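(* For $\mathrm{cobar}=\mathrm{cobar}_{(\mathrm{Set}^{\Delta^{\mathrm{op}}},\times)\to\mathcal{O}}$ there is an isomorphism $$G^{\mathrm{Kan}}\cong G\circ\mathrm{cobar}\circ\rho^*\circ\mathrm{dec}^*$$ of functors $\mathrm{Set}^{\Delta^{\mathrm{op}}}\to\mathrm{Grp}^{\Delta^{\mathrm{op}}}$.
   Context: $\mathrm{dec}^*:\mathrm{Set}^{\Delta^{\mathrm{op}}}\to\mathrm{Set}^{\Delta^{\mathrm{op}}\times\Delta^{\mathrm{op}}}$, $(\mathrm{dec}^*X)_{[a],[b]}=X_{[a]\ast[b]}$, where $[a]\ast[b]=[a+b+1]$ is concatenation; also $[a]\ast'[b]=[a+b]$ is concatenation identifying the last point of $[a]$ with the first of $[b]$, and $\Delta_{\mathrm{act}}\subset\Delta$ is the subcategory of endpoint-preserving maps. The functor $\mathrm{cobar}\circ\rho^*$ is applied in the second variable $b$, for each fixed $[a]$ (all constructions for $(\mathrm{Set}^{\Delta^{\mathrm{op}}},\times)$ are point-wise), so it suffices to define $\mathrm{cobar}\circ\rho^*:\mathrm{Set}^{\Delta^{\mathrm{op}}}\to\mathrm{Mon}$. Let $\mathcal{B}$ be the category of families of sets $(B_{[n]})_{n\ge0}$, contravariantly functorial on $\Delta_{\mathrm{act}}$, with maps $B_{[n]\ast'[m]}\to B_{[n]}\times B_{[m]}$ natural in $[n],[m]\in\Delta_{\mathrm{act}}$, coassociative and counital with respect to the counit $B_{[0]}\to\{\ast\}$ (i.e. functors of cooperads from $(\Delta_{\mathrm{act}},\ast')^{\mathrm{op}}$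 to $(\mathrm{Set},\times)^\vee$). The classical bar construction $\mathrm{bar}:\mathrm{Mon}\to\mathcal{B}$ sends a monoid $M$ to $[n]\mapsto M^n$, with active maps acting by multiplication and insertion of units, and with the canonical isomorphisms $M^{n+m}\cong M^n\times M^m$. $\mathrm{cobar}:\mathcal{B}\to\mathrm{Mon}$ is its left adjoint. $\rho^*:\mathrm{Set}^{\Delta^{\mathrm{op}}}\to\mathcal{B}$ is the equivalence sending a simplicial set $A$ to its restriction to $\Delta_{\mathrm{act}}$ with the maps $A_{[n]\ast'[m]}\to A_{[n]}\times A_{[m]}$ given by the faces to the first $n+1$ and the last $m+1$ vertices. $G:\mathrm{Mon}\to\mathrm{Grp}$ is group completion (applied point-wise). Kan's loop group of a simplicial set $X$ is the simplicial group $G^{\mathrm{Kan}}(X)_{[k]}=F(X_{[k+1]})/F(X_{[k]})$, where $F$ is the free group functor and the quotient imposes $s_k(y)\sim1$ for all $y\in X_{[k]}$ ($s_k:X_{[k]}\to X_{[k+1]}$ the last degeneracy), with faces determined on generators $x\in X_{[k+1]}$ by $\delta_i'(x)=\delta_i x$ for $i<k$ and $\delta_k'(x)=(\delta_kx)(\delta_{k+1}x)^{-1}$, and degeneracies $s_i'(x)=s_ix$, $0\le i\le k$. *)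

theory Defs
  imports "HOL-Algebra.Coset" "HOL-Library.FuncSet" "HOL-Library.Infinite_Typeclass"
begin

text \<open>
  A type \<open>'u\<close> of class \<open>infinite\<close> plays the role of the universe: the objects of
  \<open>Set\<close>, \<open>Mon\<close>, \<open>Grp\<close> are the sets, monoids, groups with elements in \<open>'u\<close>.  Because \<open>'u\<close> is
  infinite, it is large enough for the left adjoints used below to exist (see the lemmas
  \<open>ex_left_adjoint_of_bar\<close> and \<open>ex_group_completion\<close> at the end).
  Maps between sets are only meaningful on the carriers.
\<close>

section \<open>The category \<open>\<Delta>\<close>\<close>

text \<open>The object \<open>[n]\<close> is \<open>{..n}\<close>; morphisms are extensional functions.\<close>

definition Delta :: "nat \<Rightarrow> nat \<Rightarrow> (nat \<Rightarrow> nat) set" where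
  "Delta m n = {f \<in> {..m} \<rightarrow>\<^sub>E {..n}. mono_on {..m} f}"

definition Delta_act :: "nat \<Rightarrow> nat \<Rightarrow> (nat \<Rightarrow> nat) set" where
  "Delta_act m n = {f \<in> Delta m n. f 0 = 0 \<and> f m = n}"

definition idD :: "nat \<Rightarrow> nat \<Rightarrow> nat" where
  "idD n = (\<lambda>i\<in>{..n}. i)"

text \<open>\<open>join a' a b' f g\<close> is \<open>f \<ast> g : [a'] \<ast> [b'] \<rightarrow> [a] \<ast> [b]\<close>.\<close>

definition join :: "nat \<Rightarrow> nat \<Rightarrow> nat \<Rightarrow> (nat \<Rightarrow> nat) \<Rightarrow> (nat \<Rightarrow> nat) \<Rightarrow> nat \<Rightarrow> nat" where
  "join a' a b' f g =
     (\<lambda>i\<in>{..a' + b' + 1}. if i \<le> a' then f i else a + 1 + g (i - (a' + 1)))"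

text \<open>\<open>glue n' n m' f g\<close> is \<open>f \<ast>' g : [n'] \<ast>' [m'] \<rightarrow> [n] \<ast>' [m]\<close> for active \<open>f\<close>, \<open>g\<close>.\<close>

definition glue :: "nat \<Rightarrow> nat \<Rightarrow> nat \<Rightarrow> (nat \<Rightarrow> nat) \<Rightarrow> (nat \<Rightarrow> nat) \<Rightarrow> nat \<Rightarrow> nat" where
  "glue n' n m' f g = (\<lambda>i\<in>{..n' + m'}. if i \<le> n' then f i else n + g (i - n'))"

definition coface :: "nat \<Rightarrow> nat \<Rightarrow> nat \<Rightarrow> nat" where
  "coface n i = (\<lambda>j\<in>{..n}. if j < i then j else Suc j)"

definition codegen :: "nat \<Rightarrow> nat \<Rightarrow> nat \<Rightarrow> nat" where
  "codegen n i = (\<lambda>j\<in>{..Suc n}. if j \<le> i then j else j - 1)"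


section \<open>Simplicial and bisimplicial sets\<close>

text \<open>\<open>sact X m n f : X\<^bsub>[n]\<^esub> \<rightarrow> X\<^bsub>[m]\<^esub>\<close> is the action of \<open>f : [m] \<rightarrow> [n]\<close>.\<close>

record 'a sset =
  cells :: "nat \<Rightarrow> 'a set"
  sact :: "nat \<Rightarrow> nat \<Rightarrow> (nat \<Rightarrow> nat) \<Rightarrow> 'a \<Rightarrow> 'a"

definition simplicial_set :: "'a sset \<Rightarrow> bool" where
  "simplicial_set X \<longleftrightarrow>
     (\<forall>m n. \<forall>f\<in>Delta m n. sact X m n f \<in> cells X n \<rightarrow> cells X m) \<and>
     (\<forall>n. \<forall>x\<in>cells X n. sact X n n (idD n) x = x) \<and>
     (\<forall>l m n. \<forall>f\<in>Delta l m. \<forall>g\<in>Delta m n. \<forall>x\<in>cells X n.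
        sact X l m f (sact X m n g x) = sact X l n (compose {..l} g f) x)"

definition sset_hom :: "'a sset \<Rightarrow> 'b sset \<Rightarrow> (nat \<Rightarrow> 'a \<Rightarrow> 'b) set" where
  "sset_hom X Y = {\<phi>.
     (\<forall>n. \<phi> n \<in> cells X n \<rightarrow> cells Y n) \<and>
     (\<forall>m n. \<forall>f\<in>Delta m n. \<forall>x\<in>cells X n. \<phi> m (sact X m n f x) = sact Y m n f (\<phi> n x))}"

text \<open>The face \<open>\<delta>\<^sub>i : X\<^bsub>[n+1]\<^esub> \<rightarrow> X\<^bsub>[n]\<^esub>\<close> and the degeneracy \<open>s\<^sub>i : X\<^bsub>[n]\<^esub> \<rightarrow> X\<^bsub>[n+1]\<^esub>\<close>.\<close>

definition sface :: "'a sset \<Rightarrow> nat \<Rightarrow> nat \<Rightarrow> 'a \<Rightarrow> 'a" where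
  "sface X n i = sact X n (Suc n) (coface n i)"

definition sdegen :: "'a sset \<Rightarrow> nat \<Rightarrow> nat \<Rightarrow> 'a \<Rightarrow> 'a" where
  "sdegen X n i = sact X (Suc n) n (codegen n i)"

text \<open>\<open>biact Y a' a f b' b g : Y\<^bsub>[a],[b]\<^esub> \<rightarrow> Y\<^bsub>[a'],[b']\<^esub>\<close> is the action of
  \<open>f : [a'] \<rightarrow> [a]\<close> and \<open>g : [b'] \<rightarrow> [b]\<close>.\<close>

record 'a bisset =
  bicells :: "nat \<Rightarrow> nat \<Rightarrow> 'a set"
  biact :: "nat \<Rightarrow> nat \<Rightarrow> (nat \<Rightarrow> nat) \<Rightarrow> nat \<Rightarrow> nat \<Rightarrow> (nat \<Rightarrow> nat) \<Rightarrow> 'a \<Rightarrow> 'a"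

definition row :: "'a bisset \<Rightarrow> nat \<Rightarrow> 'a sset" where
  "row Y a = \<lparr>cells = bicells Y a, sact = (\<lambda>b' b g. biact Y a a (idD a) b' b g)\<rparr>"

definition row_act ::
  "'a bisset \<Rightarrow> nat \<Rightarrow> nat \<Rightarrow> (nat \<Rightarrow> nat) \<Rightarrow> nat \<Rightarrow> 'a \<Rightarrow> 'a" where
  "row_act Y a' a f = (\<lambda>b. biact Y a' a f b b (idD b))"

definition dec :: "'a sset \<Rightarrow> 'a bisset" where
  "dec X = \<lparr>bicells = (\<lambda>a b. cells X (a + b + 1)),
     biact = (\<lambda>a' a f b' b g. sact X (a' + b' + 1) (a + b + 1) (join a' a b' f g))\<rparr>"

definition dec_map :: "(nat \<Rightarrow> 'a \<Rightarrow> 'b) \<Rightarrow> nat \<Rightarrow> nat \<Rightarrow> 'a \<Rightarrow> 'b" where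
  "dec_map \<phi> = (\<lambda>a b. \<phi> (a + b + 1))"


section \<open>The category \<open>\<B>\<close>, \<open>\<rho>\<^sup>*\<close> and the bar construction\<close>

text \<open>\<open>bact B m n f : B\<^bsub>[n]\<^esub> \<rightarrow> B\<^bsub>[m]\<^esub>\<close> for active \<open>f : [m] \<rightarrow> [n]\<close>, and
  \<open>bsplit B n m : B\<^bsub>[n] \<ast>' [m]\<^esub> \<rightarrow> B\<^bsub>[n]\<^esub> \<times> B\<^bsub>[m]\<^esub>\<close>.\<close>

record 'a bobj =
  bcells :: "nat \<Rightarrow> 'a set"
  bact :: "nat \<Rightarrow> nat \<Rightarrow> (nat \<Rightarrow> nat) \<Rightarrow> 'a \<Rightarrow> 'a"
  bsplit :: "nat \<Rightarrow> nat \<Rightarrow> 'a \<Rightarrow> 'a \<times> 'a"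

definition B_object :: "'a bobj \<Rightarrow> bool" where
  "B_object B \<longleftrightarrow>
     (\<forall>m n. \<forall>f\<in>Delta_act m n. bact B m n f \<in> bcells B n \<rightarrow> bcells B m) \<and>
     (\<forall>n. \<forall>x\<in>bcells B n. bact B n n (idD n) x = x) \<and>
     (\<forall>l m n. \<forall>f\<in>Delta_act l m. \<forall>g\<in>Delta_act m n. \<forall>x\<in>bcells B n.
        bact B l m f (bact B m n g x) = bact B l n (compose {..l} g f) x) \<and>
     (\<forall>n m. bsplit B n m \<in> bcells B (n + m) \<rightarrow> bcells B n \<times> bcells B m) \<and>
     (\<forall>n' n m' m. \<forall>f\<in>Delta_act n' n. \<forall>g\<in>Delta_act m' m. \<forall>x\<in>bcells B (n + m).
        bsplit B n' m' (bact B (n' + m') (n + m) (glue n' n m' f g) x) =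
          map_prod (bact B n' n f) (bact B m' m g) (bsplit B n m x)) \<and>
     (\<forall>n m p. \<forall>x\<in>bcells B (n + m + p).
        (\<lambda>((u, v), w). (u, v, w)) (map_prod (bsplit B n m) id (bsplit B (n + m) p x)) =
          map_prod id (bsplit B m p) (bsplit B n (m + p) x)) \<and>
     (\<forall>n. \<forall>x\<in>bcells B n. snd (bsplit B 0 n x) = x \<and> fst (bsplit B n 0 x) = x)"

definition B_hom :: "'a bobj \<Rightarrow> 'b bobj \<Rightarrow> (nat \<Rightarrow> 'a \<Rightarrow> 'b) set" where
  "B_hom B B' = {\<phi>.
     (\<forall>n. \<phi> n \<in> bcells B n \<rightarrow> bcells B' n) \<and>
     (\<forall>m n. \<forall>f\<in>Delta_act m n. \<forall>x\<in>bcells B n. \<phi> m (bact B m n f x) = bact B' m n f (\<phi> n x)) \<and>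
     (\<forall>n m. \<forall>x\<in>bcells B (n + m).
        bsplit B' n m (\<phi> (n + m) x) = map_prod (\<phi> n) (\<phi> m) (bsplit B n m x))}"

text \<open>On morphisms \<open>\<rho>\<^sup>*\<close> does not change the underlying family of maps.\<close>

definition rho :: "'a sset \<Rightarrow> 'a bobj" where
  "rho A = \<lparr>bcells = cells A, bact = sact A,
     bsplit = (\<lambda>n m x. (sact A n (n + m) (\<lambda>i\<in>{..n}. i) x, sact A m (n + m) (\<lambda>i\<in>{..m}. n + i) x))\<rparr>"

definition rho_map :: "(nat \<Rightarrow> 'a \<Rightarrow> 'b) \<Rightarrow> nat \<Rightarrow> 'a \<Rightarrow> 'b" where
  "rho_map \<phi> = \<phi>"

text \<open>Unlike \<^const>\<open>hom\<close>, homomorphisms of monoids have to preserve the unit.\<close>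

definition mon_hom :: "('a, 'c) monoid_scheme \<Rightarrow> ('b, 'd) monoid_scheme \<Rightarrow> ('a \<Rightarrow> 'b) set" where
  "mon_hom M N = {h \<in> hom M N. h \<one>\<^bsub>M\<^esub> = \<one>\<^bsub>N\<^esub>}"

definition mprod :: "('a, 'c) monoid_scheme \<Rightarrow> 'a list \<Rightarrow> 'a" where
  "mprod M xs = foldr (mult M) xs \<one>\<^bsub>M\<^esub>"

text \<open>\<open>M\<^sup>n\<close> consists of the lists of length \<open>n\<close>, the entry \<open>xs ! i\<close> belonging to the edge
  \<open>i \<rightarrow> i + 1\<close> of \<open>[n]\<close>.  An active \<open>f\<close> sends \<open>xs\<close> to the list of the products of the entries
  over \<open>f j \<rightarrow> f (j + 1)\<close>.\<close>

definition bar :: "('a, 'c) monoid_scheme \<Rightarrow> 'a list bobj" where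
  "bar M = \<lparr>bcells = (\<lambda>n. {xs. length xs = n \<and> set xs \<subseteq> carrier M}),
     bact = (\<lambda>m n f xs. map (\<lambda>j. mprod M (map (\<lambda>i. xs ! i) [f j..<f (Suc j)])) [0..<m]),
     bsplit = (\<lambda>n m xs. (take n xs, drop n xs))\<rparr>"

definition bar_map :: "('a \<Rightarrow> 'b) \<Rightarrow> nat \<Rightarrow> 'a list \<Rightarrow> 'b list" where
  "bar_map h = (\<lambda>n. map h)"


section \<open>Left adjoints: the cobar construction and group completion\<close>

text \<open>A functor \<open>C : \<B> \<rightarrow> Mon\<close> is left adjoint to \<^const>\<open>bar\<close>; the adjunction is given by its
  unit, a natural transformation with the usual universal property.\<close>

locale left_adjoint_of_bar =
  fixes C :: "'u::infinite bobj \<Rightarrow> 'u monoid"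
    and Cmap :: "'u bobj \<Rightarrow> 'u bobj \<Rightarrow> (nat \<Rightarrow> 'u \<Rightarrow> 'u) \<Rightarrow> 'u \<Rightarrow> 'u"
  assumes C_monoid: "B_object B \<Longrightarrow> monoid (C B)"
    and Cmap_hom: "\<lbrakk>B_object B; B_object B'; \<phi> \<in> B_hom B B'\<rbrakk>
      \<Longrightarrow> Cmap B B' \<phi> \<in> mon_hom (C B) (C B')"
    and Cmap_id: "\<lbrakk>B_object B; y \<in> carrier (C B)\<rbrakk> \<Longrightarrow> Cmap B B (\<lambda>n x. x) y = y"
    and Cmap_comp: "\<lbrakk>B_object B; B_object B'; B_object B''; \<phi> \<in> B_hom B B'; \<psi> \<in> B_hom B' B'';
        y \<in> carrier (C B)\<rbrakk>
      \<Longrightarrow> Cmap B B'' (\<lambda>n. \<psi> n \<circ> \<phi> n) y = Cmap B' B'' \<psi> (Cmap B B' \<phi> y)"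
    and adjunction: "\<exists>\<eta>.
        (\<forall>B. B_object B \<longrightarrow> \<eta> B \<in> B_hom B (bar (C B))) \<and>
        (\<forall>B B' \<phi>. B_object B \<longrightarrow> B_object B' \<longrightarrow> \<phi> \<in> B_hom B B' \<longrightarrow>
           (\<forall>n. \<forall>x\<in>bcells B n. bar_map (Cmap B B' \<phi>) n (\<eta> B n x) = \<eta> B' n (\<phi> n x))) \<and>
        (\<forall>B M \<phi>. B_object B \<longrightarrow> monoid (M :: 'u monoid) \<longrightarrow> \<phi> \<in> B_hom B (bar M) \<longrightarrow>
           (\<exists>!h. h \<in> mon_hom (C B) M \<and> h \<in> extensional (carrier (C B)) \<and>
              (\<forall>n. \<forall>x\<in>bcells B n. bar_map h n (\<eta> B n x) = \<phi> n x)))"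

text \<open>A functor \<open>G : Mon \<rightarrow> Grp\<close> is left adjoint to the inclusion.\<close>

locale group_completion =
  fixes G :: "'u::infinite monoid \<Rightarrow> 'u monoid"
    and Gmap :: "'u monoid \<Rightarrow> 'u monoid \<Rightarrow> ('u \<Rightarrow> 'u) \<Rightarrow> 'u \<Rightarrow> 'u"
  assumes G_group: "monoid M \<Longrightarrow> group (G M)"
    and Gmap_hom: "\<lbrakk>monoid M; monoid N; h \<in> mon_hom M N\<rbrakk> \<Longrightarrow> Gmap M N h \<in> hom (G M) (G N)"
    and Gmap_id: "\<lbrakk>monoid M; y \<in> carrier (G M)\<rbrakk> \<Longrightarrow> Gmap M M (\<lambda>x. x) y = y"
    and Gmap_comp: "\<lbrakk>monoid M; monoid N; monoid L; h \<in> mon_hom M N; k \<in> mon_hom N L;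
        y \<in> carrier (G M)\<rbrakk>
      \<Longrightarrow> Gmap M L (k \<circ> h) y = Gmap N L k (Gmap M N h y)"
    and adjunction: "\<exists>\<iota>.
        (\<forall>M. monoid M \<longrightarrow> \<iota> M \<in> mon_hom M (G M)) \<and>
        (\<forall>M N h. monoid M \<longrightarrow> monoid N \<longrightarrow> h \<in> mon_hom M N \<longrightarrow>
           (\<forall>x\<in>carrier M. Gmap M N h (\<iota> M x) = \<iota> N (h x))) \<and>
        (\<forall>M H f. monoid M \<longrightarrow> group (H :: 'u monoid) \<longrightarrow> f \<in> mon_hom M H \<longrightarrow>
           (\<exists>!h. h \<in> hom (G M) H \<and> h \<in> extensional (carrier (G M)) \<and>
              (\<forall>x\<in>carrier M. h (\<iota> M x) = f x)))"


section \<open>Simplicial groups\<close>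

text \<open>Simplicial groups are presented by faces \<open>gface \<Gamma> k i : \<Gamma>\<^bsub>[k+1]\<^esub> \<rightarrow> \<Gamma>\<^bsub>[k]\<^esub>\<close> and degeneracies
  \<open>gdegen \<Gamma> k i : \<Gamma>\<^bsub>[k]\<^esub> \<rightarrow> \<Gamma>\<^bsub>[k+1]\<^esub>\<close>, which generate the action of \<open>\<Delta>\<close>.\<close>

record 'g sgroup =
  gcells :: "nat \<Rightarrow> 'g monoid"
  gface :: "nat \<Rightarrow> nat \<Rightarrow> 'g \<Rightarrow> 'g"
  gdegen :: "nat \<Rightarrow> nat \<Rightarrow> 'g \<Rightarrow> 'g"

definition sgroup_iso :: "'g sgroup \<Rightarrow> 'h sgroup \<Rightarrow> (nat \<Rightarrow> 'g \<Rightarrow> 'h) set" where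
  "sgroup_iso \<Gamma> \<Gamma>' = {\<Phi>.
     (\<forall>k. \<Phi> k \<in> iso (gcells \<Gamma> k) (gcells \<Gamma>' k)) \<and>
     (\<forall>k. \<forall>i\<le>Suc k. \<forall>c\<in>carrier (gcells \<Gamma> (Suc k)).
        \<Phi> k (gface \<Gamma> k i c) = gface \<Gamma>' k i (\<Phi> (Suc k) c)) \<and>
     (\<forall>k. \<forall>i\<le>k. \<forall>c\<in>carrier (gcells \<Gamma> k).
        \<Phi> (Suc k) (gdegen \<Gamma> k i c) = gdegen \<Gamma>' k i (\<Phi> k c))}"


section \<open>Kan's loop group\<close>

text \<open>Elements of the free group on \<open>S\<close> are classes of words; the letter \<open>(True, x)\<close> stands for
  \<open>x\<close> and \<open>(False, x)\<close> for its inverse.\<close>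

inductive_set word_rel :: "'a set \<Rightarrow> ((bool \<times> 'a) list \<times> (bool \<times> 'a) list) set"
  for S :: "'a set" where
    refl: "w \<in> lists (UNIV \<times> S) \<Longrightarrow> (w, w) \<in> word_rel S"
  | sym: "(v, w) \<in> word_rel S \<Longrightarrow> (w, v) \<in> word_rel S"
  | trans: "\<lbrakk>(u, v) \<in> word_rel S; (v, w) \<in> word_rel S\<rbrakk> \<Longrightarrow> (u, w) \<in> word_rel S"
  | cancel: "\<lbrakk>u \<in> lists (UNIV \<times> S); v \<in> lists (UNIV \<times> S); x \<in> S\<rbrakk>
      \<Longrightarrow> (u @ [(e, x), (\<not> e, x)] @ v, u @ v) \<in> word_rel S"

definition free_group :: "'a set \<Rightarrow> (bool \<times> 'a) list set monoid" where
  "free_group S = \<lparr>carrier = lists (UNIV \<times> S) // word_rel S,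
     mult = (\<lambda>A B. \<Union>u\<in>A. \<Union>v\<in>B. word_rel S `` {u @ v}),
     one = word_rel S `` {[]}\<rparr>"

definition free_gen :: "'a set \<Rightarrow> 'a \<Rightarrow> (bool \<times> 'a) list set" where
  "free_gen S x = word_rel S `` {[(True, x)]}"

definition word_eval :: "('g, 'c) monoid_scheme \<Rightarrow> ('a \<Rightarrow> 'g) \<Rightarrow> (bool \<times> 'a) list \<Rightarrow> 'g" where
  "word_eval H f w = mprod H (map (\<lambda>(e, x). if e then f x else inv\<^bsub>H\<^esub> (f x)) w)"

definition normal_closure :: "('g, 'c) monoid_scheme \<Rightarrow> 'g set \<Rightarrow> 'g set" where
  "normal_closure H R = \<Inter>{N. N \<lhd> H \<and> R \<subseteq> N}"

text \<open>The homomorphism from a quotient of a free group determined by its values on generators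
  (it is constant on classes in all uses below).\<close>

definition gen_ext ::
  "('g, 'c) monoid_scheme \<Rightarrow> ('a \<Rightarrow> 'g) \<Rightarrow> (bool \<times> 'a) list set set \<Rightarrow> 'g" where
  "gen_ext H f c = the_elem ((\<lambda>A. the_elem (word_eval H f ` A)) ` c)"

definition kan_rel :: "'a sset \<Rightarrow> nat \<Rightarrow> (bool \<times> 'a) list set set" where
  "kan_rel X k = normal_closure (free_group (cells X (Suc k)))
     ((\<lambda>y. free_gen (cells X (Suc k)) (sdegen X k k y)) ` cells X k)"

definition kan_grp :: "'a sset \<Rightarrow> nat \<Rightarrow> (bool \<times> 'a) list set set monoid" where
  "kan_grp X k = free_group (cells X (Suc k)) Mod kan_rel X k"

definition kan_gen :: "'a sset \<Rightarrow> nat \<Rightarrow> 'a \<Rightarrow> (bool \<times> 'a) list set set" where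
  "kan_gen X k x =
     kan_rel X k #>\<^bsub>free_group (cells X (Suc k))\<^esub> free_gen (cells X (Suc k)) x"

text \<open>The face \<open>gface (kan_loop X) k i\<close> starts in degree \<open>k + 1\<close>, so the last one is \<open>i = k + 1\<close>.\<close>

definition kan_loop :: "'a sset \<Rightarrow> (bool \<times> 'a) list set set sgroup" where
  "kan_loop X = \<lparr>gcells = kan_grp X,
     gface = (\<lambda>k i. gen_ext (kan_grp X k)
       (\<lambda>x. if i < Suc k then kan_gen X k (sface X (Suc k) i x)
            else kan_gen X k (sface X (Suc k) (Suc k) x)
              \<otimes>\<^bsub>kan_grp X k\<^esub> inv\<^bsub>kan_grp X k\<^esub> kan_gen X k (sface X (Suc k) (Suc (Suc k)) x))),
     gdegen = (\<lambda>k i. gen_ext (kan_grp X (Suc k))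
       (\<lambda>x. kan_gen X (Suc k) (sdegen X (Suc k) i x)))\<rparr>"

definition kan_loop_map :: "'b sset \<Rightarrow> (nat \<Rightarrow> 'a \<Rightarrow> 'b) \<Rightarrow>
    nat \<Rightarrow> (bool \<times> 'a) list set set \<Rightarrow> (bool \<times> 'b) list set set" where
  "kan_loop_map Y \<phi> k = gen_ext (kan_grp Y k) (\<lambda>x. kan_gen Y k (\<phi> (Suc k) x))"


section \<open>The composite \<open>G \<circ> cobar \<circ> \<rho>\<^sup>* \<circ> dec\<^sup>*\<close>\<close>

text \<open>For fixed \<open>a\<close> the functors \<open>\<rho>\<^sup>*\<close>, \<open>C\<close> and \<open>G\<close> are applied to the simplicial set
  \<open>b \<mapsto> (dec\<^sup>* X)\<^bsub>[a],[b]\<^esub>\<close>; \<open>decloop_act \<dots> a' a f\<close> is the action of \<open>f : [a'] \<rightarrow> [a]\<close>.\<close>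

definition decloop_act ::
  "('u monoid \<Rightarrow> 'u monoid \<Rightarrow> ('u \<Rightarrow> 'u) \<Rightarrow> 'u \<Rightarrow> 'u) \<Rightarrow> ('u bobj \<Rightarrow> 'u monoid) \<Rightarrow>
   ('u bobj \<Rightarrow> 'u bobj \<Rightarrow> (nat \<Rightarrow> 'u \<Rightarrow> 'u) \<Rightarrow> 'u \<Rightarrow> 'u) \<Rightarrow> 'u sset \<Rightarrow>
   nat \<Rightarrow> nat \<Rightarrow> (nat \<Rightarrow> nat) \<Rightarrow> 'u \<Rightarrow> 'u" where
  "decloop_act Gmap C Cmap X a' a f =
     Gmap (C (rho (row (dec X) a))) (C (rho (row (dec X) a')))
       (Cmap (rho (row (dec X) a)) (rho (row (dec X) a')) (rho_map (row_act (dec X) a' a f)))"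

definition decloop ::
  "('u monoid \<Rightarrow> 'u monoid) \<Rightarrow> ('u monoid \<Rightarrow> 'u monoid \<Rightarrow> ('u \<Rightarrow> 'u) \<Rightarrow> 'u \<Rightarrow> 'u) \<Rightarrow>
   ('u bobj \<Rightarrow> 'u monoid) \<Rightarrow> ('u bobj \<Rightarrow> 'u bobj \<Rightarrow> (nat \<Rightarrow> 'u \<Rightarrow> 'u) \<Rightarrow> 'u \<Rightarrow> 'u) \<Rightarrow>
   'u sset \<Rightarrow> 'u sgroup" where
  "decloop G Gmap C Cmap X = \<lparr>gcells = (\<lambda>a. G (C (rho (row (dec X) a)))),
     gface = (\<lambda>k i. decloop_act Gmap C Cmap X k (Suc k) (coface k i)),
     gdegen = (\<lambda>k i. decloop_act Gmap C Cmap X (Suc k) k (codegen k i))\<rparr>"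

definition decloop_map ::
  "('u monoid \<Rightarrow> 'u monoid \<Rightarrow> ('u \<Rightarrow> 'u) \<Rightarrow> 'u \<Rightarrow> 'u) \<Rightarrow> ('u bobj \<Rightarrow> 'u monoid) \<Rightarrow>
   ('u bobj \<Rightarrow> 'u bobj \<Rightarrow> (nat \<Rightarrow> 'u \<Rightarrow> 'u) \<Rightarrow> 'u \<Rightarrow> 'u) \<Rightarrow> 'u sset \<Rightarrow> 'u sset \<Rightarrow>
   (nat \<Rightarrow> 'u \<Rightarrow> 'u) \<Rightarrow> nat \<Rightarrow> 'u \<Rightarrow> 'u" where
  "decloop_map Gmap C Cmap X Y \<phi> a =
     Gmap (C (rho (row (dec X) a))) (C (rho (row (dec Y) a)))
       (Cmap (rho (row (dec X) a)) (rho (row (dec Y) a)) (rho_map (dec_map \<phi> a)))"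


section \<open>The functors are well-defined\<close>

lemma idD_Delta: "idD n \<in> Delta n n"
  by (auto simp: idD_def Delta_def mono_on_def)

lemma Delta_le: "f \<in> Delta m n \<Longrightarrow> i \<le> m \<Longrightarrow> f i \<le> n"
  by (auto simp: Delta_def)

lemma Delta_mono: "f \<in> Delta m n \<Longrightarrow> i \<le> j \<Longrightarrow> j \<le> m \<Longrightarrow> f i \<le> f j"
  by (auto simp: Delta_def mono_on_def)

lemma join_Delta:
  assumes "f \<in> Delta a' a" "g \<in> Delta b' b"
  shows "join a' a b' f g \<in> Delta (a' + b' + 1) (a + b + 1)"
proof -
  have "join a' a b' f g i \<le> a + b + 1" if "i \<le> a' + b' + 1" for i
    using that Delta_le[OF assms(1), of i] Delta_le[OF assms(2), of "i - (a' + 1)"]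
    by (auto simp: join_def)
  moreover have "join a' a b' f g i \<le> join a' a b' f g j" if "i \<le> j" "j \<le> a' + b' + 1" for i j
    using that Delta_le[OF assms(1), of i] Delta_mono[OF assms(1), of i j]
      Delta_mono[OF assms(2), of "i - (a' + 1)" "j - (a' + 1)"]
    by (auto simp: join_def)
  ultimately show ?thesis by (auto simp: Delta_def mono_on_def join_def[of a'] PiE_def)
qed

lemma join_comp:
  assumes "f \<in> Delta a'' a'" "g \<in> Delta b'' b'"
  shows "compose {..a'' + b'' + 1} (join a' a b' f' g') (join a'' a' b'' f g)
     = join a'' a b'' (compose {..a''} f' f) (compose {..b''} g' g)"
  using Delta_le[OF assms(1)] Delta_le[OF assms(2)]
  by (fastforce simp: compose_def join_def fun_eq_iff)

lemma join_id: "join a a b (idD a) (idD b) = idD (a + b + 1)"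
  by (auto simp: join_def idD_def fun_eq_iff)

lemma idD_comp: "f \<in> Delta m n \<Longrightarrow> compose {..m} (idD n) f = f" "f \<in> Delta m n \<Longrightarrow> compose {..m} f (idD m) = f"
  by (auto simp: compose_def idD_def Delta_def fun_eq_iff PiE_def extensional_def Pi_def)

lemma sset_row_dec:
  assumes "simplicial_set X"
  shows "simplicial_set (row (dec X) a)"
proof -
  note X = assms[unfolded simplicial_set_def]
  show ?thesis
    unfolding simplicial_set_def
  proof (intro conjI allI ballI)
    show "sact (row (dec X) a) m n f \<in> cells (row (dec X) a) n \<rightarrow> cells (row (dec X) a) m" if "f \<in> Delta m n" for m n f
      using X join_Delta[OF idD_Delta that] by (simp add: row_def dec_def)
    show "sact (row (dec X) a) n n (idD n) x = x" if "x \<in> cells (row (dec X) a) n" for n x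
      using X that by (simp add: row_def dec_def join_id)
    show "sact (row (dec X) a) l m f (sact (row (dec X) a) m n g x) = sact (row (dec X) a) l n (compose {..l} g f) x"
      if "f \<in> Delta l m" "g \<in> Delta m n" "x \<in> cells (row (dec X) a) n" for l m n f g x
      using X join_Delta[OF idD_Delta[of a] that(1)] join_Delta[OF idD_Delta[of a] that(2)] that(3)
        join_comp[OF idD_Delta[of a] that(1), of a "idD a" g] 
      by (simp add: row_def dec_def idD_comp[OF idD_Delta])
  qed
qed

lemma row_act_dec:
  assumes "simplicial_set X" and h: "h \<in> Delta a' a"
  shows "row_act (dec X) a' a h \<in> sset_hom (row (dec X) a) (row (dec X) a')"
proof -
  note X = assms(1)[unfolded simplicial_set_def]
  show ?thesis unfolding sset_hom_def
  proof (intro CollectI conjI allI ballI)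
    show "row_act (dec X) a' a h n \<in> cells (row (dec X) a) n \<rightarrow> cells (row (dec X) a') n" for n
      using X join_Delta[OF h idD_Delta] by (simp add: row_def dec_def row_act_def)
    show "row_act (dec X) a' a h m (sact (row (dec X) a) m n f x) = sact (row (dec X) a') m n f (row_act (dec X) a' a h n x)"
      if f: "f \<in> Delta m n" and x: "x \<in> cells (row (dec X) a) n" for m n f x
      using X x join_Delta[OF h idD_Delta] join_Delta[OF idD_Delta f]
         join_comp[OF h idD_Delta[of m], of a "idD a" f] join_comp[OF idD_Delta[of a'] f, of a h "idD n"]
      by (simp add: row_def dec_def row_act_def idD_comp[OF h] idD_comp[OF f])
  qed
qed

lemma B_object_rho:
  assumes "simplicial_set A"
  shows "B_object (rho A)"
proof -
  note A = assms[unfolded simplicial_set_def]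
  have d: "(\<lambda>i\<in>{..n}. i) \<in> Delta n (n + m)" "(\<lambda>i\<in>{..m}. n + i) \<in> Delta m (n + m)" for n m
    by (auto simp: Delta_def mono_on_def)
  have ac: "sact A m n f x \<in> cells A m" if "f \<in> Delta m n" "x \<in> cells A n" for m n f x
    using A that by (auto simp: Pi_iff)
  have co: "sact A l m f (sact A m n g x) = sact A l n (compose {..l} g f) x"
    if "f \<in> Delta l m" "g \<in> Delta m n" "x \<in> cells A n" for l m n f g x
    using A that by blast
  show ?thesis
    unfolding B_object_def
  proof (intro conjI allI ballI)
    fix n' n m' m f g x
    assume f: "f \<in> Delta_act n' n" and g: "g \<in> Delta_act m' m" and x: "x \<in> bcells (rho A) (n + m)"
    have f': "f \<in> Delta n' n" and g': "g \<in> Delta m' m" and f0: "f n' = n" "g 0 = 0" using f g by (auto simp: Delta_act_def)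
    have gl: "glue n' n m' f g \<in> Delta (n' + m') (n + m)"
    proof -
      have "glue n' n m' f g i \<le> n + m" if "i \<le> n' + m'" for i
        using that Delta_le[OF f', of i] Delta_le[OF g', of "i - n'"] by (auto simp: glue_def)
      moreover have "glue n' n m' f g i \<le> glue n' n m' f g j" if "i \<le> j" "j \<le> n' + m'" for i j
        using that Delta_le[OF f', of i] Delta_mono[OF f', of i j]
          Delta_mono[OF g', of "i - n'" "j - n'"] by (auto simp: glue_def)
      ultimately show ?thesis by (auto simp: Delta_def mono_on_def glue_def[of n'] PiE_def)
    qed
    have 1: "compose {..n'} (glue n' n m' f g) (\<lambda>i\<in>{..n'}. i) = compose {..n'} (\<lambda>i\<in>{..n}. i) f"
      using Delta_le[OF f'] by (auto simp: compose_def glue_def fun_eq_iff)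
    have 2: "compose {..m'} (glue n' n m' f g) (\<lambda>i\<in>{..m'}. n' + i) = compose {..m'} (\<lambda>i\<in>{..m}. n + i) g"
      using Delta_le[OF g'] f0 by (auto simp: compose_def glue_def fun_eq_iff)
    show "bsplit (rho A) n' m' (bact (rho A) (n' + m') (n + m) (glue n' n m' f g) x) =
          map_prod (bact (rho A) n' n f) (bact (rho A) m' m g) (bsplit (rho A) n m x)"
      using x by (simp add: rho_def co[OF d(1) gl] co[OF d(2) gl] co[OF f' d(1)] co[OF g' d(2)] 1 2)
  next
    fix n m p x assume x: "x \<in> bcells (rho A) (n + m + p)"
    have x': "x \<in> cells A (n + (m + p))" "x \<in> cells A (n + m + p)" using x by (auto simp: rho_def add.assoc)
    have 1: "compose {..n} (\<lambda>i\<in>{..n + m}. i) (\<lambda>i\<in>{..n}. i) = (\<lambda>i\<in>{..n}. i)"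
      "compose {..m} (\<lambda>i\<in>{..n + m}. i) (\<lambda>i\<in>{..m}. n + i) = (\<lambda>i\<in>{..m}. n + i)"
      "compose {..m} (\<lambda>i\<in>{..m + p}. n + i) (\<lambda>i\<in>{..m}. i) = (\<lambda>i\<in>{..m}. n + i)"
      "compose {..p} (\<lambda>i\<in>{..m + p}. n + i) (\<lambda>i\<in>{..p}. m + i) = (\<lambda>i\<in>{..p}. n + m + i)"
      by (auto simp: compose_def fun_eq_iff)
    have dd: "(\<lambda>i\<in>{..n + m}. i) \<in> Delta (n + m) (n + m + p)" using d(1)[of "n + m" p] .
    have de: "(\<lambda>i\<in>{..m + p}. n + i) \<in> Delta (m + p) (n + (m + p))" using d(2)[of n "m + p"] .
    have 2: "restrict ((+) (n + m)) {..p} = (\<lambda>i\<in>{..p}. n + (m + i))" by (auto simp: fun_eq_iff)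
    show "(\<lambda>((u, v), w). (u, v, w)) (map_prod (bsplit (rho A) n m) id (bsplit (rho A) (n + m) p x)) =
          map_prod id (bsplit (rho A) m p) (bsplit (rho A) n (m + p) x)"
      using co[OF d(1)[of n m] dd x'(2)] co[OF d(2)[of n m] dd x'(2)]
        co[OF d(1)[of m p] de x'(1)] co[OF d(2)[of m p] de x'(1)]
      by (simp add: rho_def 1 2 add.assoc)
  next
    fix n x assume x: "x \<in> bcells (rho A) n"
    have "restrict ((+) 0) {..n} = idD n" "(\<lambda>i\<in>{..n}. i) = idD n" by (auto simp: idD_def fun_eq_iff)
    then show "snd (bsplit (rho A) 0 n x) = x" "fst (bsplit (rho A) n 0 x) = x"
      using A x by (simp_all add: rho_def)
  qed (use A d ac in \<open>auto simp: rho_def Delta_act_def\<close>)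
qed

lemma mprod_Nil [simp]: "mprod M [] = \<one>\<^bsub>M\<^esub>"
  and mprod_Cons [simp]: "mprod M (x # xs) = x \<otimes>\<^bsub>M\<^esub> mprod M xs"
  by (simp_all add: mprod_def)

lemma (in monoid) mprod_closed [simp]: "set xs \<subseteq> carrier G \<Longrightarrow> mprod G xs \<in> carrier G"
  by (induction xs) auto

lemma (in monoid) mprod_append:
  "set xs \<subseteq> carrier G \<Longrightarrow> set ys \<subseteq> carrier G \<Longrightarrow> mprod G (xs @ ys) = mprod G xs \<otimes> mprod G ys"
  by (induction xs) (auto simp: m_assoc)

lemma mon_hom_mprod:
  assumes "h \<in> mon_hom M N" "monoid M" "set xs \<subseteq> carrier M"
  shows "h (mprod M xs) = mprod N (map h xs)"
  using assms(3)
proof (induction xs)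
  case Nil then show ?case using assms by (simp add: mon_hom_def)
next
  case (Cons x xs)
  then show ?case using assms monoid.mprod_closed[of M xs] by (simp add: mon_hom_def hom_def)
qed

lemma mprod_upt_split:
  assumes M: "monoid M" and f: "\<And>i j. i \<le> j \<Longrightarrow> j \<le> m \<Longrightarrow> f i \<le> (f j :: nat)"
    and c: "\<And>i. i < f m \<Longrightarrow> q i \<in> carrier M" and ab: "a \<le> b" "b \<le> m"
  shows "mprod M (map (\<lambda>j. mprod M (map q [f j..<f (Suc j)])) [a..<b]) = mprod M (map q [f a..<f b])"
proof -
  interpret M: monoid M by (rule M)
  have cc: "set (map q [f i..<f j]) \<subseteq> carrier M" if "j \<le> m" for i j
    using c f[OF that order_refl] by fastforce
  show ?thesis using ab
  proof (induction b)
    case 0 then show ?case by simp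
  next
    case (Suc b)
    show ?case
    proof (cases "a = Suc b")
      case False
      then have a: "a \<le> b" using Suc by simp
      have u: "[f a..<f (Suc b)] = [f a..<f b] @ [f b..<f (Suc b)]"
        using f[of a b] f[of b "Suc b"] a Suc.prems upt_add_eq_append[of "f a" "f b" "f (Suc b) - f b"] by simp
      have "mprod M (map q [f j..<f (Suc j)]) \<in> carrier M" if "j < b" for j
        using cc[of "Suc j" j] Suc.prems that by (intro M.mprod_closed) simp
      then have "set (map (\<lambda>j. mprod M (map q [f j..<f (Suc j)])) [a..<b]) \<subseteq> carrier M" by auto
      then have "mprod M (map (\<lambda>j. mprod M (map q [f j..<f (Suc j)])) [a..<Suc b]) =
        mprod M (map (\<lambda>j. mprod M (map q [f j..<f (Suc j)])) [a..<b]) \<otimes>\<^bsub>M\<^esub> mprod M (map q [f b..<f (Suc b)])"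
        using a cc[of "Suc b" b] Suc.prems by (simp add: M.mprod_append del: set_map)
      then show ?thesis
        using Suc a u cc[of b a] cc[of "Suc b" b] by (simp add: M.mprod_append del: set_map)
    qed simp
  qed
qed

lemma B_object_bar:
  assumes M: "monoid M"
  shows "B_object (bar M)"
proof -
  interpret M: monoid M by (rule M)
  have cl: "bact (bar M) m n f xs \<in> bcells (bar M) m" if f: "f \<in> Delta_act m n" and "xs \<in> bcells (bar M) n" for m n f xs
  proof -
    have "mprod M (map ((!) xs) [f j..<f (Suc j)]) \<in> carrier M" if "j < m" for j
      using f that \<open>xs \<in> _\<close> Delta_le[of f m n "Suc j"]
      by (intro M.mprod_closed) (fastforce simp: Delta_act_def bar_def subset_iff)
    then show ?thesis by (auto simp: bar_def)
  qed
  show ?thesis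
    unfolding B_object_def
  proof (intro conjI allI ballI)
    fix n and xs :: "'a list" assume xs: "xs \<in> bcells (bar M) n"
    show "bact (bar M) n n (idD n) xs = xs"
      using xs by (auto simp: bar_def idD_def subset_iff intro!: nth_equalityI)
  next
    fix l m n f g and xs :: "'a list"
    assume f: "f \<in> Delta_act l m" and g: "g \<in> Delta_act m n" and xs: "xs \<in> bcells (bar M) n"
    have f': "f \<in> Delta l m" and g': "g \<in> Delta m n" using f g by (auto simp: Delta_act_def)
    have gm: "g m = n" using g by (auto simp: Delta_act_def)
    have "mprod M (map ((!) (map (\<lambda>j. mprod M (map ((!) xs) [g j..<g (Suc j)])) [0..<m])) [f j..<f (Suc j)])
       = mprod M (map ((!) xs) [g (f j)..<g (f (Suc j))])" if j: "j < l" for j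
    proof -
      have le: "f j \<le> f (Suc j)" "f (Suc j) \<le> m" using Delta_mono[OF f'] Delta_le[OF f'] j by auto
      have m: "map ((!) (map (\<lambda>j. mprod M (map ((!) xs) [g j..<g (Suc j)])) [0..<m])) [f j..<f (Suc j)]
         = map (\<lambda>j. mprod M (map ((!) xs) [g j..<g (Suc j)])) [f j..<f (Suc j)]"
        using le by auto
      show ?thesis unfolding m
        using mprod_upt_split[where m = m and f = g and q = "(!) xs" and a = "f j" and b = "f (Suc j)",
            OF M Delta_mono[OF g']] le xs gm
        by (auto simp: bar_def subset_iff)
    qed
    then show "bact (bar M) l m f (bact (bar M) m n g xs) = bact (bar M) l n (compose {..l} g f) xs"
      by (simp add: bar_def compose_def)
  next
    fix n' n m' m f g and xs :: "'a list"
    assume f: "f \<in> Delta_act n' n" and g: "g \<in> Delta_act m' m" and xs: "xs \<in> bcells (bar M) (n + m)"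
    have f': "f \<in> Delta n' n" and g': "g \<in> Delta m' m" and e: "f n' = n" "g 0 = 0"
      using f g by (auto simp: Delta_act_def)
    let ?h = "glue n' n m' f g"
    have l: "length xs = n + m" using xs by (simp add: bar_def)
    have h1: "?h j = f j" if "j \<le> n'" for j using that by (simp add: glue_def)
    have h2: "?h (n' + j) = n + g j" if "j \<le> m'" for j using that e by (auto simp: glue_def)
    have 1: "map ((!) xs) [?h j..<?h (Suc j)] = map ((!) (take n xs)) [f j..<f (Suc j)]" if "j < n'" for j
      using that h1[of j] h1[of "Suc j"] Delta_le[OF f', of "Suc j"] by auto
    have 2: "map ((!) xs) [?h (n' + j)..<?h (Suc (n' + j))] = map ((!) (drop n xs)) [g j..<g (Suc j)]" if "j < m'" for j
      using that h2[of j] h2[of "Suc j"] Delta_le[OF g', of "Suc j"] l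
      by (intro nth_equalityI) (auto simp: nth_drop ac_simps)
    have "[0..<n' + m'] = [0..<n'] @ map (\<lambda>j. n' + j) [0..<m']"
      by (rule nth_equalityI) (auto simp: nth_append)
    then show "bsplit (bar M) n' m' (bact (bar M) (n' + m') (n + m) ?h xs) =
      map_prod (bact (bar M) n' n f) (bact (bar M) m' m g) (bsplit (bar M) n m xs)"
      using 1 2 by (simp add: bar_def del: upt_Suc)
  next
    fix n m p and xs :: "'a list"
    show "(\<lambda>((u, v), w). (u, v, w)) (map_prod (bsplit (bar M) n m) id (bsplit (bar M) (n + m) p xs)) =
          map_prod id (bsplit (bar M) m p) (bsplit (bar M) n (m + p) xs)"
      by (simp add: bar_def take_drop add.commute[of m n])
  qed (use cl in \<open>auto simp: bar_def dest: in_set_takeD in_set_dropD\<close>)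
qed


section \<open>The left adjoints exist\<close>

text \<open>The monoid congruence on words in \<open>A\<close> generated by \<open>R\<close>.\<close>

inductive_set cong_gen :: "'a set \<Rightarrow> ('a list \<times> 'a list) set \<Rightarrow> ('a list \<times> 'a list) set"
  for A :: "'a set" and R :: "('a list \<times> 'a list) set" where
    refl: "w \<in> lists A \<Longrightarrow> (w, w) \<in> cong_gen A R"
  | sym: "(v, w) \<in> cong_gen A R \<Longrightarrow> (w, v) \<in> cong_gen A R"
  | trans: "\<lbrakk>(u, v) \<in> cong_gen A R; (v, w) \<in> cong_gen A R\<rbrakk> \<Longrightarrow> (u, w) \<in> cong_gen A R"
  | rel: "\<lbrakk>(u, v) \<in> R; p \<in> lists A; q \<in> lists A\<rbrakk> \<Longrightarrow> (p @ u @ q, p @ v @ q) \<in> cong_gen A R"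

lemma cong_gen_lists:
  assumes "R \<subseteq> lists A \<times> lists A" "(u, v) \<in> cong_gen A R"
  shows "u \<in> lists A \<and> v \<in> lists A"
  using assms(2,1) by induction (auto simp: subset_iff)

lemma cong_gen_append:
  assumes R: "R \<subseteq> lists A \<times> lists A"
    and "(u, v) \<in> cong_gen A R" "(u', v') \<in> cong_gen A R"
  shows "(u @ u', v @ v') \<in> cong_gen A R"
proof -
  have l: "(p @ u, p @ v) \<in> cong_gen A R" if "(u, v) \<in> cong_gen A R" "p \<in> lists A" for u v p
    using that
  proof induction
    case (refl w) then show ?case by (intro cong_gen.refl) auto
  next
    case (rel u v p' q)
    then show ?case using cong_gen.rel[of u v R "p @ p'" A q] by auto
  qed (auto intro: cong_gen.sym cong_gen.trans)
  have r: "(u @ p, v @ p) \<in> cong_gen A R" if "(u, v) \<in> cong_gen A R" "p \<in> lists A" for u v p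
    using that
  proof induction
    case (refl w) then show ?case by (intro cong_gen.refl) auto
  next
    case (rel u v p' q)
    then show ?case using cong_gen.rel[of u v R "p'" A "q @ p"] by auto
  qed (auto intro: cong_gen.sym cong_gen.trans)
  show ?thesis
    using l[OF assms(3), of v] r[OF assms(2), of u'] cong_gen_lists[OF R] assms(2,3)
      cong_gen.trans by blast
qed

lemma presented_monoid:
  fixes A :: "'x set" and R :: "('x list \<times> 'x list) set" and g :: "'x list \<Rightarrow> 'u"
  assumes R: "R \<subseteq> lists A \<times> lists A" and g: "inj g"
  obtains P :: "'u monoid" and \<iota> where
    "monoid P" "\<iota> \<in> A \<rightarrow> carrier P"
    "\<And>u v. (u, v) \<in> R \<Longrightarrow> mprod P (map \<iota> u) = mprod P (map \<iota> v)"
    "\<And>y. y \<in> carrier P \<Longrightarrow> \<exists>w\<in>lists A. y = mprod P (map \<iota> w)"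
    "\<And>(M :: 'u monoid) f. \<lbrakk>monoid M; f \<in> A \<rightarrow> carrier M;
        \<And>u v. (u, v) \<in> R \<Longrightarrow> mprod M (map f u) = mprod M (map f v)\<rbrakk>
      \<Longrightarrow> \<exists>h\<in>mon_hom P M. \<forall>a\<in>A. h (\<iota> a) = f a"
proof -
  define E where "E = cong_gen A R"
  define r where "r w = (SOME v. (w, v) \<in> E)" for w
  define c where "c w = g (r w)" for w
  define d where "d = inv_into UNIV g"
  define P :: "'u monoid" where "P = \<lparr>carrier = c ` lists A, monoid.mult = (\<lambda>y z. c (d y @ d z)), one = c []\<rparr>"
  have dc: "(w, d (c w)) \<in> E" if "w \<in> lists A" for w
    using that g unfolding d_def c_def r_def E_def
    by (simp add: inv_f_f) (rule someI, erule cong_gen.refl)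
  have El: "u \<in> lists A \<and> v \<in> lists A" if "(u, v) \<in> E" for u v
    using cong_gen_lists[OF R] that unfolding E_def by blast
  have ceq: "c u = c v" if "(u, v) \<in> E" for u v
  proof -
    have "(\<lambda>w. (u, w) \<in> E) = (\<lambda>w. (v, w) \<in> E)"
      using that unfolding E_def by (blast intro: cong_gen.sym cong_gen.trans)
    then show ?thesis by (simp add: c_def r_def)
  qed
  have app: "(u @ u', v @ v') \<in> E" if "(u, v) \<in> E" "(u', v') \<in> E" for u v u' v'
    using cong_gen_append[OF R] that unfolding E_def by blast
  have cm: "c (d (c u) @ d (c v)) = c (u @ v)" if "u \<in> lists A" "v \<in> lists A" for u v
    using app[OF dc[OF that(1)] dc[OF that(2)]] ceq by metis
  have mult: "c u \<otimes>\<^bsub>P\<^esub> c v = c (u @ v)" if "u \<in> lists A" "v \<in> lists A" for u v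
    using cm[OF that] by (simp add: P_def)
  have mult': "c u \<otimes>\<^bsub>P\<^esub> c v = c (u @ v)" if "\<forall>x\<in>set u. x \<in> A" "\<forall>x\<in>set v. x \<in> A" for u v
    using that by (auto intro!: mult)
  have car: "carrier P = c ` lists A" and one: "\<one>\<^bsub>P\<^esub> = c []" by (simp_all add: P_def)
  have mon: "monoid P"
    by (rule monoidI) (auto simp: car one mult' ball_Un intro!: imageI)
  define \<iota> where "\<iota> a = c [a]" for a
  have pr: "mprod P (map \<iota> w) = c w" if "w \<in> lists A" for w
    using that by (induction w) (auto simp: one \<iota>_def mult')
  show ?thesis
  proof (rule that[of P \<iota>])
    show "monoid P" by (rule mon)
    show "\<iota> \<in> A \<rightarrow> carrier P" by (auto simp: \<iota>_def car)
    show "mprod P (map \<iota> u) = mprod P (map \<iota> v)" if "(u, v) \<in> R" for u v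
    proof -
      have "(u, v) \<in> E" using cong_gen.rel[OF that, of "[]" A "[]"] by (simp add: E_def)
      then show ?thesis using pr El ceq by metis
    qed
    show "\<exists>w\<in>lists A. y = mprod P (map \<iota> w)" if "y \<in> carrier P" for y
      using that pr by (auto simp: car)
    fix M :: "'u monoid" and f
    assume M: "monoid M" and f: "f \<in> A \<rightarrow> carrier M"
      and fR: "\<And>u v. (u, v) \<in> R \<Longrightarrow> mprod M (map f u) = mprod M (map f v)"
    interpret M: monoid M by (rule M)
    have fl: "set (map f w) \<subseteq> carrier M" if "w \<in> lists A" for w
      using f that by auto
    have fE: "mprod M (map f u) = mprod M (map f v)" if "(u, v) \<in> E" for u v
      using that unfolding E_def
    proof induction
      case (rel u v p q)
      then have "u \<in> lists A" "v \<in> lists A" using R by auto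
      then show ?case using fl rel fR[OF rel(1)] by (simp add: M.mprod_append del: set_map)
    qed auto
    define h where "h y = mprod M (map f (d y))" for y
    have hc: "h (c w) = mprod M (map f w)" if "w \<in> lists A" for w
      using fE[OF dc[OF that]] by (simp add: h_def)
    have "h y \<in> carrier M" if "y \<in> carrier P" for y
      using that hc fl by (force simp: car simp del: set_map)
    moreover have "h (y \<otimes>\<^bsub>P\<^esub> z) = h y \<otimes>\<^bsub>M\<^esub> h z" if yz: "y \<in> carrier P" "z \<in> carrier P" for y z
    proof -
      obtain u v where "y = c u" "u \<in> lists A" "z = c v" "v \<in> lists A"
        using yz unfolding car by blast
      then show ?thesis using fl by (simp add: mult hc M.mprod_append del: set_map in_lists_conv_set)
    qed
    ultimately have "h \<in> mon_hom P M"
      by (simp add: mon_hom_def hom_def one hc)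
    moreover have "\<forall>a\<in>A. h (\<iota> a) = f a"
      using f by (auto simp: \<iota>_def hc Pi_iff)
    ultimately show "\<exists>h\<in>mon_hom P M. \<forall>a\<in>A. h (\<iota> a) = f a" by blast
  qed
qed

lemma ex_inj_list: "\<exists>g :: 'u::infinite list \<Rightarrow> 'u. inj g"
proof -
  have "(card_of (UNIV :: ('u \<times> 'u) set), card_of (UNIV :: 'u set)) \<in> ordIso"
    using card_of_Times_same_infinite[of "UNIV :: 'u set"] infinite_UNIV by simp
  then obtain p :: "'u \<times> 'u \<Rightarrow> 'u" where p: "inj p"
    using card_of_ordIso[of "UNIV :: ('u \<times> 'u) set" "UNIV :: 'u set"] by (auto simp: bij_betw_def)
  obtain k :: "nat \<Rightarrow> 'u" where k: "inj k"
    using infinite_countable_subset[OF infinite_UNIV[where 'a = 'u]] by auto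
  define e where "e = (\<lambda>xs :: 'u list. foldr (\<lambda>x y. p (x, y)) xs undefined)"
  have "xs = ys" if "length xs = length ys" "e xs = e ys" for xs ys
    using that by (induction xs ys rule: list_induct2) (auto simp: e_def dest: injD[OF p])
  then have "inj (\<lambda>xs. p (k (length xs), e xs))"
    by (intro injI) (auto dest!: injD[OF p] injD[OF k])
  then show ?thesis by blast
qed

lemma ex_inj_signed_list: "\<exists>g :: (bool \<times> 'u::infinite) list \<Rightarrow> 'u. inj g"
proof -
  obtain l :: "'u list \<Rightarrow> 'u" where l: "inj l" using ex_inj_list by blast
  obtain x y :: 'u where xy: "x \<noteq> y"
    using infinite_UNIV[where 'a = 'u] by (metis (full_types) UNIV_eq_I finite.simps insertCI)
  define s where "s = (\<lambda>(b, z). l [if b then x else y, z])"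
  have "inj s" using xy by (auto simp: s_def inj_def dest!: injD[OF l] split: if_splits)
  then have "inj (l \<circ> map s)" using l by (simp add: inj_compose)
  then show ?thesis by blast
qed


lemma mon_hom_eqI:
  assumes "h \<in> mon_hom P M" "h' \<in> mon_hom P M" "monoid P" "\<iota> \<in> A \<rightarrow> carrier P"
    and gen: "\<And>y. y \<in> carrier P \<Longrightarrow> \<exists>w\<in>lists A. y = mprod P (map \<iota> w)"
    and "\<And>a. a \<in> A \<Longrightarrow> h (\<iota> a) = h' (\<iota> a)" and y: "y \<in> carrier P"
  shows "h y = h' y"
proof -
  obtain w where w: "w \<in> lists A" "y = mprod P (map \<iota> w)" using gen[OF y] by blast
  have s: "set (map \<iota> w) \<subseteq> carrier P" using w assms(4) by auto
  have "map h (map \<iota> w) = map h' (map \<iota> w)" using w assms(6) by auto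
  then show ?thesis
    using mon_hom_mprod[OF assms(1,3) s] mon_hom_mprod[OF assms(2,3) s] w by metis
qed

lemma mon_hom_id: "(\<lambda>x. x) \<in> mon_hom M M"
  by (simp add: mon_hom_def hom_def)

lemma mon_hom_comp: "h \<in> mon_hom M N \<Longrightarrow> k \<in> mon_hom N L \<Longrightarrow> k \<circ> h \<in> mon_hom M L"
  by (auto simp: mon_hom_def hom_def Pi_iff)

lemma hom_mon_hom:
  assumes "group A" "group B" shows "hom A B = mon_hom A B"
  using hom_one[OF _ assms] by (auto simp: mon_hom_def)

lemma mon_hom_closed: "h \<in> mon_hom M N \<Longrightarrow> x \<in> carrier M \<Longrightarrow> h x \<in> carrier N"
  by (auto simp: mon_hom_def hom_def)

lemma mon_hom_mult: "h \<in> mon_hom M N \<Longrightarrow> x \<in> carrier M \<Longrightarrow> y \<in> carrier M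
    \<Longrightarrow> h (x \<otimes>\<^bsub>M\<^esub> y) = h x \<otimes>\<^bsub>N\<^esub> h y"
  by (auto simp: mon_hom_def hom_def)

lemma mon_hom_one: "h \<in> mon_hom M N \<Longrightarrow> h \<one>\<^bsub>M\<^esub> = \<one>\<^bsub>N\<^esub>"
  by (auto simp: mon_hom_def)

lemma mon_hom_restrict: "monoid M \<Longrightarrow> h \<in> mon_hom M N \<Longrightarrow> restrict h (carrier M) \<in> mon_hom M N"
  by (auto simp: mon_hom_def hom_def monoid.m_closed monoid.one_closed)

lemma group_completion_object:
  fixes M :: "'u::infinite monoid"
  assumes "monoid M"
  obtains P :: "'u monoid" and j where
    "group P" "j \<in> mon_hom M P"
    "\<And>(H :: 'u monoid) f. \<lbrakk>group H; f \<in> mon_hom M H\<rbrakk> \<Longrightarrow>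
       \<exists>!h. h \<in> hom P H \<and> h \<in> extensional (carrier P) \<and> (\<forall>x\<in>carrier M. h (j x) = f x)"
proof -
  interpret M: monoid M by fact
  obtain g :: "(bool \<times> 'u) list \<Rightarrow> 'u" where g: "inj g" using ex_inj_signed_list by blast
  define A where "A = (UNIV :: bool set) \<times> carrier M"
  define R where "R = {([(e, x), (\<not> e, x)], []) | e x. x \<in> carrier M}
    \<union> {([(True, x), (True, y)], [(True, x \<otimes>\<^bsub>M\<^esub> y)]) | x y. x \<in> carrier M \<and> y \<in> carrier M}
    \<union> {([(True, \<one>\<^bsub>M\<^esub>)], [])}"
  have R: "R \<subseteq> lists A \<times> lists A" by (auto simp: R_def A_def)
  obtain P :: "'u monoid" and \<iota> where P: "monoid P" "\<iota> \<in> A \<rightarrow> carrier P"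
    and PR: "\<And>u v. (u, v) \<in> R \<Longrightarrow> mprod P (map \<iota> u) = mprod P (map \<iota> v)"
    and gen: "\<And>y. y \<in> carrier P \<Longrightarrow> \<exists>w\<in>lists A. y = mprod P (map \<iota> w)"
    and univ: "\<And>(M :: 'u monoid) f. \<lbrakk>monoid M; f \<in> A \<rightarrow> carrier M;
        \<And>u v. (u, v) \<in> R \<Longrightarrow> mprod M (map f u) = mprod M (map f v)\<rbrakk>
      \<Longrightarrow> \<exists>h\<in>mon_hom P M. \<forall>a\<in>A. h (\<iota> a) = f a"
    proof (rule presented_monoid[OF R g], goal_cases)
    case (1 P \<iota>)
    show ?case by (rule 1(1)[OF 1(2-)])
  qed
  interpret P: monoid P by fact
  have \<iota>c: "\<iota> (e, x) \<in> carrier P" if "x \<in> carrier M" for e x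
    using P(2) that by (auto simp: A_def)
  have canc: "\<iota> (e, x) \<otimes>\<^bsub>P\<^esub> \<iota> (\<not> e, x) = \<one>\<^bsub>P\<^esub>" if "x \<in> carrier M" for e x
    using PR[of "[(e, x), (\<not> e, x)]" "[]"] that \<iota>c by (auto simp: R_def)
  have ml: "\<iota> (True, x) \<otimes>\<^bsub>P\<^esub> \<iota> (True, y) = \<iota> (True, x \<otimes>\<^bsub>M\<^esub> y)"
    if "x \<in> carrier M" "y \<in> carrier M" for x y
    using PR[of "[(True, x), (True, y)]" "[(True, x \<otimes>\<^bsub>M\<^esub> y)]"] that \<iota>c by (auto simp: R_def)
  have on: "\<iota> (True, \<one>\<^bsub>M\<^esub>) = \<one>\<^bsub>P\<^esub>"
    using PR[of "[(True, \<one>\<^bsub>M\<^esub>)]" "[]"] \<iota>c by (auto simp: R_def)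
  have inv: "\<exists>z\<in>carrier P. mprod P (map \<iota> w) \<otimes>\<^bsub>P\<^esub> z = \<one>\<^bsub>P\<^esub> \<and> z \<otimes>\<^bsub>P\<^esub> mprod P (map \<iota> w) = \<one>\<^bsub>P\<^esub>"
    if "w \<in> lists A" for w
    using that
  proof (induction w)
    case Nil then show ?case by auto
  next
    case (Cons a w)
    then obtain z where z: "z \<in> carrier P" "mprod P (map \<iota> w) \<otimes>\<^bsub>P\<^esub> z = \<one>\<^bsub>P\<^esub>"
      "z \<otimes>\<^bsub>P\<^esub> mprod P (map \<iota> w) = \<one>\<^bsub>P\<^esub>" by auto
    obtain e x where a: "a = (e, x)" "x \<in> carrier M" using Cons by (cases a) (auto simp: A_def)
    define W where "W = mprod P (map \<iota> w)"
    have W: "W \<in> carrier P" unfolding W_def using Cons P(2) by (intro P.mprod_closed) auto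
    have c: "\<iota> (e, x) \<in> carrier P" "\<iota> (\<not> e, x) \<in> carrier P" using \<iota>c a by auto
    have c1: "\<iota> (e, x) \<otimes>\<^bsub>P\<^esub> \<iota> (\<not> e, x) = \<one>\<^bsub>P\<^esub>" "\<iota> (\<not> e, x) \<otimes>\<^bsub>P\<^esub> \<iota> (e, x) = \<one>\<^bsub>P\<^esub>"
      using canc[of x e] canc[of x "\<not> e"] a by auto
    have "(\<iota> (e, x) \<otimes>\<^bsub>P\<^esub> W) \<otimes>\<^bsub>P\<^esub> (z \<otimes>\<^bsub>P\<^esub> \<iota> (\<not> e, x))
        = \<iota> (e, x) \<otimes>\<^bsub>P\<^esub> (W \<otimes>\<^bsub>P\<^esub> z) \<otimes>\<^bsub>P\<^esub> \<iota> (\<not> e, x)"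
      using W c z(1) by (simp add: P.m_assoc)
    moreover have "(z \<otimes>\<^bsub>P\<^esub> \<iota> (\<not> e, x)) \<otimes>\<^bsub>P\<^esub> (\<iota> (e, x) \<otimes>\<^bsub>P\<^esub> W)
        = z \<otimes>\<^bsub>P\<^esub> (\<iota> (\<not> e, x) \<otimes>\<^bsub>P\<^esub> \<iota> (e, x)) \<otimes>\<^bsub>P\<^esub> W"
      using W c z(1) by (simp add: P.m_assoc)
    ultimately show ?case
      using W c z c1 by (intro bexI[of _ "z \<otimes>\<^bsub>P\<^esub> \<iota> (\<not> e, x)"]) (auto simp: a W_def)
  qed
  have grp: "group P"
    by (rule group.intro[OF P(1)], unfold_locales) (use gen inv in \<open>fastforce simp: Units_def\<close>)
  define j where "j x = \<iota> (True, x)" for x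
  show ?thesis
  proof (rule that[of P j])
    show "group P" by (rule grp)
    show jh: "j \<in> mon_hom M P" using \<iota>c ml on by (auto simp: mon_hom_def hom_def j_def)
    fix H :: "'u monoid" and f assume H: "group H" and f: "f \<in> mon_hom M H"
    interpret H: group H by fact
    define f' where "f' = (\<lambda>(e, x). if e then f x else inv\<^bsub>H\<^esub> f x)"
    have fc: "f x \<in> carrier H" if "x \<in> carrier M" for x using mon_hom_closed[OF f that] .
    have "\<exists>h\<in>mon_hom P H. \<forall>a\<in>A. h (\<iota> a) = f' a"
    proof (rule univ)
      show "f' \<in> A \<rightarrow> carrier H" by (auto simp: A_def f'_def fc)
      show "mprod H (map f' u) = mprod H (map f' v)" if "(u, v) \<in> R" for u v
        using that mon_hom_mult[OF f] mon_hom_one[OF f] by (auto simp: R_def f'_def fc)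
    qed (rule H.is_monoid)
    then obtain h where h: "h \<in> mon_hom P H" and hA: "\<And>a. a \<in> A \<Longrightarrow> h (\<iota> a) = f' a" by blast
    have hj: "h (j x) = f x" if "x \<in> carrier M" for x
      using hA[of "(True, x)"] that by (simp add: j_def A_def f'_def)
    show "\<exists>!h. h \<in> hom P H \<and> h \<in> extensional (carrier P) \<and> (\<forall>x\<in>carrier M. h (j x) = f x)"
    proof (rule ex1I[of _ "restrict h (carrier P)"])
      show "restrict h (carrier P) \<in> hom P H \<and> restrict h (carrier P) \<in> extensional (carrier P) \<and>
          (\<forall>x\<in>carrier M. restrict h (carrier P) (j x) = f x)"
        using mon_hom_restrict[OF P(1) h] hj mon_hom_closed[OF jh] hom_mon_hom[OF grp H] by auto
      fix k assume k: "k \<in> hom P H \<and> k \<in> extensional (carrier P) \<and> (\<forall>x\<in>carrier M. k (j x) = f x)"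
      have km: "k \<in> mon_hom P H" using k hom_mon_hom[OF grp H] by auto
      have kA: "k (\<iota> (e, x)) = f' (e, x)" if x: "x \<in> carrier M" for e x
      proof (cases e)
        case True then show ?thesis using k x by (auto simp: f'_def j_def)
      next
        case False
        have "k (\<iota> (True, x)) \<otimes>\<^bsub>H\<^esub> k (\<iota> (False, x)) = \<one>\<^bsub>H\<^esub>"
          using mon_hom_mult[OF km \<iota>c[OF x, of True] \<iota>c[OF x, of False]] canc[OF x, of True] mon_hom_one[OF km]
            by simp
        then have "k (\<iota> (False, x)) = inv\<^bsub>H\<^esub> k (\<iota> (True, x))"
          using mon_hom_closed[OF km \<iota>c[OF x]] by (metis H.inv_equality H.inv_inv H.inv_closed)
        then show ?thesis using False k x by (auto simp: f'_def j_def)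
      qed
      show "k = restrict h (carrier P)"
      proof (rule extensionalityI)
        show "k \<in> extensional (carrier P)" using k by blast
        fix y assume y: "y \<in> carrier P"
        have "k y = h y"
          using mon_hom_eqI[OF km h P(1) P(2) gen _ y] kA hA by (auto simp: A_def)
        then show "k y = restrict h (carrier P) y" using y by simp
      qed auto
    qed
  qed
qed

lemma ex_group_completion:
  "\<exists>G Gmap. group_completion (G :: 'u::infinite monoid \<Rightarrow> 'u monoid) Gmap"
proof -
  define Q where "Q M P j \<longleftrightarrow> group P \<and> j \<in> mon_hom M P \<and>
    (\<forall>(H :: 'u monoid) f. group H \<longrightarrow> f \<in> mon_hom M H \<longrightarrow>
       (\<exists>!h. h \<in> hom P H \<and> h \<in> extensional (carrier P) \<and> (\<forall>x\<in>carrier M. h (j x) = f x)))"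
    for M P :: "'u monoid" and j
  have "\<exists>P j. Q M P j" if "monoid M" for M
    by (rule group_completion_object[OF that]) (unfold Q_def, blast)
  then obtain G j where Q: "\<And>M. monoid M \<Longrightarrow> Q M (G M) (j M)" by metis
  have grp: "group (G M)" and jh: "j M \<in> mon_hom M (G M)"
    and univ: "\<And>(H :: 'u monoid) f. group H \<Longrightarrow> f \<in> mon_hom M H \<Longrightarrow>
      \<exists>!h. h \<in> hom (G M) H \<and> h \<in> extensional (carrier (G M)) \<and> (\<forall>x\<in>carrier M. h (j M x) = f x)"
    if "monoid M" for M
    using Q[OF that] unfolding Q_def by blast+
  define Gm where "Gm M N f = (THE h. h \<in> hom (G M) (G N) \<and> h \<in> extensional (carrier (G M)) \<and>
      (\<forall>x\<in>carrier M. h (j M x) = (j N \<circ> f) x))" for M N f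
  have Gm: "Gm M N f \<in> hom (G M) (G N) \<and> Gm M N f \<in> extensional (carrier (G M)) \<and>
      (\<forall>x\<in>carrier M. Gm M N f (j M x) = (j N \<circ> f) x)"
    if "monoid M" "monoid N" "f \<in> mon_hom M N" for M N f
    unfolding Gm_def
    by (rule theI'[OF univ[OF that(1) grp[OF that(2)] mon_hom_comp[OF that(3) jh[OF that(2)]]]])
  have uniq: "h y = k y" if "monoid M" "group (H :: 'u monoid)" "h \<in> hom (G M) H" "k \<in> hom (G M) H"
     "\<And>x. x \<in> carrier M \<Longrightarrow> h (j M x) = k (j M x)" "y \<in> carrier (G M)" for M H h k y
  proof -
    let ?r = "\<lambda>h. restrict h (carrier (G M))"
    interpret GM: group "G M" by (rule grp) fact
    have eq: "hom (G M) H = mon_hom (G M) H" by (rule hom_mon_hom[OF grp]) fact+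
    have c: "j M x \<in> carrier (G M)" if "x \<in> carrier M" for x
      using mon_hom_closed[OF jh] \<open>monoid M\<close> that by blast
    have "?r h \<in> hom (G M) H" "?r k \<in> hom (G M) H"
      using that mon_hom_restrict[OF GM.is_monoid] unfolding eq by auto
    moreover have "h \<circ> j M \<in> mon_hom M H" using that jh mon_hom_comp eq by blast
    ultimately have "?r h = ?r k"
      using univ[OF that(1,2), of "h \<circ> j M"] that(5) c by auto
    then show ?thesis using that(6) by (metis restrict_apply')
  qed
  have "group_completion G Gm"
  proof (rule group_completion.intro)
    show "Gm M M (\<lambda>x. x) y = y" if "monoid M" "y \<in> carrier (G M)" for M y
      by (rule uniq[of M "G M"]) (use that grp Gm[of M M "\<lambda>x. x"] mon_hom_id in \<open>auto simp: hom_def\<close>)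
    show "Gm M L (k \<circ> h) y = Gm N L k (Gm M N h y)"
      if m: "monoid M" "monoid N" "monoid L" "h \<in> mon_hom M N" "k \<in> mon_hom N L" "y \<in> carrier (G M)"
      for M N L h k y
    proof -
      have "Gm M L (k \<circ> h) y = (Gm N L k \<circ> Gm M N h) y"
      proof (rule uniq[of M "G L" "Gm M L (k \<circ> h)" "Gm N L k \<circ> Gm M N h"])
        show "Gm M L (k \<circ> h) (j M x) = (Gm N L k \<circ> Gm M N h) (j M x)" if "x \<in> carrier M" for x
          using Gm[OF m(1,3) mon_hom_comp[OF m(4,5)]] Gm[OF m(1,2,4)] Gm[OF m(2,3,5)] that
            mon_hom_closed[OF m(4) that] by simp
        show "Gm M L (k \<circ> h) \<in> hom (G M) (G L)" using Gm[OF m(1,3) mon_hom_comp[OF m(4,5)]] by blast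
        show "Gm N L k \<circ> Gm M N h \<in> hom (G M) (G L)"
          using hom_compose[of "Gm M N h" "G M" "G N" "Gm N L k" "G L"] Gm[OF m(1,2,4)] Gm[OF m(2,3,5)] by blast
      qed (use m grp in auto)
      then show ?thesis by simp
    qed
    show "\<exists>\<iota>. (\<forall>M. monoid M \<longrightarrow> \<iota> M \<in> mon_hom M (G M)) \<and>
        (\<forall>M N h. monoid M \<longrightarrow> monoid N \<longrightarrow> h \<in> mon_hom M N \<longrightarrow>
           (\<forall>x\<in>carrier M. Gm M N h (\<iota> M x) = \<iota> N (h x))) \<and>
        (\<forall>M H f. monoid M \<longrightarrow> group (H :: 'u monoid) \<longrightarrow> f \<in> mon_hom M H \<longrightarrow>
           (\<exists>!h. h \<in> hom (G M) H \<and> h \<in> extensional (carrier (G M)) \<and>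
              (\<forall>x\<in>carrier M. h (\<iota> M x) = f x)))"
    proof (intro exI[of _ j] conjI allI impI ballI)
      show "j M \<in> mon_hom M (G M)" if "monoid M" for M by (rule jh[OF that])
      show "Gm M N h (j M x) = j N (h x)"
        if "monoid M" "monoid N" "h \<in> mon_hom M N" "x \<in> carrier M" for M N h x
        using Gm[OF that(1-3)] that(4) by simp
    qed (rule univ)

    show "\<And>M. monoid M \<Longrightarrow> group (G M)" by (rule grp)
    show "\<And>M N h. monoid M \<Longrightarrow> monoid N \<Longrightarrow> h \<in> mon_hom M N \<Longrightarrow> Gm M N h \<in> hom (G M) (G N)"
      using Gm by blast
  qed
  then show ?thesis by blast
qed

text \<open>The edges of an \<open>n\<close>-cell, obtained by iterating the maps \<^const>\<open>bsplit\<close>.\<close>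

fun bedges :: "'a bobj \<Rightarrow> nat \<Rightarrow> 'a \<Rightarrow> 'a list" where
  "bedges B 0 x = []"
| "bedges B (Suc n) x = fst (bsplit B 1 n x) # bedges B n (snd (bsplit B 1 n x))"

lemma length_bedges [simp]: "length (bedges B n x) = n"
  by (induction n arbitrary: x) auto

lemma B_objectD:
  assumes "B_object B"
  shows "f \<in> Delta_act m n \<Longrightarrow> x \<in> bcells B n \<Longrightarrow> bact B m n f x \<in> bcells B m"
    and "x \<in> bcells B (n + m) \<Longrightarrow> fst (bsplit B n m x) \<in> bcells B n"
    and "x \<in> bcells B (n + m) \<Longrightarrow> snd (bsplit B n m x) \<in> bcells B m"
    and "\<lbrakk>f \<in> Delta_act n' n; g \<in> Delta_act m' m; x \<in> bcells B (n + m)\<rbrakk> \<Longrightarrow>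
        bsplit B n' m' (bact B (n' + m') (n + m) (glue n' n m' f g) x) =
          map_prod (bact B n' n f) (bact B m' m g) (bsplit B n m x)"
    and "x \<in> bcells B (n + m + p) \<Longrightarrow>
        (\<lambda>((u, v), w). (u, v, w)) (map_prod (bsplit B n m) id (bsplit B (n + m) p x)) =
          map_prod id (bsplit B m p) (bsplit B n (m + p) x)"
    and "x \<in> bcells B n \<Longrightarrow> snd (bsplit B 0 n x) = x"
    and "x \<in> bcells B n \<Longrightarrow> fst (bsplit B n 0 x) = x"
proof -
  note a = assms[unfolded B_object_def Pi_iff]
  show "f \<in> Delta_act m n \<Longrightarrow> x \<in> bcells B n \<Longrightarrow> bact B m n f x \<in> bcells B m"
    using conjunct1[OF a] by blast
  note a2 = conjunct2[OF conjunct2[OF conjunct2[OF a]]]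
  have s: "bsplit B n m x \<in> bcells B n \<times> bcells B m" if "x \<in> bcells B (n + m)"
    using conjunct1[OF a2] that by blast
  show "x \<in> bcells B (n + m) \<Longrightarrow> fst (bsplit B n m x) \<in> bcells B n"
    and "x \<in> bcells B (n + m) \<Longrightarrow> snd (bsplit B n m x) \<in> bcells B m"
    using s by (auto simp: mem_Times_iff)
  note a3 = conjunct2[OF a2]
  show "\<lbrakk>f \<in> Delta_act n' n; g \<in> Delta_act m' m; x \<in> bcells B (n + m)\<rbrakk> \<Longrightarrow>
        bsplit B n' m' (bact B (n' + m') (n + m) (glue n' n m' f g) x) =
          map_prod (bact B n' n f) (bact B m' m g) (bsplit B n m x)"
    using conjunct1[OF a3] by blast
  note a4 = conjunct2[OF a3]
  show "x \<in> bcells B (n + m + p) \<Longrightarrow>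
        (\<lambda>((u, v), w). (u, v, w)) (map_prod (bsplit B n m) id (bsplit B (n + m) p x)) =
          map_prod id (bsplit B m p) (bsplit B n (m + p) x)"
    using conjunct1[OF a4] by blast
  show "x \<in> bcells B n \<Longrightarrow> snd (bsplit B 0 n x) = x" "x \<in> bcells B n \<Longrightarrow> fst (bsplit B n 0 x) = x"
    using conjunct2[OF a4] by blast+
qed

lemma B_homD:
  assumes "\<phi> \<in> B_hom B B'"
  shows "x \<in> bcells B n \<Longrightarrow> \<phi> n x \<in> bcells B' n"
    and "f \<in> Delta_act m n \<Longrightarrow> x \<in> bcells B n \<Longrightarrow> \<phi> m (bact B m n f x) = bact B' m n f (\<phi> n x)"
    and "x \<in> bcells B (n + m) \<Longrightarrow> bsplit B' n m (\<phi> (n + m) x) = map_prod (\<phi> n) (\<phi> m) (bsplit B n m x)"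
  using assms unfolding B_hom_def Pi_iff mem_Collect_eq by blast+

lemma bedges_cells:
  "B_object B \<Longrightarrow> x \<in> bcells B n \<Longrightarrow> set (bedges B n x) \<subseteq> bcells B 1"
proof (induction n arbitrary: x)
  case (Suc n)
  then show ?case using B_objectD(2,3)[of B x 1 n] by auto
qed simp

lemma bedges_split:
  "B_object B \<Longrightarrow> x \<in> bcells B (n + m) \<Longrightarrow>
   bedges B (n + m) x = bedges B n (fst (bsplit B n m x)) @ bedges B m (snd (bsplit B n m x))"
proof (induction n arbitrary: x)
  case 0
  then show ?case using B_objectD(6)[of B x m] by simp
next
  case (Suc n)
  define s where "s = snd (bsplit B 1 (n + m) x)"
  have s: "s \<in> bcells B (n + m)" using Suc B_objectD(3)[of B x 1 "n + m"] by (simp add: s_def)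
  have "(\<lambda>((u, v), w). (u, v, w)) (map_prod (bsplit B 1 n) id (bsplit B (1 + n) m x)) =
          map_prod id (bsplit B n m) (bsplit B 1 (n + m) x)"
    using B_objectD(5)[of B x 1 n m] Suc by simp
  then have "fst (bsplit B 1 n (fst (bsplit B (Suc n) m x))) = fst (bsplit B 1 (n + m) x)"
    "snd (bsplit B 1 n (fst (bsplit B (Suc n) m x))) = fst (bsplit B n m s)"
    "snd (bsplit B (Suc n) m x) = snd (bsplit B n m s)"
    by (simp_all add: s_def map_prod_def split_beta prod_eq_iff)
  then show ?case using Suc.IH[OF Suc.prems(1) s] by (simp add: s_def)
qed

lemma bedges_1: "B_object B \<Longrightarrow> x \<in> bcells B 1 \<Longrightarrow> bedges B 1 x = [x]"
  using B_objectD(7)[of B x 1] by simp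

lemma bedges_hom:
  "B_object B \<Longrightarrow> \<phi> \<in> B_hom B B' \<Longrightarrow> x \<in> bcells B n \<Longrightarrow>
    bedges B' n (\<phi> n x) = map (\<phi> 1) (bedges B n x)"
proof (induction n arbitrary: x)
  case (Suc n)
  then show ?case
    using B_homD(3)[of \<phi> B B' x 1 n] B_objectD(3)[of B x 1 n] by simp
qed simp

lemma bedges_bar_hom:
  "B_object B \<Longrightarrow> \<phi> \<in> B_hom B (bar M) \<Longrightarrow> x \<in> bcells B n \<Longrightarrow>
    \<phi> n x = map (\<lambda>e. hd (\<phi> 1 e)) (bedges B n x)"
proof (induction n arbitrary: x)
  case 0
  then show ?case using B_homD(1)[of \<phi> B "bar M" x 0] by (simp add: bar_def)
next
  case (Suc n)
  have l: "length (\<phi> (Suc n) x) = Suc n"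
    using B_homD(1)[OF Suc.prems(2,3)] by (simp add: bar_def)
  have "(take 1 (\<phi> (Suc n) x), drop 1 (\<phi> (Suc n) x)) = map_prod (\<phi> 1) (\<phi> n) (bsplit B 1 n x)"
    using B_homD(3)[of \<phi> B "bar M" x 1 n] Suc.prems by (simp add: bar_def)
  moreover have "snd (bsplit B 1 n x) \<in> bcells B n"
    using B_objectD(3)[of B x 1 n] Suc.prems by simp
  ultimately have "take 1 (\<phi> (Suc n) x) = \<phi> 1 (fst (bsplit B 1 n x))"
    "drop 1 (\<phi> (Suc n) x) = map (\<lambda>e. hd (\<phi> 1 e)) (bedges B n (snd (bsplit B 1 n x)))"
    using Suc.IH[OF Suc.prems(1,2)] by (simp_all add: map_prod_def split_beta)
  moreover have "\<phi> (Suc n) x = hd (take 1 (\<phi> (Suc n) x)) # drop 1 (\<phi> (Suc n) x)"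
    using l by (cases "\<phi> (Suc n) x") simp_all
  ultimately show ?case by simp
qed

definition long_edge :: "nat \<Rightarrow> nat \<Rightarrow> nat" where
  "long_edge n = (\<lambda>i\<in>{..1}. i * n)"

lemma long_edge: "long_edge n \<in> Delta_act 1 n"
  by (auto simp: long_edge_def Delta_act_def Delta_def mono_on_def le_Suc_eq)

lemma Delta_act_split:
  assumes f: "f \<in> Delta_act (Suc m) n"
  defines "k \<equiv> f 1"
  defines "g \<equiv> (\<lambda>i\<in>{..m}. f (Suc i) - k)"
  shows "k \<le> n" "g \<in> Delta_act m (n - k)" "f = glue 1 k m (long_edge k) g"
    "\<And>i. i \<le> m \<Longrightarrow> f (Suc i) = k + g i"
proof -
  have mono: "f i \<le> f j" if "i \<le> j" "j \<le> Suc m" for i j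
    using f that by (auto simp: Delta_act_def Delta_def mono_on_def)
  have ends: "f 0 = 0" "f (Suc m) = n" and ext: "f \<in> extensional {..Suc m}"
    using f by (auto simp: Delta_act_def Delta_def PiE_def)
  show "k \<le> n" using mono[of 1 "Suc m"] ends by (simp add: k_def)
  show fg: "f (Suc i) = k + g i" if "i \<le> m" for i
    using mono[of 1 "Suc i"] that by (simp add: g_def k_def)
  have g0: "g 0 = 0" by (simp add: g_def k_def)
  show "g \<in> Delta_act m (n - k)"
    unfolding Delta_act_def Delta_def mono_on_def PiE_def
  proof (intro CollectI conjI IntI Pi_I allI impI)
    show "g x \<in> {..n - k}" if "x \<in> {..m}" for x
      using that mono[of "Suc x" "Suc m"] ends by (simp add: g_def diff_le_mono)
    show "g i \<le> g j" if "i \<in> {..m} \<and> j \<in> {..m} \<and> i \<le> j" for i j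
      using that mono[of "Suc i" "Suc j"] by (simp add: g_def diff_le_mono)
    show "g 0 = 0" "g m = n - k" using ends by (simp_all add: g_def k_def)
  qed (simp add: g_def)
  show "f = glue 1 k m (long_edge k) g"
  proof (rule extensionalityI[OF ext])
    show "glue 1 k m (long_edge k) g \<in> extensional {..Suc m}" by (simp add: glue_def)
    fix i assume "i \<in> {..Suc m}"
    then show "f i = glue 1 k m (long_edge k) g i"
      using ends(1) fg g0 by (cases i) (auto simp: glue_def long_edge_def le_Suc_eq)
  qed
qed

lemma bedges_act:
  assumes B: "B_object B" and P: "monoid P" and \<iota>: "\<iota> \<in> bcells B 1 \<rightarrow> carrier P"
    and rel: "\<And>n x. x \<in> bcells B n \<Longrightarrow>
      \<iota> (bact B 1 n (long_edge n) x) = mprod P (map \<iota> (bedges B n x))"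
  shows "f \<in> Delta_act m n \<Longrightarrow> x \<in> bcells B n \<Longrightarrow>
    map \<iota> (bedges B m (bact B m n f x)) = bact (bar P) m n f (map \<iota> (bedges B n x))"
proof (induction m arbitrary: n f x)
  case 0
  then show ?case by (simp add: bar_def)
next
  case (Suc m)
  define k where "k = f 1"
  define g where "g = (\<lambda>i\<in>{..m}. f (Suc i) - k)"
  note d = Delta_act_split[OF Suc.prems(1), folded k_def, folded g_def]
  define l where "l = n - k"
  have n: "n = k + l" using d(1) by (simp add: l_def)
  have g: "g \<in> Delta_act m l" using d(2) by (simp add: l_def)
  define y where "y = fst (bsplit B k l x)"
  define z where "z = snd (bsplit B k l x)"
  have x: "x \<in> bcells B (k + l)" using Suc.prems n by simp
  have y: "y \<in> bcells B k" and z: "z \<in> bcells B l"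
    using B_objectD(2,3)[OF B x] by (auto simp: y_def z_def)
  have "bsplit B 1 m (bact B (1 + m) (k + l) (glue 1 k m (long_edge k) g) x) =
      map_prod (bact B 1 k (long_edge k)) (bact B m l g) (bsplit B k l x)"
    by (rule B_objectD(4)[OF B long_edge g x])
  then have "bsplit B 1 m (bact B (Suc m) n f x) = (bact B 1 k (long_edge k) y, bact B m l g z)"
    using d(3) n by (simp add: y_def z_def map_prod_def split_beta)
  then have lhs: "map \<iota> (bedges B (Suc m) (bact B (Suc m) n f x)) =
      mprod P (map \<iota> (bedges B k y)) # bact (bar P) m l g (map \<iota> (bedges B l z))"
    using rel[OF y] Suc.IH[OF g z] by simp
  have xs: "bedges B n x = bedges B k y @ bedges B l z"
    using bedges_split[OF B x] n by (simp add: y_def z_def)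
  have f0: "f 0 = 0" using Suc.prems by (simp add: Delta_act_def)
  let ?ys = "map \<iota> (bedges B k y)" and ?zs = "map \<iota> (bedges B l z)"
  have e0: "map (\<lambda>i. (?ys @ ?zs) ! i) [f 0..<f (Suc 0)] = ?ys"
    by (rule nth_equalityI) (auto simp: f0 k_def[symmetric] nth_append simp flip: One_nat_def)
  have ej: "map (\<lambda>i. (?ys @ ?zs) ! i) [f (Suc j)..<f (Suc (Suc j))] =
      map (\<lambda>i. ?zs ! i) [g j..<g (Suc j)]" if "j < m" for j
    using that d(4)[of j] d(4)[of "Suc j"]
    by (intro nth_equalityI) (auto simp: nth_append)
  have "bact (bar P) (Suc m) n f (?ys @ ?zs) = mprod P ?ys # bact (bar P) m l g ?zs"
    by (simp add: bar_def upt_conv_Cons map_Suc_upt[symmetric] e0 ej del: upt_Suc map_append)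
  then show ?case using lhs xs by simp
qed

lemma cobar_object:
  fixes B :: "'u::infinite bobj"
  assumes B: "B_object B"
  obtains P :: "'u monoid" and \<eta> where
    "monoid P" "\<eta> \<in> B_hom B (bar P)"
    "\<And>(M :: 'u monoid) \<phi>. \<lbrakk>monoid M; \<phi> \<in> B_hom B (bar M)\<rbrakk> \<Longrightarrow>
       \<exists>!h. h \<in> mon_hom P M \<and> h \<in> extensional (carrier P) \<and>
         (\<forall>n. \<forall>x\<in>bcells B n. bar_map h n (\<eta> n x) = \<phi> n x)"
proof -
  obtain g :: "'u list \<Rightarrow> 'u" where g: "inj g" using ex_inj_list by blast
  define A where "A = bcells B 1"
  define R where "R = {([bact B 1 n (long_edge n) x], bedges B n x) | n x. x \<in> bcells B n}"
  have R: "R \<subseteq> lists A \<times> lists A"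
    using bedges_cells[OF B] B_objectD(1)[OF B long_edge] by (auto simp: R_def A_def)
  obtain P :: "'u monoid" and \<iota> where P: "monoid P" "\<iota> \<in> A \<rightarrow> carrier P"
    and PR: "\<And>u v. (u, v) \<in> R \<Longrightarrow> mprod P (map \<iota> u) = mprod P (map \<iota> v)"
    and gen: "\<And>y. y \<in> carrier P \<Longrightarrow> \<exists>w\<in>lists A. y = mprod P (map \<iota> w)"
    and univ: "\<And>(M :: 'u monoid) f. \<lbrakk>monoid M; f \<in> A \<rightarrow> carrier M;
        \<And>u v. (u, v) \<in> R \<Longrightarrow> mprod M (map f u) = mprod M (map f v)\<rbrakk>
      \<Longrightarrow> \<exists>h\<in>mon_hom P M. \<forall>a\<in>A. h (\<iota> a) = f a"
  proof (rule presented_monoid[OF R g], goal_cases)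
    case (1 P \<iota>)
    show ?case by (rule 1(1)[OF 1(2-)])
  qed
  interpret P: monoid P by fact
  have rel: "\<iota> (bact B 1 n (long_edge n) x) = mprod P (map \<iota> (bedges B n x))"
    if "x \<in> bcells B n" for n x
  proof -
    have "bact B 1 n (long_edge n) x \<in> A" using B_objectD(1)[OF B long_edge that] by (simp add: A_def)
    then have "\<iota> (bact B 1 n (long_edge n) x) \<in> carrier P" using P(2) by blast
    moreover have "([bact B 1 n (long_edge n) x], bedges B n x) \<in> R" using that by (auto simp: R_def)
    ultimately show ?thesis using PR by fastforce
  qed
  define \<eta> where "\<eta> n x = map \<iota> (bedges B n x)" for n x
  have \<eta>: "\<eta> \<in> B_hom B (bar P)"
    unfolding B_hom_def
  proof (intro CollectI conjI allI ballI)
    show "\<eta> n \<in> bcells B n \<rightarrow> bcells (bar P) n" for n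
      using bedges_cells[OF B] P(2) by (fastforce simp: \<eta>_def bar_def A_def)
    show "\<eta> m (bact B m n f x) = bact (bar P) m n f (\<eta> n x)"
      if "f \<in> Delta_act m n" "x \<in> bcells B n" for m n f x
      unfolding \<eta>_def using bedges_act[OF B P(1) P(2)[unfolded A_def] rel that] .
    show "bsplit (bar P) n m (\<eta> (n + m) x) = map_prod (\<eta> n) (\<eta> m) (bsplit B n m x)"
      if "x \<in> bcells B (n + m)" for n m x
      using bedges_split[OF B that] by (simp add: bar_def \<eta>_def map_prod_def split_beta)
  qed
  show ?thesis
  proof (rule that[OF P(1) \<eta>])
    fix M :: "'u monoid" and \<phi> assume M: "monoid M" and \<phi>: "\<phi> \<in> B_hom B (bar M)"
    define f where "f e = hd (\<phi> 1 e)" for e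
    have \<phi>f: "\<phi> n x = map f (bedges B n x)" if "x \<in> bcells B n" for n x
      using bedges_bar_hom[OF B \<phi> that] by (simp add: f_def)
    have \<phi>1: "\<phi> 1 e = [f e]" "f e \<in> carrier M" if "e \<in> A" for e
    proof -
      show "\<phi> 1 e = [f e]" using \<phi>f[of e 1] bedges_1[OF B, of e] that by (simp add: A_def)
      then show "f e \<in> carrier M" using B_homD(1)[OF \<phi>, of e 1] that by (simp add: A_def bar_def)
    qed
    have "\<exists>h\<in>mon_hom P M. \<forall>a\<in>A. h (\<iota> a) = f a"
    proof (rule univ[OF M])
      show "f \<in> A \<rightarrow> carrier M" using \<phi>1 by blast
      fix u v assume "(u, v) \<in> R"
      then obtain n x where uv: "u = [bact B 1 n (long_edge n) x]" "v = bedges B n x"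
        and x: "x \<in> bcells B n" by (auto simp: R_def)
      let ?b = "bact B 1 n (long_edge n) x"
      have b: "?b \<in> A" using B_objectD(1)[OF B long_edge x] by (simp add: A_def)
      have l: "length (\<phi> n x) = n" using B_homD(1)[OF \<phi> x] by (simp add: bar_def)
      have "[f ?b] = bact (bar M) 1 n (long_edge n) (\<phi> n x)"
        using \<phi>1[OF b] B_homD(2)[OF \<phi> long_edge x] by simp
      also have "\<dots> = [mprod M (map (\<lambda>i. \<phi> n x ! i) [0..<n])]"
        by (simp add: bar_def long_edge_def)
      also have "\<dots> = [mprod M (\<phi> n x)]" using map_nth[of "\<phi> n x"] l by simp
      finally show "mprod M (map f u) = mprod M (map f v)"
        using uv \<phi>f[OF x] \<phi>1[OF b] M by (simp add: monoid.r_one)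
    qed
    then obtain h where h: "h \<in> mon_hom P M" and hA: "\<And>a. a \<in> A \<Longrightarrow> h (\<iota> a) = f a" by blast
    show "\<exists>!h. h \<in> mon_hom P M \<and> h \<in> extensional (carrier P) \<and>
         (\<forall>n. \<forall>x\<in>bcells B n. bar_map h n (\<eta> n x) = \<phi> n x)"
    proof (rule ex1I[of _ "restrict h (carrier P)"])
      have "map (restrict h (carrier P)) (map \<iota> (bedges B n x)) = map f (bedges B n x)"
        if "x \<in> bcells B n" for n x
        using bedges_cells[OF B that] hA P(2) by (auto simp: A_def Pi_iff)
      then show "restrict h (carrier P) \<in> mon_hom P M \<and>
          restrict h (carrier P) \<in> extensional (carrier P) \<and>
         (\<forall>n. \<forall>x\<in>bcells B n. bar_map (restrict h (carrier P)) n (\<eta> n x) = \<phi> n x)"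
        using mon_hom_restrict[OF P(1) h] \<phi>f by (simp add: bar_map_def \<eta>_def)
      fix k assume k: "k \<in> mon_hom P M \<and> k \<in> extensional (carrier P) \<and>
         (\<forall>n. \<forall>x\<in>bcells B n. bar_map k n (\<eta> n x) = \<phi> n x)"
      have kA: "k (\<iota> a) = h (\<iota> a)" if "a \<in> A" for a
      proof -
        have "bar_map k 1 (\<eta> 1 a) = \<phi> 1 a" using k that unfolding A_def by blast
        then show ?thesis
          using bedges_1[OF B, of a] hA[OF that] \<phi>1[OF that] that by (simp add: A_def bar_map_def \<eta>_def)
      qed
      show "k = restrict h (carrier P)"
      proof (rule extensionalityI)
        show "k \<in> extensional (carrier P)" using k by blast
        fix y assume y: "y \<in> carrier P"
        have "k y = h y"
          using k by (intro mon_hom_eqI[OF _ h P(1) P(2) gen kA y]) auto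
        then show "k y = restrict h (carrier P) y" using y by simp
      qed auto
    qed
  qed
qed

lemma B_hom_comp:
  "\<phi> \<in> B_hom B B' \<Longrightarrow> \<psi> \<in> B_hom B' B'' \<Longrightarrow> B_object B \<Longrightarrow> (\<lambda>n. \<psi> n \<circ> \<phi> n) \<in> B_hom B B''"
  by (simp add: B_hom_def Pi_iff B_objectD(2,3) map_prod_def split_beta)

lemma B_hom_id: "(\<lambda>n x. x) \<in> B_hom B B"
  by (simp add: B_hom_def map_prod_def)

lemma bar_map_hom:
  assumes M: "monoid M" and h: "h \<in> mon_hom M N"
  shows "bar_map h \<in> B_hom (bar M) (bar N)"
  unfolding B_hom_def
proof (intro CollectI conjI allI ballI)
  show "bar_map h n \<in> bcells (bar M) n \<rightarrow> bcells (bar N) n" for n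
    using mon_hom_closed[OF h] by (auto simp: bar_def bar_map_def subset_iff)
  show "bar_map h m (bact (bar M) m n f xs) = bact (bar N) m n f (bar_map h n xs)"
    if f: "f \<in> Delta_act m n" and xs: "xs \<in> bcells (bar M) n" for m n f xs
  proof -
    have "h (mprod M (map ((!) xs) [f j..<f (Suc j)])) = mprod N (map ((!) (map h xs)) [f j..<f (Suc j)])"
      if j: "j < m" for j
    proof -
      have "f (Suc j) \<le> n" using f j by (auto simp: Delta_act_def Delta_def)
      then have l: "i < length xs" if "i \<in> set [f j..<f (Suc j)]" for i
        using that xs by (auto simp: bar_def)
      have "set (map ((!) xs) [f j..<f (Suc j)]) \<subseteq> carrier M"
        using l xs by (auto simp: bar_def)
      then have "h (mprod M (map ((!) xs) [f j..<f (Suc j)])) = mprod N (map h (map ((!) xs) [f j..<f (Suc j)]))"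
        by (rule mon_hom_mprod[OF h M])
      also have "map h (map ((!) xs) [f j..<f (Suc j)]) = map ((!) (map h xs)) [f j..<f (Suc j)]"
        using l by simp
      finally show ?thesis .
    qed
    then show ?thesis by (simp add: bar_def bar_map_def)
  qed
qed (simp add: bar_def bar_map_def take_map drop_map)

lemma ex_left_adjoint_of_bar:
  "\<exists>C Cmap. left_adjoint_of_bar (C :: 'u::infinite bobj \<Rightarrow> 'u monoid) Cmap"
proof -
  define Q where "Q B P \<eta> \<longleftrightarrow> monoid P \<and> \<eta> \<in> B_hom B (bar P) \<and>
    (\<forall>(M :: 'u monoid) \<phi>. monoid M \<longrightarrow> \<phi> \<in> B_hom B (bar M) \<longrightarrow>
       (\<exists>!h. h \<in> mon_hom P M \<and> h \<in> extensional (carrier P) \<and>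
         (\<forall>n. \<forall>x\<in>bcells B n. bar_map h n (\<eta> n x) = \<phi> n x)))"
    for B :: "'u bobj" and P :: "'u monoid" and \<eta>
  have "\<exists>P \<eta>. Q B P \<eta>" if "B_object B" for B
    by (rule cobar_object[OF that]) (unfold Q_def, blast)
  then obtain C \<eta> where Q: "\<And>B. B_object B \<Longrightarrow> Q B (C B) (\<eta> B)" by metis
  have mon: "monoid (C B)" and \<eta>: "\<eta> B \<in> B_hom B (bar (C B))"
    and univ: "\<And>(M :: 'u monoid) \<phi>. monoid M \<Longrightarrow> \<phi> \<in> B_hom B (bar M) \<Longrightarrow>
       \<exists>!h. h \<in> mon_hom (C B) M \<and> h \<in> extensional (carrier (C B)) \<and>
         (\<forall>n. \<forall>x\<in>bcells B n. bar_map h n (\<eta> B n x) = \<phi> n x)"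
    if "B_object B" for B
    using Q[OF that] unfolding Q_def by blast+
  have uniq: "h y = k y" if B: "B_object B" and M: "monoid M" and h: "h \<in> mon_hom (C B) M"
    and k: "k \<in> mon_hom (C B) M"
    and hk: "\<And>n x. x \<in> bcells B n \<Longrightarrow> map h (\<eta> B n x) = map k (\<eta> B n x)" and y: "y \<in> carrier (C B)"
    for B and M :: "'u monoid" and h k y
  proof -
    let ?r = "\<lambda>h. restrict h (carrier (C B))"
    have c: "set (\<eta> B n x) \<subseteq> carrier (C B)" if "x \<in> bcells B n" for n x
      using B_homD(1)[OF \<eta>[OF B] that] by (simp add: bar_def)
    have r: "bar_map (?r f) n (\<eta> B n x) = map f (\<eta> B n x)" if "x \<in> bcells B n" for f :: "'u \<Rightarrow> 'u" and n x
      using c[OF that] by (auto simp: bar_map_def)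
    have "(\<lambda>n. bar_map h n \<circ> \<eta> B n) \<in> B_hom B (bar M)"
      by (rule B_hom_comp[OF \<eta>[OF B] bar_map_hom[OF mon[OF B] h] B])
    note ex1 = univ[OF B M this]
    obtain f where u: "\<And>h'. h' \<in> mon_hom (C B) M \<and> h' \<in> extensional (carrier (C B)) \<and>
        (\<forall>n. \<forall>x\<in>bcells B n. bar_map h' n (\<eta> B n x) = (bar_map h n \<circ> \<eta> B n) x) \<Longrightarrow> h' = f"
      using ex1 by (elim ex1E) blast
    have "?r h = f"
      by (rule u) (use mon_hom_restrict[OF mon[OF B] h] r in \<open>simp add: bar_map_def\<close>)
    moreover have "?r k = f"
      by (rule u) (use mon_hom_restrict[OF mon[OF B] k] r hk in \<open>simp add: bar_map_def\<close>)
    ultimately have "?r h = ?r k" by simp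
    then show ?thesis using y by (metis restrict_apply')
  qed
  define Cm where "Cm B B' \<phi> = (THE h. h \<in> mon_hom (C B) (C B') \<and> h \<in> extensional (carrier (C B)) \<and>
      (\<forall>n. \<forall>x\<in>bcells B n. bar_map h n (\<eta> B n x) = (\<eta> B' n \<circ> \<phi> n) x))" for B B' \<phi>
  have Cm: "Cm B B' \<phi> \<in> mon_hom (C B) (C B') \<and> Cm B B' \<phi> \<in> extensional (carrier (C B)) \<and>
      (\<forall>n. \<forall>x\<in>bcells B n. bar_map (Cm B B' \<phi>) n (\<eta> B n x) = (\<eta> B' n \<circ> \<phi> n) x)"
    if "B_object B" "B_object B'" "\<phi> \<in> B_hom B B'" for B B' \<phi>
    unfolding Cm_def
    by (rule theI'[OF univ[OF that(1) mon[OF that(2)] B_hom_comp[OF that(3) \<eta>[OF that(2)] that(1)]]])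
  have "left_adjoint_of_bar C Cm"
  proof (rule left_adjoint_of_bar.intro)
    show "\<And>B. B_object B \<Longrightarrow> monoid (C B)" by (rule mon)
    show "\<And>B B' \<phi>. B_object B \<Longrightarrow> B_object B' \<Longrightarrow> \<phi> \<in> B_hom B B' \<Longrightarrow> Cm B B' \<phi> \<in> mon_hom (C B) (C B')"
      using Cm by blast
    show "Cm B B (\<lambda>n x. x) y = y" if "B_object B" "y \<in> carrier (C B)" for B y
    proof (rule uniq[where h = "Cm B B (\<lambda>n x. x)" and k = "\<lambda>x. x",
          OF that(1) mon[OF that(1)] _ mon_hom_id _ that(2)])
      note c = Cm[OF that(1,1) B_hom_id]
      show "Cm B B (\<lambda>n x. x) \<in> mon_hom (C B) (C B)" using c by blast
      show "map (Cm B B (\<lambda>n x. x)) (\<eta> B n x) = map (\<lambda>x. x) (\<eta> B n x)" if "x \<in> bcells B n" for n x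
        using c that by (simp add: bar_map_def)
    qed
    show "Cm B B'' (\<lambda>n. \<psi> n \<circ> \<phi> n) y = Cm B' B'' \<psi> (Cm B B' \<phi> y)"
      if m: "B_object B" "B_object B'" "B_object B''" "\<phi> \<in> B_hom B B'" "\<psi> \<in> B_hom B' B''"
        "y \<in> carrier (C B)" for B B' B'' \<phi> \<psi> y
    proof -
      note c1 = Cm[OF m(1,2,4)] and c2 = Cm[OF m(2,3,5)] and c3 = Cm[OF m(1,3) B_hom_comp[OF m(4,5,1)]]
      have "Cm B B'' (\<lambda>n. \<psi> n \<circ> \<phi> n) y = (Cm B' B'' \<psi> \<circ> Cm B B' \<phi>) y"
      proof (rule uniq[where h = "Cm B B'' (\<lambda>n. \<psi> n \<circ> \<phi> n)" and k = "Cm B' B'' \<psi> \<circ> Cm B B' \<phi>",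
            OF m(1) mon[OF m(3)] _ _ _ m(6)])
        show "Cm B B'' (\<lambda>n. \<psi> n \<circ> \<phi> n) \<in> mon_hom (C B) (C B'')" using c3 by blast
        show "Cm B' B'' \<psi> \<circ> Cm B B' \<phi> \<in> mon_hom (C B) (C B'')" using c1 c2 mon_hom_comp by blast
        show "map (Cm B B'' (\<lambda>n. \<psi> n \<circ> \<phi> n)) (\<eta> B n x) = map (Cm B' B'' \<psi> \<circ> Cm B B' \<phi>) (\<eta> B n x)"
          if "x \<in> bcells B n" for n x
          using c1 c2 c3 that B_homD(1)[OF m(4) that] by (simp add: bar_map_def flip: map_map)
      qed
      then show ?thesis by simp
    qed
    show "\<exists>\<eta>. (\<forall>B. B_object B \<longrightarrow> \<eta> B \<in> B_hom B (bar (C B))) \<and>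
        (\<forall>B B' \<phi>. B_object B \<longrightarrow> B_object B' \<longrightarrow> \<phi> \<in> B_hom B B' \<longrightarrow>
           (\<forall>n. \<forall>x\<in>bcells B n. bar_map (Cm B B' \<phi>) n (\<eta> B n x) = \<eta> B' n (\<phi> n x))) \<and>
        (\<forall>B M \<phi>. B_object B \<longrightarrow> monoid (M :: 'u monoid) \<longrightarrow> \<phi> \<in> B_hom B (bar M) \<longrightarrow>
           (\<exists>!h. h \<in> mon_hom (C B) M \<and> h \<in> extensional (carrier (C B)) \<and>
              (\<forall>n. \<forall>x\<in>bcells B n. bar_map h n (\<eta> B n x) = \<phi> n x)))"
    proof (intro exI[of _ \<eta>] conjI allI impI ballI)
      show "\<eta> B \<in> B_hom B (bar (C B))" if "B_object B" for B by (rule \<eta>[OF that])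
      show "bar_map (Cm B B' \<phi>) n (\<eta> B n x) = \<eta> B' n (\<phi> n x)"
        if "B_object B" "B_object B'" "\<phi> \<in> B_hom B B'" "x \<in> bcells B n" for B B' \<phi> n x
        using Cm[OF that(1-3)] that(4) by simp
    qed (rule univ)
  qed
  then show ?thesis by blast
qed

end

theory Submission
  imports Defs
begin

text \<open>
  By the two universal properties, \<open>G (cobar B)\<close> is the group generated by \<open>B\<^bsub>[1]\<^esub>\<close> subject to
  the relations that the long edge of a cell is the product of the edges of its spine.  In degree
  \<open>k\<close> the generators are \<open>e \<in> X\<^bsub>[k+2]\<^esub>\<close>, regarded as an edge with vertices \<open>\<delta>\<^bsub>k+2\<^esub> e\<close> and
  \<open>\<delta>\<^bsub>k+1\<^esub> e\<close> in \<open>X\<^bsub>[k+1]\<^esub>\<close>.  Every vertex \<open>w\<close> is joined by the edge \<open>s\<^sub>k w\<close> to the base point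
  \<open>s\<^sub>k \<delta>\<^bsub>k+1\<^esub> w\<close>, and the triangle \<open>s\<^sub>k e\<close> expresses \<open>e\<close> through these edges; so the group is
  generated by the vertices, subject to \<open>w = 1\<close> for base points \<open>w\<close>.  This is Kan's group, and the
  isomorphism sends \<open>w\<close> to the inverse of \<open>s\<^sub>k w\<close>.
\<close>

section \<open>Free groups and their quotients\<close>

abbreviation word_class :: "'a set \<Rightarrow> (bool \<times> 'a) list \<Rightarrow> (bool \<times> 'a) list set" where
  "word_class S w \<equiv> word_rel S `` {w}"

lemma equiv_word_rel: "equiv (lists (UNIV \<times> S)) (word_rel S)"
proof (rule equivI)
  have "v \<in> lists (UNIV \<times> S) \<and> w \<in> lists (UNIV \<times> S)" if "(v, w) \<in> word_rel S" for v w
    using that by induction auto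
  then show "word_rel S \<subseteq> lists (UNIV \<times> S) \<times> lists (UNIV \<times> S)" by (simp add: subrelI)
qed (auto intro: refl_onI symI transI word_rel.intros)

text \<open>The rule \<open>cancel\<close> carries a context on both sides, so a generating step
  survives adding a fixed word on the left or on the right. The two one-sided versions are then
  chained by transitivity.\<close>

lemma word_rel_append:
  assumes "(u, u') \<in> word_rel S" "(v, v') \<in> word_rel S"
  shows "(u @ v, u' @ v') \<in> word_rel S"
proof -
  note sub = equiv_word_rel[of S, THEN equiv_type]
  have l: "(p @ a, p @ b) \<in> word_rel S" if "(a, b) \<in> word_rel S" "p \<in> lists (UNIV \<times> S)" for a b p
    using that
  proof induction
    case (refl w)
    then show ?case by (intro word_rel.refl) auto
  next
    case (cancel u v x e)
    then show ?case using word_rel.cancel[of "p @ u" S v x e] by simp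
  qed (auto intro: word_rel.intros simp del: lists_eq_set)
  have r: "(a @ p, b @ p) \<in> word_rel S" if "(a, b) \<in> word_rel S" "p \<in> lists (UNIV \<times> S)" for a b p
    using that
  proof induction
    case (refl w)
    then show ?case by (intro word_rel.refl) auto
  next
    case (cancel u v x e)
    then show ?case using word_rel.cancel[of u S "v @ p" x e] by simp
  qed (auto intro: word_rel.intros simp del: lists_eq_set)
  have "v \<in> lists (UNIV \<times> S)" "u' \<in> lists (UNIV \<times> S)" using assms sub by blast+
  then show ?thesis using r[OF assms(1)] l[OF assms(2)] word_rel.trans by blast
qed

text \<open>The product in \<open>free_group\<close> is a union over all pairs of representatives.
  By \<open>word_rel_append\<close> all classes in that union coincide, so it collapses to a single
  class.\<close>

lemma free_group_mult:
  assumes "u \<in> lists (UNIV \<times> S)" "v \<in> lists (UNIV \<times> S)"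
  shows "word_class S u \<otimes>\<^bsub>free_group S\<^esub> word_class S v = word_class S (u @ v)"
proof -
  have eq: "word_class S (u' @ v') = word_class S (u @ v)"
    if "(u, u') \<in> word_rel S" "(v, v') \<in> word_rel S" for u' v'
    using equiv_class_eq[OF equiv_word_rel word_rel_append[OF that]] by simp
  have ne: "word_class S u \<noteq> {}" "word_class S v \<noteq> {}"
    using word_rel.refl[OF assms(1)] word_rel.refl[OF assms(2)] by blast+
  have "(\<Union>v'\<in>word_class S v. word_class S (u' @ v')) = word_class S (u @ v)"
    if "(u, u') \<in> word_rel S" for u'
    by (rule SUP_eq_const[OF ne(2)]) (use eq that in blast)
  then have "(\<Union>u'\<in>word_class S u. \<Union>v'\<in>word_class S v. word_class S (u' @ v')) = word_class S (u @ v)"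
    by (intro SUP_eq_const[OF ne(1)]) blast
  then show ?thesis by (simp add: free_group_def)
qed

lemma free_group_carrier: "carrier (free_group S) = word_class S ` lists (UNIV \<times> S)"
  by (auto simp: free_group_def quotient_def)

lemma free_group_one: "\<one>\<^bsub>free_group S\<^esub> = word_class S []"
  by (simp add: free_group_def)

lemma free_group_cancel:
  assumes "x \<in> S"
  shows "word_class S [(e, x)] \<otimes>\<^bsub>free_group S\<^esub> word_class S [(\<not> e, x)] = \<one>\<^bsub>free_group S\<^esub>"
  using assms equiv_class_eq[OF equiv_word_rel word_rel.cancel[of "[]" S "[]" x e]]
  by (simp add: free_group_mult free_group_one)

lemma group_free_group: "group (free_group S)"
proof (rule groupI)
  let ?F = "free_group S"
  show "A \<otimes>\<^bsub>?F\<^esub> B \<in> carrier ?F" if "A \<in> carrier ?F" "B \<in> carrier ?F" for A B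
    using that by (auto simp: free_group_carrier free_group_mult in_lists_conv_set ball_Un simp del: lists_eq_set intro!: imageI)
  show "\<one>\<^bsub>?F\<^esub> \<in> carrier ?F"
    by (auto simp: free_group_carrier free_group_one)
  show "A \<otimes>\<^bsub>?F\<^esub> B \<otimes>\<^bsub>?F\<^esub> C = A \<otimes>\<^bsub>?F\<^esub> (B \<otimes>\<^bsub>?F\<^esub> C)"
    if "A \<in> carrier ?F" "B \<in> carrier ?F" "C \<in> carrier ?F" for A B C
    using that by (auto simp: free_group_carrier free_group_mult in_lists_conv_set ball_Un simp del: lists_eq_set)
  show "\<one>\<^bsub>?F\<^esub> \<otimes>\<^bsub>?F\<^esub> A = A" if "A \<in> carrier ?F" for A
    using that by (auto simp: free_group_carrier free_group_one free_group_mult in_lists_conv_set ball_Un simp del: lists_eq_set)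
  \<comment> \<open>A left inverse is built letter by letter: if \<open>v\<close> inverts
    \<open>w\<close>, then \<open>v\<close> followed by the opposite of \<open>a\<close> inverts
    \<open>a # w\<close>, because the two opposite letters cancel in the middle.\<close>
  have "\<exists>v\<in>lists (UNIV \<times> S). word_class S v \<otimes>\<^bsub>?F\<^esub> word_class S w = \<one>\<^bsub>?F\<^esub>"
    if "w \<in> lists (UNIV \<times> S)" for w
    using that
  proof induction
    case Nil
    then show ?case by (intro bexI[of _ "[]"]) (auto simp: free_group_mult free_group_one)
  next
    case (Cons a w)
    then obtain v where v: "v \<in> lists (UNIV \<times> S)" "word_class S (v @ w) = word_class S []"
      by (auto simp: free_group_mult free_group_one simp del: lists_eq_set)
    obtain e x where a: "a = (e, x)" "x \<in> S" using Cons(1) by (cases a) auto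
    have "word_class S (v @ [(\<not> e, x)] @ [(e, x)] @ w) = word_class S (v @ w)"
      using equiv_class_eq[OF equiv_word_rel word_rel.cancel[of v S w x "\<not> e"]] v a Cons(2) by simp
    then show ?case
      using v a Cons(2) by (intro bexI[of _ "v @ [(\<not> e, x)]"]) (auto simp: free_group_mult free_group_one)
  qed
  then show "\<exists>B\<in>carrier ?F. B \<otimes>\<^bsub>?F\<^esub> A = \<one>\<^bsub>?F\<^esub>" if "A \<in> carrier ?F" for A
    using that by (fastforce simp: free_group_carrier simp del: lists_eq_set)
qed

lemma free_gen_closed: "x \<in> S \<Longrightarrow> free_gen S x \<in> carrier (free_group S)"
  by (auto simp: free_gen_def free_group_carrier)

lemma inv_free_gen:
  assumes "x \<in> S"
  shows "inv\<^bsub>free_group S\<^esub> free_gen S x = word_class S [(False, x)]"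
  using assms free_group_cancel[of x S False]
  by (intro group.inv_equality[OF group_free_group])
     (auto simp: free_gen_def free_group_carrier)

text \<open>Uniqueness half of the universal property of the free group, by induction on a
  representing word. A negative letter is the class of an inverse generator, so agreement there is
  forced as well.\<close>

lemma free_hom_eqI:
  assumes "group H" and h: "h \<in> hom (free_group S) H" and k: "k \<in> hom (free_group S) H"
    and eq: "\<And>x. x \<in> S \<Longrightarrow> h (free_gen S x) = k (free_gen S x)"
    and A: "A \<in> carrier (free_group S)"
  shows "h A = k A"
proof -
  interpret H: group H by fact
  interpret F: group "free_group S" by (rule group_free_group)
  interpret h: group_hom "free_group S" H h by unfold_locales (rule h)
  interpret k: group_hom "free_group S" H k by unfold_locales (rule k)
  have "h (word_class S w) = k (word_class S w)" if "w \<in> lists (UNIV \<times> S)" for w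
    using that
  proof induction
    case Nil
    then show ?case using h.hom_one k.hom_one by (simp add: free_group_one)
  next
    case (Cons a w)
    obtain e x where a: "a = (e, x)" "x \<in> S" using Cons(1) by (cases a) auto
    have "h (word_class S [a]) = k (word_class S [a])"
    proof (cases e)
      case True
      then show ?thesis using eq[OF a(2)] a by (simp add: free_gen_def)
    next
      case False
      then show ?thesis
        using eq[OF a(2)] a h.hom_inv[of "free_gen S x"] k.hom_inv[of "free_gen S x"]
        by (simp add: inv_free_gen free_gen_closed)
    qed
    moreover have "word_class S (a # w) = word_class S [a] \<otimes>\<^bsub>free_group S\<^esub> word_class S w"
      using Cons by (subst free_group_mult) auto
    moreover have "word_class S [a] \<in> carrier (free_group S)" "word_class S w \<in> carrier (free_group S)"
      using Cons by (auto simp: free_group_carrier)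
    ultimately show ?case using Cons by simp
  qed
  then show ?thesis using A by (auto simp: free_group_carrier)
qed

lemma word_eval_append:
  assumes "group H" "f \<in> S \<rightarrow> carrier H" "u \<in> lists (UNIV \<times> S)" "v \<in> lists (UNIV \<times> S)"
  shows "word_eval H f (u @ v) = word_eval H f u \<otimes>\<^bsub>H\<^esub> word_eval H f v"
    and "word_eval H f u \<in> carrier H"
proof -
  interpret group H by fact
  have c: "set (map (\<lambda>(e, x). if e then f x else inv\<^bsub>H\<^esub> f x) w) \<subseteq> carrier H"
    if "w \<in> lists (UNIV \<times> S)" for w
    using that assms(2) by (auto simp: in_lists_conv_set Pi_iff)
  show "word_eval H f (u @ v) = word_eval H f u \<otimes>\<^bsub>H\<^esub> word_eval H f v"
    using c[OF assms(3)] c[OF assms(4)] by (simp add: word_eval_def mprod_append del: set_map)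
  show "word_eval H f u \<in> carrier H"
    using c[OF assms(3)] by (simp add: word_eval_def del: set_map)
qed

text \<open>Only the rule \<open>cancel\<close> needs an argument: a pair of opposite letters
  evaluates to the unit.\<close>

lemma word_eval_cong:
  assumes H: "group H" and f: "f \<in> S \<rightarrow> carrier H" and "(u, v) \<in> word_rel S"
  shows "word_eval H f u = word_eval H f v"
  using assms(3)
proof induction
  case (cancel u v x e)
  interpret group H by fact
  have "f x \<in> carrier H" using f cancel by auto
  then have "word_eval H f [(e, x), (\<not> e, x)] = \<one>\<^bsub>H\<^esub>" by (cases e) (auto simp: word_eval_def)
  moreover have m: "[(e, x), (\<not> e, x)] \<in> lists (UNIV \<times> S)" using cancel by simp
  moreover have "[(e, x), (\<not> e, x)] @ v \<in> lists (UNIV \<times> S)" using cancel by simp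
  ultimately show ?case
    using cancel(1,2)
    by (simp only: word_eval_append[OF H f] l_one)
qed auto

text \<open>The inner stage of \<open>gen_ext\<close>, isolated because it is the homomorphism out
  of the free group; \<open>gen_ext\<close> is the map that it induces on cosets.\<close>

definition free_ext :: "('g, 'c) monoid_scheme \<Rightarrow> ('a \<Rightarrow> 'g) \<Rightarrow> (bool \<times> 'a) list set \<Rightarrow> 'g" where
  "free_ext H f A = the_elem (word_eval H f ` A)"

lemma free_ext_class:
  assumes "group H" "f \<in> S \<rightarrow> carrier H" "w \<in> lists (UNIV \<times> S)"
  shows "free_ext H f (word_class S w) = word_eval H f w"
proof -
  have "word_eval H f v = word_eval H f w" if "v \<in> word_class S w" for v
    using word_eval_cong[OF assms(1,2)] that by (metis Image_singleton_iff)
  moreover have "word_class S w \<noteq> {}" using word_rel.refl[OF assms(3)] by blast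
  ultimately show ?thesis
    unfolding free_ext_def by (rule the_elem_image_unique[rotated])
qed

lemma free_ext_hom:
  assumes "group H" "f \<in> S \<rightarrow> carrier H"
  shows "free_ext H f \<in> hom (free_group S) H"
  by (rule homI)
     (auto simp: free_group_carrier free_group_mult free_ext_class[OF assms]
       word_eval_append[OF assms] in_lists_conv_set ball_Un simp del: lists_eq_set)

lemma free_ext_gen:
  assumes "group H" "f \<in> S \<rightarrow> carrier H" "x \<in> S"
  shows "free_ext H f (free_gen S x) = f x"
proof -
  interpret group H by fact
  show ?thesis
    using assms free_ext_class[OF assms(1,2), of "[(True, x)]"]
    by (auto simp: free_gen_def word_eval_def Pi_iff)
qed

lemma normal_normal_closure:
  assumes "group H" "R \<subseteq> carrier H"
  shows "normal_closure H R \<lhd> H" "R \<subseteq> normal_closure H R"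
proof -
  interpret group H by fact
  let ?N = "{N. N \<lhd> H \<and> R \<subseteq> N}"
  \<comment> \<open>The whole group is a member of \<open>?N\<close>, so the family that is
    intersected is nonempty.\<close>
  have "carrier H \<lhd> H" by (simp add: normal_inv_iff subgroup_self)
  then have "carrier H \<in> ?N" using assms by simp
  then have "subgroup (\<Inter>?N) H"
    by (intro subgroups_Inter) (auto intro: normal_imp_subgroup)
  then show "normal_closure H R \<lhd> H"
    unfolding normal_closure_def by (auto simp: normal_inv_iff)
  show "R \<subseteq> normal_closure H R" by (auto simp: normal_closure_def)
qed

text \<open>The kernel is normal and contains the relators, hence is one of the subgroups that are
  intersected.\<close>

lemma normal_closure_le_kernel:
  assumes "group_hom H K h" "R \<subseteq> kernel H K h"
  shows "normal_closure H R \<subseteq> kernel H K h"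
  using group_hom.normal_kernel[OF assms(1)] assms(2) by (auto simp: normal_closure_def)

text \<open>The outer \<open>the_elem\<close> in \<open>gen_ext\<close> is meaningful only if
  \<open>free_ext H f\<close> is constant on the coset. This holds because \<open>N\<close> lies in
  the kernel, and the constant is read off at \<open>A\<close>, a member of its own coset.\<close>

lemma gen_ext_coset:
  assumes H: "group H" and f: "f \<in> S \<rightarrow> carrier H" and N: "N \<lhd> free_group S"
    and ker: "N \<subseteq> kernel (free_group S) H (free_ext H f)" and A: "A \<in> carrier (free_group S)"
  shows "gen_ext H f (N #>\<^bsub>free_group S\<^esub> A) = free_ext H f A"
proof -
  interpret H: group H by fact
  interpret N: normal N "free_group S" by fact
  have "free_ext H f (n \<otimes>\<^bsub>free_group S\<^esub> A) = free_ext H f A" if "n \<in> N" for n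
    using that ker A hom_mult[OF free_ext_hom[OF H f], of n A] hom_in_carrier[OF free_ext_hom[OF H f] A]
    by (auto simp: kernel_def)
  moreover have "A \<in> N #>\<^bsub>free_group S\<^esub> A" by (rule N.rcos_self[OF A N.is_subgroup])
  ultimately have "free_ext H f ` (N #>\<^bsub>free_group S\<^esub> A) = {free_ext H f A}"
    unfolding r_coset_def by blast
  then show ?thesis by (simp add: gen_ext_def free_ext_def[abs_def])
qed


section \<open>Kan's loop group in a fixed degree\<close>

lemma simplicial_setD:
  assumes "simplicial_set X"
  shows "f \<in> Delta m n \<Longrightarrow> x \<in> cells X n \<Longrightarrow> sact X m n f x \<in> cells X m"
    and "x \<in> cells X n \<Longrightarrow> sact X n n (idD n) x = x"
    and "\<lbrakk>f \<in> Delta l m; g \<in> Delta m n; x \<in> cells X n\<rbrakk>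
      \<Longrightarrow> sact X l m f (sact X m n g x) = sact X l n (compose {..l} g f) x"
  using assms unfolding simplicial_set_def by blast+

lemma coface_Delta: "coface n i \<in> Delta n (Suc n)"
  by (auto simp: coface_def Delta_def mono_on_def)

lemma codegen_Delta: "i \<le> n \<Longrightarrow> codegen n i \<in> Delta (Suc n) n"
  by (auto simp: codegen_def Delta_def mono_on_def)

lemma sface_closed: "simplicial_set X \<Longrightarrow> x \<in> cells X (Suc n) \<Longrightarrow> sface X n i x \<in> cells X n"
  unfolding sface_def by (rule simplicial_setD(1)[OF _ coface_Delta])

lemma sdegen_closed:
  "simplicial_set X \<Longrightarrow> i \<le> n \<Longrightarrow> x \<in> cells X n \<Longrightarrow> sdegen X n i x \<in> cells X (Suc n)"
  unfolding sdegen_def by (rule simplicial_setD(1)[OF _ codegen_Delta])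

lemma kan_relators:
  assumes "simplicial_set X"
  shows "(\<lambda>y. free_gen (cells X (Suc k)) (sdegen X k k y)) ` cells X k
    \<subseteq> carrier (free_group (cells X (Suc k)))"
  by (auto intro!: free_gen_closed sdegen_closed[OF assms order_refl])

lemma kan_rel_normal:
  assumes "simplicial_set X"
  shows "kan_rel X k \<lhd> free_group (cells X (Suc k))"
  unfolding kan_rel_def by (rule normal_normal_closure(1)[OF group_free_group kan_relators[OF assms]])

lemma group_kan_grp: "simplicial_set X \<Longrightarrow> group (kan_grp X k)"
  unfolding kan_grp_def by (rule normal.factorgroup_is_group[OF kan_rel_normal])

lemma kan_coset_hom:
  assumes "simplicial_set X"
  shows "(\<lambda>A. kan_rel X k #>\<^bsub>free_group (cells X (Suc k))\<^esub> A)
    \<in> hom (free_group (cells X (Suc k))) (kan_grp X k)"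
  unfolding kan_grp_def by (rule normal.r_coset_hom_Mod[OF kan_rel_normal[OF assms]])

lemma kan_gen_closed:
  assumes "simplicial_set X" "x \<in> cells X (Suc k)"
  shows "kan_gen X k x \<in> carrier (kan_grp X k)"
  unfolding kan_gen_def by (rule hom_in_carrier[OF kan_coset_hom[OF assms(1)] free_gen_closed[OF assms(2)]])

text \<open>The generator is a relator, so its coset is \<open>kan_rel X k\<close> itself, the unit
  of the quotient.\<close>

lemma kan_gen_degenerate:
  assumes X: "simplicial_set X" and y: "y \<in> cells X k"
  shows "kan_gen X k (sdegen X k k y) = \<one>\<^bsub>kan_grp X k\<^esub>"
proof -
  let ?F = "free_group (cells X (Suc k))"
  interpret F: group ?F by (rule group_free_group)
  have "free_gen (cells X (Suc k)) (sdegen X k k y) \<in> kan_rel X k"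
    unfolding kan_rel_def
    by (rule normal_normal_closure(2)[OF group_free_group kan_relators[OF X], THEN subsetD]) (use y in blast)
  then have "kan_gen X k (sdegen X k k y) = kan_rel X k"
    unfolding kan_gen_def using kan_relators[OF X, of k] y
    by (intro F.coset_join2 normal_imp_subgroup kan_rel_normal X) blast
  then show ?thesis by (simp add: kan_grp_def)
qed

text \<open>Every element of the quotient is the coset of an element of the free group, so composing
  with the quotient map reduces this to \<open>free_hom_eqI\<close>.\<close>

lemma kan_hom_eqI:
  assumes X: "simplicial_set X" and H: "group H"
    and h: "h \<in> hom (kan_grp X k) H" and h': "h' \<in> hom (kan_grp X k) H"
    and eq: "\<And>x. x \<in> cells X (Suc k) \<Longrightarrow> h (kan_gen X k x) = h' (kan_gen X k x)"
    and c: "c \<in> carrier (kan_grp X k)"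
  shows "h c = h' c"
proof -
  let ?q = "\<lambda>A. kan_rel X k #>\<^bsub>free_group (cells X (Suc k))\<^esub> A"
  obtain A where A: "A \<in> carrier (free_group (cells X (Suc k)))" "c = ?q A"
    using c by (auto simp: kan_grp_def carrier_FactGroup)
  have "(h \<circ> ?q) A = (h' \<circ> ?q) A"
    by (rule free_hom_eqI[OF H hom_compose[OF kan_coset_hom[OF X] h] hom_compose[OF kan_coset_hom[OF X] h'] _ A(1)])
       (simp add: eq flip: kan_gen_def)
  then show ?thesis by (simp add: A(2))
qed

text \<open>Existence half of the universal property of Kan's group. The faces, degeneracies and
  induced maps of \<open>kan_loop\<close>, as well as \<open>comparison\<close>, are all given by
  \<open>gen_ext\<close>; this shows that they are homomorphisms with the intended values on
  generators.\<close>

lemma kan_ext: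
  assumes X: "simplicial_set X" and H: "group H" and f: "f \<in> cells X (Suc k) \<rightarrow> carrier H"
    and degenerate: "\<And>y. y \<in> cells X k \<Longrightarrow> f (sdegen X k k y) = \<one>\<^bsub>H\<^esub>"
  shows "gen_ext H f \<in> hom (kan_grp X k) H"
    and "x \<in> cells X (Suc k) \<Longrightarrow> gen_ext H f (kan_gen X k x) = f x"
proof -
  let ?F = "free_group (cells X (Suc k))" and ?N = "kan_rel X k"
  interpret F: group ?F by (rule group_free_group)
  interpret N: normal ?N ?F by (rule kan_rel_normal[OF X])
  note hom = free_ext_hom[OF H f]
  have "group_hom ?F H (free_ext H f)"
    by (intro group_hom.intro group_hom_axioms.intro group_free_group H hom)
  then have ker: "?N \<subseteq> kernel ?F H (free_ext H f)"
    unfolding kan_rel_def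
    using sdegen_closed[OF X order_refl]
    by (intro normal_closure_le_kernel) (auto simp: kernel_def free_ext_gen[OF H f] degenerate intro: free_gen_closed)
  note ext = gen_ext_coset[OF H f kan_rel_normal[OF X] ker]
  show "gen_ext H f \<in> hom (kan_grp X k) H"
  proof (rule homI)
    show "gen_ext H f c \<in> carrier H" if "c \<in> carrier (kan_grp X k)" for c
      using that hom_in_carrier[OF hom] by (auto simp: kan_grp_def carrier_FactGroup ext)
    show "gen_ext H f (c \<otimes>\<^bsub>kan_grp X k\<^esub> d) = gen_ext H f c \<otimes>\<^bsub>H\<^esub> gen_ext H f d"
      if "c \<in> carrier (kan_grp X k)" "d \<in> carrier (kan_grp X k)" for c d
      using that hom_mult[OF hom]
      by (auto simp: kan_grp_def carrier_FactGroup ext N.rcos_sum)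
  qed
  show "gen_ext H f (kan_gen X k x) = f x" if "x \<in> cells X (Suc k)"
    using that by (simp add: kan_gen_def ext free_gen_closed free_ext_gen[OF H f])
qed

section \<open>A copy of Kan's group inside the universe\<close>

lemma iso_copy:
  fixes e :: "'a \<Rightarrow> 'b"
  assumes K: "group K" and e: "inj_on e (carrier K)"
  obtains H :: "'b monoid" where "group H" "e \<in> iso K H"
proof -
  interpret K: group K by fact
  let ?d = "inv_into (carrier K) e"
  define H where "H = \<lparr>carrier = e ` carrier K, monoid.mult = (\<lambda>a b. e (?d a \<otimes>\<^bsub>K\<^esub> ?d b)), one = e \<one>\<^bsub>K\<^esub>\<rparr>"
  have iso: "e \<in> iso K H"
    using e by (auto simp: iso_def hom_def bij_betw_def H_def)
  then have "group H" using K.iso_imp_img_group[OF iso] by (simp add: H_def)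
  then show ?thesis using that[OF _ iso] by blast
qed

text \<open>The adjunctions only provide maps into groups with elements in \<open>'u\<close>,
  whereas Kan's group consists of sets of sets of words. Choosing one word for each element and
  encoding words injectively in \<open>'u\<close> bridges the gap.\<close>

lemma kan_grp_copy:
  fixes X :: "'u::infinite sset"
  assumes X: "simplicial_set X"
  obtains H :: "'u monoid" and e where "group H" "e \<in> iso (kan_grp X k) H"
proof -
  let ?W = "lists ((UNIV :: bool set) \<times> cells X (Suc k))"
  define q where "q w = kan_rel X k #>\<^bsub>free_group (cells X (Suc k))\<^esub> word_class (cells X (Suc k)) w" for w
  have "carrier (kan_grp X k) = q ` ?W"
    by (auto simp: kan_grp_def carrier_FactGroup free_group_carrier q_def simp del: lists_eq_set)
  then have "inj_on (inv_into ?W q) (carrier (kan_grp X k))"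
    by (simp add: inj_on_inv_into)
  moreover obtain g :: "(bool \<times> 'u) list \<Rightarrow> 'u" where "inj g"
    using ex_inj_signed_list by blast
  ultimately have "inj_on (g \<circ> inv_into ?W q) (carrier (kan_grp X k))"
    by (meson comp_inj_on inj_on_subset subset_UNIV)
  then show ?thesis using iso_copy[OF group_kan_grp[OF X]] that by metis
qed

section \<open>A presentation of \<open>G \<circ> cobar\<close>\<close>

text \<open>The two adjunctions repackaged as a presentation: \<open>gen B\<close> gives the
  generators, \<open>gen_long_edge\<close> the relations, \<open>GC_ext\<close> and
  \<open>GC_eqI\<close> the universal property for targets with elements in \<open>'u\<close>. The
  comparison with Kan's group uses nothing else about \<open>C\<close> and \<open>G\<close>.\<close>

locale group_bar_presentation =
  fixes C :: "'u::infinite bobj \<Rightarrow> 'u monoid"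
    and Cmap :: "'u bobj \<Rightarrow> 'u bobj \<Rightarrow> (nat \<Rightarrow> 'u \<Rightarrow> 'u) \<Rightarrow> 'u \<Rightarrow> 'u"
    and G :: "'u monoid \<Rightarrow> 'u monoid"
    and Gmap :: "'u monoid \<Rightarrow> 'u monoid \<Rightarrow> ('u \<Rightarrow> 'u) \<Rightarrow> 'u \<Rightarrow> 'u"
    and gen :: "'u bobj \<Rightarrow> 'u \<Rightarrow> 'u"
  assumes group_GC: "B_object B \<Longrightarrow> group (G (C B))"
    and GC_map_hom: "\<lbrakk>B_object B; B_object B'; \<phi> \<in> B_hom B B'\<rbrakk>
      \<Longrightarrow> Gmap (C B) (C B') (Cmap B B' \<phi>) \<in> hom (G (C B)) (G (C B'))"
    and gen_closed: "\<lbrakk>B_object B; e \<in> bcells B 1\<rbrakk> \<Longrightarrow> gen B e \<in> carrier (G (C B))"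
    and gen_long_edge: "\<lbrakk>B_object B; x \<in> bcells B n\<rbrakk>
      \<Longrightarrow> gen B (bact B 1 n (long_edge n) x) = mprod (G (C B)) (map (gen B) (bedges B n x))"
    and GC_map_gen: "\<lbrakk>B_object B; B_object B'; \<phi> \<in> B_hom B B'; e \<in> bcells B 1\<rbrakk>
      \<Longrightarrow> Gmap (C B) (C B') (Cmap B B' \<phi>) (gen B e) = gen B' (\<phi> 1 e)"
    and GC_ext: "\<lbrakk>B_object B; group H; f \<in> bcells B 1 \<rightarrow> carrier H;
       \<And>n x. x \<in> bcells B n \<Longrightarrow> f (bact B 1 n (long_edge n) x) = mprod H (map f (bedges B n x))\<rbrakk>
       \<Longrightarrow> \<exists>h\<in>hom (G (C B)) (H :: 'u monoid). \<forall>e\<in>bcells B 1. h (gen B e) = f e"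
    and GC_eqI: "\<lbrakk>B_object B; group (H :: 'u monoid); h \<in> hom (G (C B)) H; k \<in> hom (G (C B)) H;
       \<And>e. e \<in> bcells B 1 \<Longrightarrow> h (gen B e) = k (gen B e); y \<in> carrier (G (C B))\<rbrakk> \<Longrightarrow> h y = k y"

text \<open>The generator of an edge is its image under both units. The first unit takes values in
  \<open>bar\<close>, so an edge becomes a list of length one, whose head is then sent to the group
  completion.\<close>

lemma ex_group_bar_presentation:
  fixes C :: "'u::infinite bobj \<Rightarrow> 'u monoid"
  assumes "left_adjoint_of_bar C Cmap" "group_completion G Gmap"
  obtains gen where "group_bar_presentation C Cmap G Gmap gen"
proof -
  interpret C: left_adjoint_of_bar C Cmap by fact
  interpret G: group_completion G Gmap by fact
  obtain \<eta> where \<eta>: "\<And>B. B_object B \<Longrightarrow> \<eta> B \<in> B_hom B (bar (C B))"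
    and \<eta>_nat: "\<And>B B' \<phi> n x. \<lbrakk>B_object B; B_object B'; \<phi> \<in> B_hom B B'; x \<in> bcells B n\<rbrakk> \<Longrightarrow>
      bar_map (Cmap B B' \<phi>) n (\<eta> B n x) = \<eta> B' n (\<phi> n x)"
    and \<eta>_univ: "\<And>B (M :: 'u monoid) \<phi>. \<lbrakk>B_object B; monoid M; \<phi> \<in> B_hom B (bar M)\<rbrakk> \<Longrightarrow>
      \<exists>!h. h \<in> mon_hom (C B) M \<and> h \<in> extensional (carrier (C B)) \<and>
        (\<forall>n. \<forall>x\<in>bcells B n. bar_map h n (\<eta> B n x) = \<phi> n x)"
    by (rule exE[OF C.adjunction], elim conjE) (rule that, erule allE, erule mp, assumption, simp_all)
  obtain \<iota> where \<iota>: "\<And>M. monoid M \<Longrightarrow> \<iota> M \<in> mon_hom M (G M)"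
    and \<iota>_nat: "\<And>M N h x. \<lbrakk>monoid M; monoid N; h \<in> mon_hom M N; x \<in> carrier M\<rbrakk> \<Longrightarrow>
      Gmap M N h (\<iota> M x) = \<iota> N (h x)"
    and \<iota>_univ: "\<And>M (H :: 'u monoid) f. \<lbrakk>monoid M; group H; f \<in> mon_hom M H\<rbrakk> \<Longrightarrow>
      \<exists>!h. h \<in> hom (G M) H \<and> h \<in> extensional (carrier (G M)) \<and> (\<forall>x\<in>carrier M. h (\<iota> M x) = f x)"
    by (rule exE[OF G.adjunction], elim conjE) (rule that, erule allE, erule mp, assumption, simp_all)
  define edge where "edge B e = hd (\<eta> B 1 e)" for B e
  \<comment> \<open>A morphism into a bar construction is determined by its values on edges.\<close>
  have \<eta>_edges: "\<eta> B n x = map (edge B) (bedges B n x)" if "B_object B" "x \<in> bcells B n" for B n x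
    using bedges_bar_hom[OF that(1) \<eta>[OF that(1)] that(2)] by (simp add: edge_def[abs_def])
  have \<eta>_edge: "\<eta> B 1 e = [edge B e]" if "B_object B" "e \<in> bcells B 1" for B e
    using \<eta>_edges[OF that] bedges_1[OF that] by simp
  have edge: "edge B e \<in> carrier (C B)" if "B_object B" "e \<in> bcells B 1" for B e
    using B_homD(1)[OF \<eta>[OF that(1)] that(2)] \<eta>_edge[OF that] by (simp add: bar_def)
  have edge_rel: "edge B (bact B 1 n (long_edge n) x) = mprod (C B) (map (edge B) (bedges B n x))"
    if B: "B_object B" and x: "x \<in> bcells B n" for B n x
  proof -
    interpret M: monoid "C B" by (rule C.C_monoid[OF B])
    let ?xs = "map (edge B) (bedges B n x)"
    have "[edge B (bact B 1 n (long_edge n) x)] = bact (bar (C B)) 1 n (long_edge n) ?xs"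
      using B_homD(2)[OF \<eta>[OF B] long_edge x] \<eta>_edges[OF B x]
        \<eta>_edge[OF B B_objectD(1)[OF B long_edge x]] by simp
    \<comment> \<open>The map \<open>long_edge n\<close> has a single step, from 0 to
      \<open>n\<close>, so the bar action multiplies the whole list.\<close>
    also have "\<dots> = [mprod (C B) (map ((!) ?xs) [0..<n])]"
      by (simp add: bar_def long_edge_def)
    also have "\<dots> = [mprod (C B) ?xs]" using map_nth[of ?xs] by simp
    finally show ?thesis by simp
  qed
  have Cmon: "monoid (C B)" and Ggrp: "group (G (C B))" if "B_object B" for B
    using that C.C_monoid G.G_group by blast+
  have C_eqI: "h y = k y" if B: "B_object B" and M: "monoid M" and h: "h \<in> mon_hom (C B) M"
    and k: "k \<in> mon_hom (C B) M"
    and hk: "\<And>e. e \<in> bcells B 1 \<Longrightarrow> h (edge B e) = k (edge B e)" and y: "y \<in> carrier (C B)"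
    for B and M :: "'u monoid" and h k y
  proof -
    \<comment> \<open>Uniqueness in the adjunction concerns extensional functions only. Both
      restrictions solve the factorization problem posed by \<open>h\<close>, hence
      coincide.\<close>
    let ?r = "\<lambda>h. restrict h (carrier (C B))"
    have c: "set (\<eta> B n x) \<subseteq> carrier (C B)" if "x \<in> bcells B n" for n x
      using B_homD(1)[OF \<eta>[OF B] that] by (simp add: bar_def)
    have r: "bar_map (?r f) n (\<eta> B n x) = map f (\<eta> B n x)" if "x \<in> bcells B n" for f :: "'u \<Rightarrow> 'u" and n x
      using c[OF that] by (auto simp: bar_map_def)
    \<comment> \<open>The unit is a list of edge values on every cell, so agreement on edges
      suffices.\<close>
    have hk': "map k (\<eta> B n x) = map h (\<eta> B n x)" if "x \<in> bcells B n" for n x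
      using \<eta>_edges[OF B that] bedges_cells[OF B that] hk by auto
    have "(\<lambda>n. bar_map h n \<circ> \<eta> B n) \<in> B_hom B (bar M)"
      by (rule B_hom_comp[OF \<eta>[OF B] bar_map_hom[OF Cmon[OF B] h] B])
    note ex1 = \<eta>_univ[OF B M this]
    obtain f where u: "\<And>h'. h' \<in> mon_hom (C B) M \<and> h' \<in> extensional (carrier (C B)) \<and>
        (\<forall>n. \<forall>x\<in>bcells B n. bar_map h' n (\<eta> B n x) = (bar_map h n \<circ> \<eta> B n) x) \<Longrightarrow> h' = f"
      using ex1 by (elim ex1E) blast
    have "?r h = f"
      by (rule u) (use mon_hom_restrict[OF Cmon[OF B] h] r in \<open>simp add: bar_map_def\<close>)
    moreover have "?r k = f"
      by (rule u) (use mon_hom_restrict[OF Cmon[OF B] k] r hk' in \<open>simp add: bar_map_def\<close>)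
    ultimately have "?r h = ?r k" by simp
    then show ?thesis using y by (metis restrict_apply')
  qed
  have G_eqI: "h y = k y" if M: "monoid M" and H: "group H" and h: "h \<in> hom (G M) H"
    and k: "k \<in> hom (G M) H"
    and hk: "\<And>x. x \<in> carrier M \<Longrightarrow> h (\<iota> M x) = k (\<iota> M x)" and y: "y \<in> carrier (G M)"
    for M H :: "'u monoid" and h k y
  proof -
    let ?r = "\<lambda>h. restrict h (carrier (G M))"
    have eq: "hom (G M) H = mon_hom (G M) H" by (rule hom_mon_hom[OF G.G_group[OF M] H])
    have c: "\<iota> M x \<in> carrier (G M)" if "x \<in> carrier M" for x
      using mon_hom_closed[OF \<iota>[OF M] that] .
    have GM: "monoid (G M)" using G.G_group[OF M] by (rule group.is_monoid)
    have "?r h \<in> hom (G M) H" "?r k \<in> hom (G M) H"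
      using h k mon_hom_restrict[OF GM] unfolding eq by auto
    moreover have "h \<circ> \<iota> M \<in> mon_hom M H" using h \<iota>[OF M] mon_hom_comp eq by blast
    ultimately have "?r h = ?r k"
      using \<iota>_univ[OF M H, of "h \<circ> \<iota> M"] hk c by auto
    then show ?thesis using y by (metis restrict_apply')
  qed
  define j where "j B e = \<iota> (C B) (edge B e)" for B e
  have "group_bar_presentation C Cmap G Gmap j"
  proof (rule group_bar_presentation.intro)
    show "group (G (C B))" if "B_object B" for B by (rule Ggrp[OF that])
    show "Gmap (C B) (C B') (Cmap B B' \<phi>) \<in> hom (G (C B)) (G (C B'))"
      if "B_object B" "B_object B'" "\<phi> \<in> B_hom B B'" for B B' \<phi>
      using that by (intro G.Gmap_hom C.Cmap_hom Cmon)
    show "j B e \<in> carrier (G (C B))" if "B_object B" "e \<in> bcells B 1" for B e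
      unfolding j_def by (rule mon_hom_closed[OF \<iota>[OF Cmon[OF that(1)]] edge[OF that]])
    show "j B (bact B 1 n (long_edge n) x) = mprod (G (C B)) (map (j B) (bedges B n x))"
      if B: "B_object B" and x: "x \<in> bcells B n" for B n x
    proof -
      have "set (map (edge B) (bedges B n x)) \<subseteq> carrier (C B)"
        using bedges_cells[OF B x] edge[OF B] by auto
      then show ?thesis
        unfolding j_def edge_rel[OF B x]
        by (simp add: mon_hom_mprod[OF \<iota>[OF Cmon[OF B]] Cmon[OF B]] comp_def del: set_map)
    qed
    show "Gmap (C B) (C B') (Cmap B B' \<phi>) (j B e) = j B' (\<phi> 1 e)"
      if B: "B_object B" "B_object B'" and \<phi>: "\<phi> \<in> B_hom B B'" and e: "e \<in> bcells B 1" for B B' \<phi> e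
    proof -
      have "Cmap B B' \<phi> (edge B e) = edge B' (\<phi> 1 e)"
        using \<eta>_nat[OF B \<phi> e] \<eta>_edge[OF B(1) e] \<eta>_edge[OF B(2) B_homD(1)[OF \<phi> e]]
        by (simp add: bar_map_def)
      then show ?thesis
        using \<iota>_nat[OF Cmon[OF B(1)] Cmon[OF B(2)] C.Cmap_hom[OF B \<phi>] edge[OF B(1) e]]
        by (simp add: j_def)
    qed
    show "\<exists>h\<in>hom (G (C B)) H. \<forall>e\<in>bcells B 1. h (j B e) = f e"
      if B: "B_object B" and H: "group H" and f: "f \<in> bcells B 1 \<rightarrow> carrier H"
        and rel: "\<And>n x. x \<in> bcells B n \<Longrightarrow> f (bact B 1 n (long_edge n) x) = mprod H (map f (bedges B n x))"
      for B and H :: "'u monoid" and f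
    proof -
      \<comment> \<open>The function \<open>f\<close> is applied along the spine. The hypothesis on
        long edges is what \<open>bedges_act\<close> needs to make this family commute with all
        active maps.\<close>
      define \<phi> where "\<phi> n x = map f (bedges B n x)" for n x
      have Hm: "monoid H" using H by (rule group.is_monoid)
      have \<phi>: "\<phi> \<in> B_hom B (bar H)"
        unfolding B_hom_def
      proof (intro CollectI conjI allI ballI)
        show "\<phi> n \<in> bcells B n \<rightarrow> bcells (bar H) n" for n
          using bedges_cells[OF B] f by (fastforce simp: \<phi>_def bar_def)
        show "\<phi> m (bact B m n g x) = bact (bar H) m n g (\<phi> n x)"
          if "g \<in> Delta_act m n" "x \<in> bcells B n" for m n g x
          unfolding \<phi>_def using bedges_act[OF B Hm f rel that] .
        show "bsplit (bar H) n m (\<phi> (n + m) x) = map_prod (\<phi> n) (\<phi> m) (bsplit B n m x)"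
          if "x \<in> bcells B (n + m)" for n m x
          using bedges_split[OF B that] by (simp add: bar_def \<phi>_def map_prod_def split_beta)
      qed
      obtain h where h: "h \<in> mon_hom (C B) H" and h\<eta>: "\<And>n x. x \<in> bcells B n \<Longrightarrow> bar_map h n (\<eta> B n x) = \<phi> n x"
        using \<eta>_univ[OF B Hm \<phi>] by blast
      obtain k where k: "k \<in> hom (G (C B)) H" and k\<iota>: "\<And>x. x \<in> carrier (C B) \<Longrightarrow> k (\<iota> (C B) x) = h x"
        using \<iota>_univ[OF Cmon[OF B] H h] by blast
      have "k (j B e) = f e" if "e \<in> bcells B 1" for e
        using k\<iota>[OF edge[OF B that]] h\<eta>[OF that] \<eta>_edge[OF B that] bedges_1[OF B that]
        by (simp add: j_def bar_map_def \<phi>_def)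
      with k show ?thesis by blast
    qed
    show "h y = k y"
      if B: "B_object B" and H: "group H" and h: "h \<in> hom (G (C B)) H" and k: "k \<in> hom (G (C B)) H"
        and hk: "\<And>e. e \<in> bcells B 1 \<Longrightarrow> h (j B e) = k (j B e)" and y: "y \<in> carrier (G (C B))"
      for B and H :: "'u monoid" and h k y
    proof (rule G_eqI[OF Cmon[OF B] H h k _ y])
      have eq: "hom (G (C B)) H = mon_hom (G (C B)) H" by (rule hom_mon_hom[OF Ggrp[OF B] H])
      \<comment> \<open>A homomorphism out of the completion is determined on the image of
        \<open>\<iota>\<close>; there the composites are monoid homomorphisms out of
        \<open>C B\<close>, to which \<open>C_eqI\<close> applies.\<close>
      have c: "h \<circ> \<iota> (C B) \<in> mon_hom (C B) H" "k \<circ> \<iota> (C B) \<in> mon_hom (C B) H"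
        using h k \<iota>[OF Cmon[OF B]] mon_hom_comp eq by blast+
      show "h (\<iota> (C B) x) = k (\<iota> (C B) x)" if "x \<in> carrier (C B)" for x
        using C_eqI[OF B group.is_monoid[OF H] c _ that] hk by (simp add: j_def)
    qed
  qed
  then show ?thesis by (rule that)
qed

section \<open>Decalage\<close>


lemma sface_sdegen:
  assumes "simplicial_set X" "x \<in> cells X n" "i \<le> n"
  shows "sface X n i (sdegen X n i x) = x" "sface X n (Suc i) (sdegen X n i x) = x"
proof -
  have "compose {..n} (codegen n i) (coface n i) = idD n"
    "compose {..n} (codegen n i) (coface n (Suc i)) = idD n"
    using assms(3) by (auto simp: compose_def codegen_def coface_def idD_def fun_eq_iff)
  then show "sface X n i (sdegen X n i x) = x" "sface X n (Suc i) (sdegen X n i x) = x"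
    using simplicial_setD(2)[OF assms(1,2)] simplicial_setD(3)[OF assms(1) coface_Delta codegen_Delta[OF assms(3)] assms(2)]
    by (simp_all add: sface_def sdegen_def)
qed

lemma sface_sdegen_le:
  assumes "simplicial_set X" "x \<in> cells X (Suc n)" "i \<le> j" "j \<le> n"
  shows "sface X (Suc n) i (sdegen X (Suc n) (Suc j) x) = sdegen X n j (sface X n i x)"
proof -
  have "compose {..Suc n} (codegen (Suc n) (Suc j)) (coface (Suc n) i) = compose {..Suc n} (coface n i) (codegen n j)"
    using assms(3,4) by (auto simp: compose_def codegen_def coface_def fun_eq_iff)
  then show ?thesis
    using simplicial_setD(3)[OF assms(1) coface_Delta codegen_Delta assms(2), of "Suc j" i]
      simplicial_setD(3)[OF assms(1) codegen_Delta coface_Delta assms(2), of j i] assms(4)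
    by (simp add: sface_def sdegen_def)
qed

lemma sface_sdegen_gt:
  assumes "simplicial_set X" "x \<in> cells X (Suc n)" "j < i" "j \<le> n"
  shows "sface X (Suc n) (Suc i) (sdegen X (Suc n) j x) = sdegen X n j (sface X n i x)"
proof -
  have "compose {..Suc n} (codegen (Suc n) j) (coface (Suc n) (Suc i)) = compose {..Suc n} (coface n i) (codegen n j)"
    using assms(3,4) by (auto simp: compose_def codegen_def coface_def fun_eq_iff)
  then show ?thesis
    using simplicial_setD(3)[OF assms(1) coface_Delta codegen_Delta assms(2), of j "Suc i"]
      simplicial_setD(3)[OF assms(1) codegen_Delta coface_Delta assms(2), of j i] assms(4)
    by (simp add: sface_def sdegen_def)
qed

lemma sdegen_sdegen:
  assumes "simplicial_set X" "x \<in> cells X n" "i \<le> j" "j \<le> n"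
  shows "sdegen X (Suc n) i (sdegen X n j x) = sdegen X (Suc n) (Suc j) (sdegen X n i x)"
proof -
  have "compose {..Suc (Suc n)} (codegen n j) (codegen (Suc n) i) = compose {..Suc (Suc n)} (codegen n i) (codegen (Suc n) (Suc j))"
    using assms(3,4) by (auto simp: compose_def codegen_def fun_eq_iff)
  then show ?thesis
    using simplicial_setD(3)[OF assms(1) codegen_Delta codegen_Delta assms(2), of i j]
      simplicial_setD(3)[OF assms(1) codegen_Delta codegen_Delta assms(2), of "Suc j" i] assms(3,4)
    by (simp add: sdegen_def)
qed

lemma sset_homD:
  assumes "\<phi> \<in> sset_hom X Y"
  shows "x \<in> cells X n \<Longrightarrow> \<phi> n x \<in> cells Y n"
    and "f \<in> Delta m n \<Longrightarrow> x \<in> cells X n \<Longrightarrow> \<phi> m (sact X m n f x) = sact Y m n f (\<phi> n x)"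
  using assms unfolding sset_hom_def by blast+

lemma sset_hom_sdegen:
  "\<phi> \<in> sset_hom X Y \<Longrightarrow> i \<le> n \<Longrightarrow> x \<in> cells X n \<Longrightarrow> \<phi> (Suc n) (sdegen X n i x) = sdegen Y n i (\<phi> n x)"
  unfolding sdegen_def by (rule sset_homD(2)[OF _ codegen_Delta])

lemma split_Delta: "(\<lambda>i\<in>{..n}. i) \<in> Delta n (n + m)" "(\<lambda>i\<in>{..m}. n + i) \<in> Delta m (n + m)"
  by (auto simp: Delta_def mono_on_def)

lemma rho_map_hom:
  assumes "\<phi> \<in> sset_hom A A'"
  shows "rho_map \<phi> \<in> B_hom (rho A) (rho A')"
  using sset_homD[OF assms] split_Delta
  by (auto simp: B_hom_def rho_def rho_map_def Delta_act_def)

lemma dec_map_hom: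
  assumes "\<phi> \<in> sset_hom X Y"
  shows "dec_map \<phi> a \<in> sset_hom (row (dec X) a) (row (dec Y) a)"
  using sset_homD[OF assms] join_Delta[OF idD_Delta]
  by (auto simp: sset_hom_def row_def dec_def dec_map_def)

section \<open>Vertices, spines and the edges of a row\<close>

definition vertex :: "'a sset \<Rightarrow> nat \<Rightarrow> nat \<Rightarrow> 'a \<Rightarrow> 'a" where
  "vertex A n i = sact A 0 n (\<lambda>_\<in>{..0}. i)"

lemma const_Delta: "i \<le> n \<Longrightarrow> (\<lambda>_\<in>{..0}. i) \<in> Delta 0 n"
  by (auto simp: Delta_def mono_on_def)

lemma vertex_closed: "simplicial_set A \<Longrightarrow> x \<in> cells A n \<Longrightarrow> i \<le> n \<Longrightarrow> vertex A n i x \<in> cells A 0"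
  unfolding vertex_def by (rule simplicial_setD(1)[OF _ const_Delta])

lemma vertex_sact:
  assumes "simplicial_set A" "f \<in> Delta m n" "x \<in> cells A n" "i \<le> m"
  shows "vertex A m i (sact A m n f x) = vertex A n (f i) x"
proof -
  have "compose {..0} f (\<lambda>_\<in>{..0::nat}. i) = (\<lambda>_\<in>{..0}. f i)" by (auto simp: compose_def)
  then show ?thesis
    using simplicial_setD(3)[OF assms(1) const_Delta[OF assms(4)] assms(2,3)] by (simp only: vertex_def)
qed

text \<open>A function on the vertices gives a cocycle on the edges, so its product along the spine
  of a cell telescopes.\<close>

lemma mprod_spine:
  assumes A: "simplicial_set A" and H: "group H" and u: "u \<in> cells A 0 \<rightarrow> carrier H"
  shows "x \<in> cells A n \<Longrightarrow>
    mprod H (map (\<lambda>e. u (vertex A 1 0 e) \<otimes>\<^bsub>H\<^esub> inv\<^bsub>H\<^esub> u (vertex A 1 1 e)) (bedges (rho A) n x)) =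
      u (vertex A n 0 x) \<otimes>\<^bsub>H\<^esub> inv\<^bsub>H\<^esub> u (vertex A n n x)"
proof (induction n arbitrary: x)
  case 0
  interpret H: group H by fact
  have "u (vertex A 0 0 x) \<in> carrier H" using u vertex_closed[OF A 0, of 0] by blast
  then show ?case by simp
next
  case (Suc n)
  interpret H: group H by fact
  have x: "x \<in> cells A (1 + n)" using Suc.prems by simp
  \<comment> \<open>The first edge \<open>a\<close> of the spine is split off; \<open>b\<close> is
    the cell on the remaining vertices.\<close>
  define a where "a = sact A 1 (1 + n) (\<lambda>i\<in>{..1}. i) x"
  define b where "b = sact A n (1 + n) (\<lambda>i\<in>{..n}. 1 + i) x"
  have b: "b \<in> cells A n" unfolding b_def by (rule simplicial_setD(1)[OF A split_Delta(2) x])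
  have edges: "bedges (rho A) (Suc n) x = a # bedges (rho A) n b"
    by (simp add: rho_def a_def b_def del: One_nat_def)
  \<comment> \<open>The end of \<open>a\<close> and the beginning of \<open>b\<close> are both
    vertex 1 of \<open>x\<close>; its two contributions cancel in the product.\<close>
  have va: "vertex A 1 0 a = vertex A (Suc n) 0 x" "vertex A 1 1 a = vertex A (Suc n) 1 x"
    unfolding a_def using vertex_sact[OF A split_Delta(1) x] by simp_all
  have vb: "vertex A n 0 b = vertex A (Suc n) 1 x" "vertex A n n b = vertex A (Suc n) (Suc n) x"
    unfolding b_def by (subst vertex_sact[OF A split_Delta(2) x]; simp)+
  have c: "u (vertex A (Suc n) i x) \<in> carrier H" if "i \<le> Suc n" for i
    using vertex_closed[OF A Suc.prems that] u by blast
  have cancel: "inv\<^bsub>H\<^esub> g \<otimes>\<^bsub>H\<^esub> (g \<otimes>\<^bsub>H\<^esub> h) = h" if "g \<in> carrier H" "h \<in> carrier H" for g h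
    using that by (simp add: H.m_assoc[symmetric])
  show ?case
    unfolding edges list.map mprod_Cons Suc.IH[OF b] va vb
    using c[of 0] c[of 1] c[of "Suc n"] cancel by (simp add: H.m_assoc)
qed

lemma row_dec_cells: "cells (row (dec X) k) n = cells X (k + n + 1)"
  by (simp add: row_def dec_def)

text \<open>The points 0 and 1 of \<open>[1]\<close> come last in the concatenation of
  \<open>[k]\<close> and \<open>[1]\<close>. Keeping 0 therefore omits the last point, and keeping 1
  omits the one before it.\<close>

lemma vertex_row_dec:
  "vertex (row (dec X) k) 1 0 e = sface X (Suc k) (Suc (Suc k)) e"
  "vertex (row (dec X) k) 1 1 e = sface X (Suc k) (Suc k) e"
proof -
  have "join k k 0 (idD k) (\<lambda>_\<in>{..0}. 0) = coface (Suc k) (Suc (Suc k))"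
    "join k k 0 (idD k) (\<lambda>_\<in>{..0}. 1) = coface (Suc k) (Suc k)"
    by (auto simp: join_def idD_def coface_def fun_eq_iff)
  then show "vertex (row (dec X) k) 1 0 e = sface X (Suc k) (Suc (Suc k)) e"
    "vertex (row (dec X) k) 1 1 e = sface X (Suc k) (Suc k) e"
    by (simp_all add: vertex_def sface_def row_def dec_def)
qed

text \<open>The map acts on the initial block and \<open>[1]\<close> is appended behind it, so the
  index \<open>i\<close> is unchanged and only the dimension grows by two.\<close>

lemma row_act_coface:
  assumes "i \<le> Suc k"
  shows "row_act (dec X) k (Suc k) (coface k i) 1 e = sface X (Suc (Suc k)) i e"
proof -
  have "join k (Suc k) 1 (coface k i) (idD 1) = coface (Suc (Suc k)) i"
    using assms by (auto simp: join_def idD_def coface_def fun_eq_iff)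
  then show ?thesis by (simp add: row_act_def sface_def dec_def)
qed

lemma row_act_codegen:
  assumes "i \<le> k"
  shows "row_act (dec X) (Suc k) k (codegen k i) 1 e = sdegen X (Suc (Suc k)) i e"
proof -
  have "join (Suc k) k 1 (codegen k i) (idD 1) = codegen (Suc (Suc k)) i"
    using assms by (auto simp: join_def idD_def codegen_def fun_eq_iff)
  then show ?thesis by (simp add: row_act_def sdegen_def dec_def)
qed

section \<open>Generators and relations for the groups of the rows, and the comparison map\<close>

context group_bar_presentation
begin

abbreviation dec_row :: "'u sset \<Rightarrow> nat \<Rightarrow> 'u bobj" where
  "dec_row X k \<equiv> rho (row (dec X) k)"

abbreviation dec_grp :: "'u sset \<Rightarrow> nat \<Rightarrow> 'u monoid" where
  "dec_grp X k \<equiv> G (C (dec_row X k))"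

abbreviation dec_gen :: "'u sset \<Rightarrow> nat \<Rightarrow> 'u \<Rightarrow> 'u" where
  "dec_gen X k \<equiv> gen (dec_row X k)"

lemma B_object_dec: "simplicial_set X \<Longrightarrow> B_object (dec_row X k)"
  by (intro B_object_rho sset_row_dec)

lemma bcells_dec: "bcells (dec_row X k) n = cells X (k + n + 1)"
  by (simp add: rho_def row_dec_cells)

lemma group_dec_grp: "simplicial_set X \<Longrightarrow> group (dec_grp X k)"
  by (intro group_GC B_object_dec)

lemma dec_gen_closed:
  "simplicial_set X \<Longrightarrow> e \<in> cells X (Suc (Suc k)) \<Longrightarrow> dec_gen X k e \<in> carrier (dec_grp X k)"
  using gen_closed[OF B_object_dec, of X e k] by (simp add: bcells_dec)

text \<open>The case \<open>n = 0\<close> of \<open>gen_long_edge\<close>: the spine of a vertex is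
  empty, so its degenerate edge is an empty product.\<close>

lemma dec_gen_degenerate:
  assumes "simplicial_set X" "y \<in> cells X (Suc k)"
  shows "dec_gen X k (sdegen X (Suc k) (Suc k) y) = \<one>\<^bsub>dec_grp X k\<^esub>"
proof -
  have "join k k 1 (idD k) (long_edge 0) = codegen (Suc k) (Suc k)"
    by (auto simp: join_def idD_def long_edge_def codegen_def fun_eq_iff)
  then have "bact (dec_row X k) 1 0 (long_edge 0) y = sdegen X (Suc k) (Suc k) y"
    by (simp add: rho_def row_def dec_def sdegen_def)
  then show ?thesis
    using gen_long_edge[OF B_object_dec[OF assms(1)], of y k 0] assms(2) by (simp add: bcells_dec)
qed

text \<open>The case \<open>n = 2\<close> of \<open>gen_long_edge\<close>. The three vertices of the
  triangle sit at positions \<open>k + 1\<close>, \<open>k + 2\<close>, \<open>k + 3\<close>;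
  omitting the middle one gives the long edge, omitting the last or the first gives the
  spine.\<close>

lemma dec_gen_triangle:
  assumes X: "simplicial_set X" and z: "z \<in> cells X (Suc (Suc (Suc k)))"
  shows "dec_gen X k (sface X (Suc (Suc k)) (Suc (Suc k)) z) =
    dec_gen X k (sface X (Suc (Suc k)) (Suc (Suc (Suc k))) z) \<otimes>\<^bsub>dec_grp X k\<^esub>
    dec_gen X k (sface X (Suc (Suc k)) (Suc k) z)"
proof -
  let ?B = "dec_row X k" and ?K = "Suc (Suc k)"
  interpret L: group "dec_grp X k" by (rule group_dec_grp[OF X])
  have B: "B_object ?B" by (rule B_object_dec[OF X])
  have maps: "join k k 1 (idD k) (long_edge 2) = coface ?K ?K"
    "join k k 1 (idD k) (\<lambda>i\<in>{..1}. i) = coface ?K (Suc ?K)"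
    "join k k 1 (idD k) (\<lambda>i\<in>{..1}. 1 + i) = coface ?K (Suc k)"
    by (auto simp: join_def idD_def long_edge_def coface_def fun_eq_iff)
  have long: "bact ?B 1 2 (long_edge 2) z = sface X ?K ?K z"
    using maps(1) by (simp add: rho_def row_def dec_def sface_def numeral_2_eq_2)
  have split: "bsplit ?B 1 1 z = (sface X ?K (Suc ?K) z, sface X ?K (Suc k) z)"
    by (simp add: rho_def row_def dec_def sface_def numeral_2_eq_2 maps(2,3)[unfolded One_nat_def])
  have z': "z \<in> bcells ?B 2" using z by (simp add: bcells_dec numeral_2_eq_2)
  have "bedges ?B (Suc 0) (sface X ?K (Suc k) z) = [sface X ?K (Suc k) z]"
    using bedges_1[OF B] sface_closed[OF X z] by (simp add: bcells_dec)
  then have "bedges ?B 2 z = [sface X ?K (Suc ?K) z, sface X ?K (Suc k) z]"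
    using split by (simp add: numeral_2_eq_2)
  then show ?thesis
    using gen_long_edge[OF B z'] long dec_gen_closed[OF X sface_closed[OF X z]] by simp
qed

lemma
  assumes X: "simplicial_set X" and f: "f \<in> Delta a' a"
  shows dec_act_hom: "decloop_act Gmap C Cmap X a' a f \<in> hom (dec_grp X a) (dec_grp X a')"
    and dec_act_gen: "e \<in> cells X (Suc (Suc a)) \<Longrightarrow>
      decloop_act Gmap C Cmap X a' a f (dec_gen X a e) = dec_gen X a' (row_act (dec X) a' a f 1 e)"
proof -
  note \<phi> = rho_map_hom[OF row_act_dec[OF X f]]
  show "decloop_act Gmap C Cmap X a' a f \<in> hom (dec_grp X a) (dec_grp X a')"
    unfolding decloop_act_def by (rule GC_map_hom[OF B_object_dec[OF X] B_object_dec[OF X] \<phi>])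
  show "decloop_act Gmap C Cmap X a' a f (dec_gen X a e) = dec_gen X a' (row_act (dec X) a' a f 1 e)"
    if "e \<in> cells X (Suc (Suc a))"
    using GC_map_gen[OF B_object_dec[OF X] B_object_dec[OF X] \<phi>] that
    by (simp add: decloop_act_def bcells_dec rho_map_def)
qed


text \<open>Without the inverse the last faces would only agree up to conjugation.\<close>

definition comparison :: "'u sset \<Rightarrow> nat \<Rightarrow> (bool \<times> 'u) list set set \<Rightarrow> 'u" where
  "comparison X k = gen_ext (dec_grp X k) (\<lambda>w. inv\<^bsub>dec_grp X k\<^esub> dec_gen X k (sdegen X (Suc k) k w))"

lemma
  assumes X: "simplicial_set X"
  shows comparison_hom: "comparison X k \<in> hom (kan_grp X k) (dec_grp X k)"
    and comparison_gen: "w \<in> cells X (Suc k) \<Longrightarrow>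
      comparison X k (kan_gen X k w) = inv\<^bsub>dec_grp X k\<^esub> dec_gen X k (sdegen X (Suc k) k w)"
proof -
  interpret L: group "dec_grp X k" by (rule group_dec_grp[OF X])
  let ?f = "\<lambda>w. inv\<^bsub>dec_grp X k\<^esub> dec_gen X k (sdegen X (Suc k) k w)"
  have f: "?f \<in> cells X (Suc k) \<rightarrow> carrier (dec_grp X k)"
    using dec_gen_closed[OF X sdegen_closed[OF X]] by simp
  \<comment> \<open>Since \<open>s_k s_k y = s_{k+1} s_k y\<close>, a relator is sent to a
    degenerate edge of the row.\<close>
  have deg: "?f (sdegen X k k y) = \<one>\<^bsub>dec_grp X k\<^esub>" if "y \<in> cells X k" for y
    using sdegen_sdegen[OF X that order_refl order_refl]
      dec_gen_degenerate[OF X sdegen_closed[OF X order_refl that]] by simp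
  show "comparison X k \<in> hom (kan_grp X k) (dec_grp X k)"
    unfolding comparison_def by (rule kan_ext(1)[OF X L.is_group f deg])
  show "w \<in> cells X (Suc k) \<Longrightarrow> comparison X k (kan_gen X k w) = ?f w"
    unfolding comparison_def by (rule kan_ext(2)[OF X L.is_group f deg])
qed

text \<open>The image of an edge is the value of the last Kan face at this edge, inverted.\<close>

lemma comparison_last_face:
  assumes X: "simplicial_set X" and e: "e \<in> cells X (Suc (Suc k))"
  shows "comparison X k (kan_gen X k (sface X (Suc k) (Suc k) e) \<otimes>\<^bsub>kan_grp X k\<^esub>
      inv\<^bsub>kan_grp X k\<^esub> kan_gen X k (sface X (Suc k) (Suc (Suc k)) e)) = inv\<^bsub>dec_grp X k\<^esub> dec_gen X k e"
proof -
  let ?K = "kan_grp X k" and ?L = "dec_grp X k" and ?z = "sdegen X (Suc (Suc k)) k e"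
  interpret K: group ?K by (rule group_kan_grp[OF X])
  interpret L: group ?L by (rule group_dec_grp[OF X])
  interpret \<Phi>: group_hom ?K ?L "comparison X k"
    by (intro group_hom.intro group_hom_axioms.intro K.is_group L.is_group comparison_hom X)
  \<comment> \<open>\<open>a\<close> and \<open>b\<close> come from the edges leading from the base
    point to the initial and to the terminal vertex of \<open>e\<close>.\<close>
  define a where "a = dec_gen X k (sdegen X (Suc k) k (sface X (Suc k) (Suc (Suc k)) e))"
  define b where "b = dec_gen X k (sdegen X (Suc k) k (sface X (Suc k) (Suc k) e))"
  have ab: "a \<in> carrier ?L" "b \<in> carrier ?L"
    unfolding a_def b_def by (intro dec_gen_closed[OF X] sdegen_closed[OF X] sface_closed[OF X e]; simp)+
  have ge: "dec_gen X k e \<in> carrier ?L" by (rule dec_gen_closed[OF X e])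
  \<comment> \<open>The spine of the triangle \<open>?z\<close> runs from the base point to the
    initial vertex of \<open>e\<close> and then along \<open>e\<close>; its long edge ends at the
    terminal vertex.\<close>
  have "sface X (Suc (Suc k)) (Suc (Suc (Suc k))) ?z = sdegen X (Suc k) k (sface X (Suc k) (Suc (Suc k)) e)"
    "sface X (Suc (Suc k)) (Suc (Suc k)) ?z = sdegen X (Suc k) k (sface X (Suc k) (Suc k) e)"
    by (rule sface_sdegen_gt[OF X e]; simp)+
  moreover have "sface X (Suc (Suc k)) (Suc k) ?z = e"
    by (rule sface_sdegen(2)[OF X e]) simp
  moreover have "?z \<in> cells X (Suc (Suc (Suc k)))" by (rule sdegen_closed[OF X _ e]) simp
  ultimately have b: "b = a \<otimes>\<^bsub>?L\<^esub> dec_gen X k e"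
    using dec_gen_triangle[OF X, of ?z k] by (simp add: a_def b_def)
  have c: "kan_gen X k (sface X (Suc k) i e) \<in> carrier ?K" for i
    by (intro kan_gen_closed[OF X] sface_closed[OF X e])
  have "comparison X k (kan_gen X k (sface X (Suc k) (Suc k) e) \<otimes>\<^bsub>?K\<^esub>
      inv\<^bsub>?K\<^esub> kan_gen X k (sface X (Suc k) (Suc (Suc k)) e)) = inv\<^bsub>?L\<^esub> b \<otimes>\<^bsub>?L\<^esub> a"
    using comparison_gen[OF X sface_closed[OF X e]] c ab by (simp add: a_def b_def)
  also have "\<dots> = inv\<^bsub>?L\<^esub> dec_gen X k e"
    using ab(1) ge by (simp add: b L.inv_mult_group L.m_assoc)
  finally show ?thesis .
qed

text \<open>The assignment on edges is a quotient of values at the two ends, so it telescopes along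
  spines and satisfies the relations of the presentation. The homomorphism is first built into a
  copy of Kan's group in \<open>'u\<close> and then carried back.\<close>

lemma ex_comparison_inverse:
  assumes X: "simplicial_set X"
  shows "\<exists>\<Psi>\<in>hom (dec_grp X k) (kan_grp X k). \<forall>e\<in>cells X (Suc (Suc k)). \<Psi> (dec_gen X k e) =
      kan_gen X k (sface X (Suc k) (Suc (Suc k)) e) \<otimes>\<^bsub>kan_grp X k\<^esub>
      inv\<^bsub>kan_grp X k\<^esub> kan_gen X k (sface X (Suc k) (Suc k) e)"
proof -
  let ?A = "row (dec X) k" and ?K = "kan_grp X k"
  interpret K: group ?K by (rule group_kan_grp[OF X])
  have A: "simplicial_set ?A" by (rule sset_row_dec[OF X])
  obtain H :: "'u monoid" and \<epsilon> where H: "group H" and \<epsilon>: "\<epsilon> \<in> iso ?K H"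
    using kan_grp_copy[OF X] .
  have \<epsilon>_hom: "\<epsilon> \<in> hom ?K H" and \<epsilon>_bij: "bij_betw \<epsilon> (carrier ?K) (carrier H)"
    using \<epsilon> by (auto simp: iso_def)
  interpret \<epsilon>: group_hom ?K H \<epsilon>
    by (intro group_hom.intro group_hom_axioms.intro K.is_group H \<epsilon>_hom)
  define u where "u v = \<epsilon> (kan_gen X k v)" for v
  define f where "f e = u (vertex ?A 1 0 e) \<otimes>\<^bsub>H\<^esub> inv\<^bsub>H\<^esub> u (vertex ?A 1 1 e)" for e
  have u: "u \<in> cells ?A 0 \<rightarrow> carrier H"
    using kan_gen_closed[OF X] by (auto simp: u_def row_dec_cells)
  have f: "f \<in> bcells (dec_row X k) 1 \<rightarrow> carrier H"
  proof
    fix e assume "e \<in> bcells (dec_row X k) 1"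
    then have "u (vertex ?A 1 i e) \<in> carrier H" if "i \<le> 1" for i
      using vertex_closed[OF A _ that] u by (auto simp: rho_def)
    then show "f e \<in> carrier H" by (simp add: f_def)
  qed
  \<comment> \<open>A cell and its long edge have the same first and last vertex, and by
    \<open>mprod_spine\<close> the product along the spine depends on these only.\<close>
  have rel: "f (bact (dec_row X k) 1 n (long_edge n) x) = mprod H (map f (bedges (dec_row X k) n x))"
    if x: "x \<in> bcells (dec_row X k) n" for n x
  proof -
    have x: "x \<in> cells ?A n" using x by (simp add: rho_def)
    have le: "long_edge n \<in> Delta 1 n" using long_edge by (simp add: Delta_act_def)
    have "f (sact ?A 1 n (long_edge n) x) = u (vertex ?A n 0 x) \<otimes>\<^bsub>H\<^esub> inv\<^bsub>H\<^esub> u (vertex ?A n n x)"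
      using vertex_sact[OF A le x] by (simp add: f_def long_edge_def)
    then show ?thesis
      using mprod_spine[OF A H u x] by (simp add: rho_def[of ?A] f_def[abs_def])
  qed
  obtain h where h: "h \<in> hom (dec_grp X k) H"
    and hf: "\<And>e. e \<in> bcells (dec_row X k) 1 \<Longrightarrow> h (dec_gen X k e) = f e"
    using GC_ext[OF B_object_dec[OF X] H f rel] by blast
  let ?\<delta> = "inv_into (carrier ?K) \<epsilon>"
  have "?\<delta> \<in> hom H ?K" using K.iso_set_sym[OF \<epsilon>] by (simp add: iso_def)
  then have "?\<delta> \<circ> h \<in> hom (dec_grp X k) ?K" using h by (rule hom_compose[rotated])
  moreover have "(?\<delta> \<circ> h) (dec_gen X k e) =
      kan_gen X k (sface X (Suc k) (Suc (Suc k)) e) \<otimes>\<^bsub>?K\<^esub> inv\<^bsub>?K\<^esub> kan_gen X k (sface X (Suc k) (Suc k) e)"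
    (is "_ = ?rhs") if e: "e \<in> cells X (Suc (Suc k))" for e
  proof -
    have c: "kan_gen X k (sface X (Suc k) i e) \<in> carrier ?K" for i
      by (intro kan_gen_closed[OF X] sface_closed[OF X e])
    have "h (dec_gen X k e) = \<epsilon> ?rhs"
      using hf[of e] e c by (simp add: bcells_dec f_def u_def vertex_row_dec[unfolded One_nat_def])
    moreover have "?rhs \<in> carrier ?K" using c by simp
    ultimately show ?thesis
      using \<epsilon>_bij by (simp only: comp_apply bij_betw_def inv_into_f_f)
  qed
  ultimately show ?thesis by blast
qed

text \<open>\<open>\<Psi>\<close> is a two-sided inverse; both composites are homomorphisms and are
  compared with the identity on generators.\<close>

lemma comparison_iso:
  assumes X: "simplicial_set X"
  shows "comparison X k \<in> iso (kan_grp X k) (dec_grp X k)"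
proof -
  let ?K = "kan_grp X k" and ?L = "dec_grp X k" and ?\<Phi> = "comparison X k"
  interpret K: group ?K by (rule group_kan_grp[OF X])
  interpret L: group ?L by (rule group_dec_grp[OF X])
  obtain \<Psi> where \<Psi>: "\<Psi> \<in> hom ?L ?K"
    and \<Psi>_all: "\<forall>e\<in>cells X (Suc (Suc k)). \<Psi> (dec_gen X k e) =
      kan_gen X k (sface X (Suc k) (Suc (Suc k)) e) \<otimes>\<^bsub>?K\<^esub> inv\<^bsub>?K\<^esub> kan_gen X k (sface X (Suc k) (Suc k) e)"
    by (rule bexE[OF ex_comparison_inverse[OF X]])
  note \<Psi>_gen = bspec[OF \<Psi>_all]
  note \<Phi> = comparison_hom[OF X]
  interpret \<Phi>: group_hom ?K ?L ?\<Phi>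
    by (intro group_hom.intro group_hom_axioms.intro K.is_group L.is_group \<Phi>)
  interpret \<Psi>: group_hom ?L ?K \<Psi>
    by (intro group_hom.intro group_hom_axioms.intro K.is_group L.is_group \<Psi>)
  have "(\<Psi> \<circ> ?\<Phi>) c = c" if "c \<in> carrier ?K" for c
  proof (rule kan_hom_eqI[where h' = "\<lambda>c. c", OF X K.is_group hom_compose[OF \<Phi> \<Psi>] _ _ that])
    show "(\<lambda>c. c) \<in> hom ?K ?K" by (simp add: hom_def)
    fix w assume w: "w \<in> cells X (Suc k)"
    have s: "sdegen X (Suc k) k w \<in> cells X (Suc (Suc k))" by (rule sdegen_closed[OF X _ w]) simp
    \<comment> \<open>The edge \<open>s_k w\<close> starts at a degenerate vertex, trivial in Kan's
      group, and ends at \<open>w\<close>. So \<open>\<Psi>\<close> returns the inverse of the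
      generator of \<open>w\<close>, which undoes the inverse in \<open>comparison\<close>.\<close>
    have "sface X (Suc k) (Suc (Suc k)) (sdegen X (Suc k) k w) = sdegen X k k (sface X k (Suc k) w)"
      by (rule sface_sdegen_gt[OF X w]) auto
    moreover have "sface X (Suc k) (Suc k) (sdegen X (Suc k) k w) = w"
      by (rule sface_sdegen(2)[OF X w]) simp
    ultimately have "\<Psi> (dec_gen X k (sdegen X (Suc k) k w)) = inv\<^bsub>?K\<^esub> kan_gen X k w"
      using \<Psi>_gen[OF s] kan_gen_degenerate[OF X sface_closed[OF X w]] kan_gen_closed[OF X w] by simp
    then show "(\<Psi> \<circ> ?\<Phi>) (kan_gen X k w) = kan_gen X k w"
      using comparison_gen[OF X w] dec_gen_closed[OF X s] kan_gen_closed[OF X w] by simp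
  qed
  moreover have "(?\<Phi> \<circ> \<Psi>) y = y" if "y \<in> carrier ?L" for y
  proof (rule GC_eqI[where k = "\<lambda>c. c", OF B_object_dec[OF X] L.is_group hom_compose[OF \<Psi> \<Phi>] _ _ that])
    show "(\<lambda>c. c) \<in> hom ?L ?L" by (simp add: hom_def)
    fix e assume "e \<in> bcells (dec_row X k) 1"
    then have e: "e \<in> cells X (Suc (Suc k))" by (simp add: bcells_dec)
    have c: "kan_gen X k (sface X (Suc k) i e) \<in> carrier ?K" for i
      by (intro kan_gen_closed[OF X] sface_closed[OF X e])
    \<comment> \<open>This is the inverse of the element treated in
      \<open>comparison_last_face\<close>.\<close>
    have "\<Psi> (dec_gen X k e) = inv\<^bsub>?K\<^esub> (kan_gen X k (sface X (Suc k) (Suc k) e) \<otimes>\<^bsub>?K\<^esub>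
        inv\<^bsub>?K\<^esub> kan_gen X k (sface X (Suc k) (Suc (Suc k)) e))"
      using \<Psi>_gen[OF e] c by (simp add: K.inv_mult_group)
    then show "(?\<Phi> \<circ> \<Psi>) (dec_gen X k e) = dec_gen X k e"
      using comparison_last_face[OF X e] c dec_gen_closed[OF X e] by simp
  qed
  ultimately have "bij_betw ?\<Phi> (carrier ?K) (carrier ?L)"
    by (intro bij_betwI[where g = \<Psi>]) auto
  then show ?thesis using \<Phi> by (simp add: iso_def)
qed

section \<open>Compatibility with faces, degeneracies and maps of simplicial sets\<close>

lemma comparison_face:
  assumes X: "simplicial_set X" and i: "i \<le> Suc k" and c: "c \<in> carrier (kan_grp X (Suc k))"
  shows "comparison X k (gface (kan_loop X) k i c) =
    decloop_act Gmap C Cmap X k (Suc k) (coface k i) (comparison X (Suc k) c)"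
proof -
  let ?K = "kan_grp X k" and ?L = "dec_grp X k" and ?D = "decloop_act Gmap C Cmap X k (Suc k) (coface k i)"
  interpret K: group ?K by (rule group_kan_grp[OF X])
  interpret L: group ?L by (rule group_dec_grp[OF X])
  interpret L': group "dec_grp X (Suc k)" by (rule group_dec_grp[OF X])
  interpret \<Phi>: group_hom ?K ?L "comparison X k"
    by (intro group_hom.intro group_hom_axioms.intro K.is_group L.is_group comparison_hom X)
  define f where "f x = (if i < Suc k then kan_gen X k (sface X (Suc k) i x)
    else kan_gen X k (sface X (Suc k) (Suc k) x)
      \<otimes>\<^bsub>?K\<^esub> inv\<^bsub>?K\<^esub> kan_gen X k (sface X (Suc k) (Suc (Suc k)) x))" for x
  have gen: "kan_gen X k (sface X (Suc k) j x) \<in> carrier ?K" if "x \<in> cells X (Suc (Suc k))" for j x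
    by (intro kan_gen_closed[OF X] sface_closed[OF X that])
  have f: "f \<in> cells X (Suc (Suc k)) \<rightarrow> carrier ?K"
    using gen by (auto simp: f_def)
  \<comment> \<open>For \<open>i < Suc k\<close> the face of a relator is again a relator. For the
    last face, both faces of \<open>s_{k+1} y\<close> involved equal \<open>y\<close>, and the
    quotient is trivial.\<close>
  have deg: "f (sdegen X (Suc k) (Suc k) y) = \<one>\<^bsub>?K\<^esub>" if y: "y \<in> cells X (Suc k)" for y
  proof (cases "i < Suc k")
    case True
    then show ?thesis
      using sface_sdegen_le[OF X y, of i k] kan_gen_degenerate[OF X sface_closed[OF X y]] by (simp add: f_def)
  next
    case False
    then show ?thesis
      using sface_sdegen[OF X y order_refl] kan_gen_closed[OF X y] by (simp add: f_def)
  qed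
  have ext: "gen_ext ?K f \<in> hom (kan_grp X (Suc k)) ?K"
    "\<And>x. x \<in> cells X (Suc (Suc k)) \<Longrightarrow> gen_ext ?K f (kan_gen X (Suc k) x) = f x"
    by (rule kan_ext[OF X K.is_group f]; (rule deg)?; assumption)+
  have face: "gface (kan_loop X) k i = gen_ext ?K f"
    by (simp add: kan_loop_def f_def[abs_def])
  have D: "?D \<in> hom (dec_grp X (Suc k)) ?L"
    by (rule dec_act_hom[OF X coface_Delta])
  interpret D: group_hom "dec_grp X (Suc k)" ?L ?D
    by (intro group_hom.intro group_hom_axioms.intro L.is_group L'.is_group D)
  have "(comparison X k \<circ> gen_ext ?K f) c = (?D \<circ> comparison X (Suc k)) c"
  proof (rule kan_hom_eqI[OF X L.is_group hom_compose[OF ext(1) comparison_hom[OF X]]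
        hom_compose[OF comparison_hom[OF X] D] _ c])
    fix w assume w: "w \<in> cells X (Suc (Suc k))"
    let ?s = "sdegen X (Suc (Suc k)) (Suc k) w"
    have s: "?s \<in> cells X (Suc (Suc (Suc k)))" by (rule sdegen_closed[OF X _ w]) simp
    have "?D (comparison X (Suc k) (kan_gen X (Suc k) w)) = inv\<^bsub>?L\<^esub> dec_gen X k (sface X (Suc (Suc k)) i ?s)"
      using comparison_gen[OF X w] dec_act_gen[OF X coface_Delta s] row_act_coface[OF i, of X ?s]
        dec_gen_closed[OF X s] by simp
    \<comment> \<open>For \<open>i < Suc k\<close> the face commutes past the degeneracy. For
      \<open>i = Suc k\<close> it removes the degeneracy and leaves \<open>w\<close> itself as an
      edge, whose image is computed by \<open>comparison_last_face\<close>.\<close>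
    moreover have "comparison X k (f w) = inv\<^bsub>?L\<^esub> dec_gen X k (sface X (Suc (Suc k)) i ?s)"
    proof (cases "i < Suc k")
      case True
      then show ?thesis
        using comparison_gen[OF X sface_closed[OF X w]] sface_sdegen_le[OF X w, of i k] by (simp add: f_def)
    next
      case False
      then have i': "i = Suc k" using i by simp
      note t = comparison_last_face[OF X w]
      show ?thesis
        using t gen[OF w] i' sface_sdegen(1)[OF X w, of "Suc k"] by (simp add: f_def)
    qed
    ultimately show "(comparison X k \<circ> gen_ext ?K f) (kan_gen X (Suc k) w) =
        (?D \<circ> comparison X (Suc k)) (kan_gen X (Suc k) w)"
      using ext(2)[OF w] by simp
  qed
  then show ?thesis by (simp add: face)
qed

lemma comparison_degen:
  assumes X: "simplicial_set X" and i: "i \<le> k" and c: "c \<in> carrier (kan_grp X k)"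
  shows "comparison X (Suc k) (gdegen (kan_loop X) k i c) =
    decloop_act Gmap C Cmap X (Suc k) k (codegen k i) (comparison X k c)"
proof -
  let ?K = "kan_grp X (Suc k)" and ?L = "dec_grp X (Suc k)" and ?D = "decloop_act Gmap C Cmap X (Suc k) k (codegen k i)"
  interpret K: group ?K by (rule group_kan_grp[OF X])
  interpret L: group ?L by (rule group_dec_grp[OF X])
  interpret L': group "dec_grp X k" by (rule group_dec_grp[OF X])
  define f where "f x = kan_gen X (Suc k) (sdegen X (Suc k) i x)" for x
  have iS: "i \<le> Suc k" using i by simp
  have f: "f \<in> cells X (Suc k) \<rightarrow> carrier ?K"
    using kan_gen_closed[OF X sdegen_closed[OF X iS]] by (auto simp: f_def)
  \<comment> \<open>Relators are preserved because \<open>s_i s_k y = s_{k+1} s_i y\<close>.\<close>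
  have deg: "f (sdegen X k k y) = \<one>\<^bsub>?K\<^esub>" if y: "y \<in> cells X k" for y
    using sdegen_sdegen[OF X y i order_refl] kan_gen_degenerate[OF X sdegen_closed[OF X i y]]
    by (simp add: f_def)
  have ext: "gen_ext ?K f \<in> hom (kan_grp X k) ?K"
    "\<And>x. x \<in> cells X (Suc k) \<Longrightarrow> gen_ext ?K f (kan_gen X k x) = f x"
    by (rule kan_ext[OF X K.is_group f]; (rule deg)?; assumption)+
  have degen: "gdegen (kan_loop X) k i = gen_ext ?K f"
    by (simp add: kan_loop_def f_def[abs_def])
  have D: "?D \<in> hom (dec_grp X k) ?L"
    by (rule dec_act_hom[OF X codegen_Delta[OF i]])
  interpret D: group_hom "dec_grp X k" ?L ?D
    by (intro group_hom.intro group_hom_axioms.intro L.is_group L'.is_group D)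
  have "(comparison X (Suc k) \<circ> gen_ext ?K f) c = (?D \<circ> comparison X k) c"
  proof (rule kan_hom_eqI[OF X L.is_group hom_compose[OF ext(1) comparison_hom[OF X]]
        hom_compose[OF comparison_hom[OF X] D] _ c])
    fix w assume w: "w \<in> cells X (Suc k)"
    let ?s = "sdegen X (Suc k) k w"
    have s: "?s \<in> cells X (Suc (Suc k))" by (rule sdegen_closed[OF X _ w]) simp
    have "?D (comparison X k (kan_gen X k w)) = inv\<^bsub>?L\<^esub> dec_gen X (Suc k) (sdegen X (Suc (Suc k)) i ?s)"
      using comparison_gen[OF X w] dec_act_gen[OF X codegen_Delta[OF i] s] row_act_codegen[OF i, of X ?s]
        dec_gen_closed[OF X s] by simp
    \<comment> \<open>The right-hand side is the edge that \<open>comparison\<close> attaches to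
      \<open>s_i w\<close> in degree \<open>Suc k\<close>.\<close>
    also have "sdegen X (Suc (Suc k)) i ?s = sdegen X (Suc (Suc k)) (Suc k) (sdegen X (Suc k) i w)"
      by (rule sdegen_sdegen[OF X w i]) simp
    finally show "(comparison X (Suc k) \<circ> gen_ext ?K f) (kan_gen X k w) = (?D \<circ> comparison X k) (kan_gen X k w)"
      using ext(2)[OF w] comparison_gen[OF X sdegen_closed[OF X iS w]] by (simp add: f_def)
  qed
  then show ?thesis by (simp add: degen)
qed

text \<open>On generators this is the commutation of \<open>\<phi>\<close> with the degeneracy
  \<open>s_k\<close>, because \<open>dec_map \<phi> k\<close> acts on edges of the row by
  \<open>\<phi> (Suc (Suc k))\<close>.\<close>

lemma comparison_natural:
  assumes X: "simplicial_set X" and Y: "simplicial_set Y" and \<phi>: "\<phi> \<in> sset_hom X Y"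
    and c: "c \<in> carrier (kan_grp X k)"
  shows "comparison Y k (kan_loop_map Y \<phi> k c) = decloop_map Gmap C Cmap X Y \<phi> k (comparison X k c)"
proof -
  let ?K = "kan_grp Y k" and ?L = "dec_grp Y k" and ?D = "decloop_map Gmap C Cmap X Y \<phi> k"
  interpret K: group ?K by (rule group_kan_grp[OF Y])
  interpret L: group ?L by (rule group_dec_grp[OF Y])
  interpret L': group "dec_grp X k" by (rule group_dec_grp[OF X])
  define f where "f x = kan_gen Y k (\<phi> (Suc k) x)" for x
  have f: "f \<in> cells X (Suc k) \<rightarrow> carrier ?K"
    using kan_gen_closed[OF Y sset_homD(1)[OF \<phi>]] by (auto simp: f_def)
  have deg: "f (sdegen X k k y) = \<one>\<^bsub>?K\<^esub>" if y: "y \<in> cells X k" for y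
    using sset_hom_sdegen[OF \<phi> order_refl y] kan_gen_degenerate[OF Y sset_homD(1)[OF \<phi> y]]
    by (simp add: f_def)
  have ext: "gen_ext ?K f \<in> hom (kan_grp X k) ?K"
    "\<And>x. x \<in> cells X (Suc k) \<Longrightarrow> gen_ext ?K f (kan_gen X k x) = f x"
    by (rule kan_ext[OF X K.is_group f]; (rule deg)?; assumption)+
  have map: "kan_loop_map Y \<phi> k = gen_ext ?K f"
    by (simp add: kan_loop_map_def f_def[abs_def])
  note \<phi>' = rho_map_hom[OF dec_map_hom[OF \<phi>]]
  have D: "?D \<in> hom (dec_grp X k) ?L"
    unfolding decloop_map_def by (rule GC_map_hom[OF B_object_dec[OF X] B_object_dec[OF Y] \<phi>'])
  interpret D: group_hom "dec_grp X k" ?L ?D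
    by (intro group_hom.intro group_hom_axioms.intro L.is_group L'.is_group D)
  have "(comparison Y k \<circ> gen_ext ?K f) c = (?D \<circ> comparison X k) c"
  proof (rule kan_hom_eqI[OF X L.is_group hom_compose[OF ext(1) comparison_hom[OF Y]]
        hom_compose[OF comparison_hom[OF X] D] _ c])
    fix w assume w: "w \<in> cells X (Suc k)"
    let ?s = "sdegen X (Suc k) k w"
    have s: "?s \<in> cells X (Suc (Suc k))" by (rule sdegen_closed[OF X _ w]) simp
    have "?D (dec_gen X k ?s) = dec_gen Y k (\<phi> (Suc (Suc k)) ?s)"
      using GC_map_gen[OF B_object_dec[OF X] B_object_dec[OF Y] \<phi>'] s
      by (simp add: decloop_map_def bcells_dec rho_map_def dec_map_def)
    then show "(comparison Y k \<circ> gen_ext ?K f) (kan_gen X k w) = (?D \<circ> comparison X k) (kan_gen X k w)"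
      using ext(2)[OF w] comparison_gen[OF X w] comparison_gen[OF Y sset_homD(1)[OF \<phi> w]]
        dec_gen_closed[OF X s] sset_hom_sdegen[OF \<phi> _ w, of k] by (simp add: f_def)
  qed
  then show ?thesis by (simp add: map)
qed

end

theorem proposition6p9:
  fixes cobar :: "'u::infinite bobj \<Rightarrow> 'u monoid"
    and cobar_map :: "'u bobj \<Rightarrow> 'u bobj \<Rightarrow> (nat \<Rightarrow> 'u \<Rightarrow> 'u) \<Rightarrow> 'u \<Rightarrow> 'u"
    and G :: "'u monoid \<Rightarrow> 'u monoid"
    and G_map :: "'u monoid \<Rightarrow> 'u monoid \<Rightarrow> ('u \<Rightarrow> 'u) \<Rightarrow> 'u \<Rightarrow> 'u"
  assumes "left_adjoint_of_bar cobar cobar_map"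
    and "group_completion G G_map"
  shows "\<exists>\<Phi> :: 'u sset \<Rightarrow> nat \<Rightarrow> (bool \<times> 'u) list set set \<Rightarrow> 'u.
    (\<forall>X. simplicial_set X \<longrightarrow>
       \<Phi> X \<in> sgroup_iso (kan_loop X) (decloop G G_map cobar cobar_map X)) \<and>
    (\<forall>X Y \<phi>. simplicial_set X \<longrightarrow> simplicial_set Y \<longrightarrow> \<phi> \<in> sset_hom X Y \<longrightarrow>
       (\<forall>k. \<forall>c\<in>carrier (gcells (kan_loop X) k).
          \<Phi> Y k (kan_loop_map Y \<phi> k c) =
            decloop_map G_map cobar cobar_map X Y \<phi> k (\<Phi> X k c)))"
proof -
  \<comment> \<open>The two adjunctions enter only through this presentation. The generators are
    chosen once, so \<open>comparison\<close> is a single family for all \<open>X\<close>.\<close>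
  obtain gen where "group_bar_presentation cobar cobar_map G G_map gen"
    by (rule ex_group_bar_presentation[OF assms])
  then interpret group_bar_presentation cobar cobar_map G G_map gen .
  have cells: "gcells (kan_loop X) = kan_grp X" for X :: "'u sset"
    by (simp add: kan_loop_def)
  show ?thesis
  proof (intro exI[of _ comparison] conjI allI impI ballI)
    show "comparison X \<in> sgroup_iso (kan_loop X) (decloop G G_map cobar cobar_map X)"
      if "simplicial_set X" for X
      using comparison_iso[OF that] comparison_face[OF that] comparison_degen[OF that]
      by (simp add: sgroup_iso_def decloop_def cells)
    show "comparison Y k (kan_loop_map Y \<phi> k c) =
        decloop_map G_map cobar cobar_map X Y \<phi> k (comparison X k c)"
      if "simplicial_set X" "simplicial_set Y" "\<phi> \<in> sset_hom X Y" "c \<in> carrier (gcells (kan_loop X) k)"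
      for X Y \<phi> k c
      using comparison_natural that by (simp add: cells)
  qed
qed

end
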